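(* Let $(h_h,\boldsymbol u_h)\in V_h^k\times \boldsymbol V_h^k$ be a (time-dependent) solution, with $h_h>0$, of the semi-discrete DG scheme: for all $(e_h,\boldsymbol v_h)\in V_h^k\times\boldsymbol V_h^k$, $$M_h\big((h_h)_t,e_h\big)+A_h\big((h_h,\boldsymbol u_h),e_h\big)=0,$$ $$\boldsymbol M_h\big((h_h\boldsymbol u_h)_t,\boldsymbol v_h\big)+B_h\big((h_h,\boldsymbol u_h),\boldsymbol v_h\big)+C_h\big((h_h,\boldsymbol u_h),\boldsymbol v_h\big)-M_h\big((h_h)_t,\tfrac12\boldsymbol u_h\cdot\boldsymbol v_h\big)-A_h\big((h_h,\boldsymbol u_h),\tfrac12\boldsymbol u_h\cdot\boldsymbol v_h\big)=0,$$ where the spaces, operators and numerical fluxes are those defined in the context. Then the scheme is: (a) locally conservative: for every $K\in\Omega_h$, $$\frac{d}{dt}\int_K h_h\,\mathrm{d}x=-\int_{\partial K}\widehat{h_h\boldsymbol u_h}\cdot\boldsymbol n_K\,\mathrm{d}s,$$ $$\frac{d}{dt}\int_K h_h\boldsymbol u_h\,\mathrm{d}x=-\int_{\partial K}\widehat{(h_h\boldsymbol u_h\boldsymbol u_h)}\boldsymbol n_K\,\mathrm{d}s-\int_K g h_h\nabla b_h\,\mathrm{d}x+\int_{\partial K}\tfrac12 g h_h b_h\boldsymbol n_K\,\mathrm{d}s;$$ (b) entropy stable: $$\frac{d}{dt}E_h=-\sum_{F\in\mathcal E_h}\int_F\tfrac12\alpha_h\Big(g[\![h_h+b_h]\!]^2+\{h_h+b_h\}[\![\boldsymbol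 u_h]\!]\cdot[\![\boldsymbol u_h]\!]\Big)\,\mathrm{d}s\le 0,$$ where the discrete entropy (total energy) is $$E_h:=\sum_{K\in\Omega_h}\int_K\Big(\tfrac12 h_h|\boldsymbol u_h|^2+\tfrac12 g h_h^2+g h_h b_h\Big)\,\mathrm{d}x;$$ (c) well-balanced: if the initial condition satisfies $\boldsymbol u_h(0)=0$ and $h_h(0)+b_h=C$ for a constant $C$, then the solution satisfies $\boldsymbol u_h(t)=0$ and $h_h(t)+b_h=C$ for all times $t$.
   Context: Setting. $\Omega\subset\mathbb R^2$ is a periodic domain (periodic boundary conditions), $\Omega_h=\{K\}$ is a conforming triangulation of $\Omega$, $\boldsymbol n_K$ is the outward unit normal on $\partial K$, and $\mathcal E_h=\{F\}$ is the set of edges. For an integer $k\ge 0$, $$V_h^k:=\{v\in L^2(\Omega): v|_K\in\mathcal P_k(K)\ \ \forall K\in\Omega_h\},$$ where $\mathcal P_k(K)$ is the space of polynomials of degree at most $k$ on $K$, and $\boldsymbol V_h^k$ is the corresponding space of vector fields with two components in $V_h^k$. The constant $g>0$ is the gravitational constant. The function $b_h\in V_h^k$ is a given time-independent approximation of the bottom topography. A subscript $t$ denotes the time derivative. The unknowns $h_h$ (water height, positive) and $\boldsymbol u_h$ (velocity) depend on time, and at each time belong to $V_h^k$ and $\boldsymbol V_h^k$. Jumps and averages. On an edge $F=K^+\cap K^-$ let $\boldsymbol n$ be the unit normal on $F$ pointing towards $K^-$, $\phi^\pm:=\phi|_{K^\pm}$ (traces on $F$), $[\![\phi]\!]:=\phi^+-\phi^-$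 and $\{\phi\}:=\frac12(\phi^++\phi^-)$ (componentwise for vector-valued functions). Numerical fluxes on $F$: $$\widehat{h_h\boldsymbol u_h}\cdot\boldsymbol n:=\{h_h\boldsymbol u_h\}\cdot\boldsymbol n+\tfrac12\alpha_h[\![h_h+b_h]\!],$$ $$\widehat{(h_h\boldsymbol u_h\boldsymbol u_h)}\boldsymbol n:=\big(\{h_h\boldsymbol u_h\}\cdot\boldsymbol n\big)\{\boldsymbol u_h\}+\tfrac12\alpha_h[\![(h_h+b_h)\boldsymbol u_h]\!],$$ $$\alpha_h|_F:=\max\Big\{\sqrt{g h_h^+}+|\boldsymbol u_h^+\cdot\boldsymbol n|,\ \sqrt{g h_h^-}+|\boldsymbol u_h^-\cdot\boldsymbol n|\Big\}.$$ In integrals over $\partial K$, the fluxes with $\boldsymbol n_K$ are obtained by taking $K^+=K$, $\boldsymbol n=\boldsymbol n_K$ on each edge of $K$, and $h_h$, $b_h$ and test functions appearing outside the fluxes denote traces from inside $K$. Operators (the second argument $e_h$ may be any piecewise polynomial, such as $\frac12\boldsymbol u_h\cdot\boldsymbol v_h$): $$M_h((h_h)_t,e_h):=\sum_{K\in\Omega_h}\int_K (h_h)_t\,e_h\,\mathrm{d}x,\qquad \boldsymbol M_h((h_h\boldsymbol u_h)_t,\boldsymbol v_h):=\sum_{K\in\Omega_h}\int_K (h_h\boldsymbol u_h)_t\cdot\boldsymbol v_h\,\mathrm{d}x,$$ $$A_h((h_h,\boldsymbol u_h),e_h):=-\sum_{K\in\Omega_h}\int_K h_h\boldsymbol u_h\cdot\nabla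 e_h\,\mathrm{d}x+\sum_{F\in\mathcal E_h}\int_F\widehat{h_h\boldsymbol u_h}\cdot\boldsymbol n\,[\![e_h]\!]\,\mathrm{d}s,$$ $$B_h((h_h,\boldsymbol u_h),\boldsymbol v_h):=-\sum_{K\in\Omega_h}\int_K h_h(\boldsymbol u_h\otimes\boldsymbol u_h):\nabla\boldsymbol v_h\,\mathrm{d}x+\sum_{F\in\mathcal E_h}\int_F\widehat{(h_h\boldsymbol u_h\boldsymbol u_h)}\boldsymbol n\cdot[\![\boldsymbol v_h]\!]\,\mathrm{d}s,$$ $$C_h((h_h,\boldsymbol u_h),\boldsymbol v_h):=\sum_{K\in\Omega_h}\int_K g h_h\nabla(h_h+b_h)\cdot\boldsymbol v_h\,\mathrm{d}x-\sum_{F\in\mathcal E_h}\int_F g[\![h_h+b_h]\!]\,\{h_h\boldsymbol v_h\}\cdot\boldsymbol n\,\mathrm{d}s.$$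
   Formalization: Two claims false as printed are corrected: the momentum balance in (a) gains the term −∫_{∂K} ½ g h_h (h_h^- + b_h^-) n_K ds (^-: neighbour's trace), and the inequality dE_h/dt ≤ 0 in (b) is asserted at times when {h_h+b_h} ≥ 0 on all edges. *)

theory Defs
  imports "HOL-Analysis.Analysis"
begin

type_synonym point = "real ^ 2"
type_synonym elem = "point set"

section \<open>Periodic conforming triangulations\<close>

text \<open>
  The periodic domain is the torus obtained from the plane by dividing out the lattice spanned
  by two periods \<open>p\<close>, \<open>q\<close>. It is represented by a finite set of closed triangles \<open>\<T>\<close> whose
  lattice translates tile the plane conformingly; \<open>\<Union>\<T>\<close> is then a fundamental domain, for example
  a rectangle whose triangulation matches on opposite sides.
\<close>

definition lattice :: "point \<Rightarrow> point \<Rightarrow> point set" where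
  "lattice p q = {of_int m *\<^sub>R p + of_int n *\<^sub>R q | m n. True}"

definition periodic_triangulation :: "point \<Rightarrow> point \<Rightarrow> elem set \<Rightarrow> bool" where
  "periodic_triangulation p q \<T> \<longleftrightarrow>
     p \<noteq> q \<and> independent {p, q} \<and>
     finite \<T> \<and> (\<forall>K\<in>\<T>. 2 simplex K) \<and>
     (\<Union>K\<in>\<T>. \<Union>l\<in>lattice p q. (+) l ` K) = UNIV \<and>
     (\<forall>K\<in>\<T>. \<forall>K'\<in>\<T>. \<forall>l\<in>lattice p q. (K, 0) \<noteq> (K', l) \<longrightarrow>
        interior K \<inter> interior ((+) l ` K') = {} \<and>
        (K \<inter> (+) l ` K') face_of K \<and> (K \<inter> (+) l ` K') face_of ((+) l ` K'))"

text \<open>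
  An oriented edge: the common side of \<open>K\<^sup>+\<close> and of the translate of \<open>K\<^sup>-\<close> by a lattice vector
  (nonzero if the edge crosses the periodic boundary). It is positioned on the boundary of \<open>K\<^sup>+\<close>.
\<close>

datatype edge = Edge (Kplus: elem) (Kminus: elem) (shift: point)

definition edge_set :: "edge \<Rightarrow> point set" where
  "edge_set F = Kplus F \<inter> (+) (shift F) ` Kminus F"

definition flip :: "edge \<Rightarrow> edge" where
  "flip F = Edge (Kminus F) (Kplus F) (- shift F)"

definition oriented_edges :: "point \<Rightarrow> point \<Rightarrow> elem set \<Rightarrow> edge set" where
  "oriented_edges p q \<T> =
     {F. Kplus F \<in> \<T> \<and> Kminus F \<in> \<T> \<and> shift F \<in> lattice p q \<and> aff_dim (edge_set F) = 1}"

text \<open>\<open>\<E>\<close> contains every edge exactly once, with an arbitrary choice of \<open>K\<^sup>+\<close> and \<open>K\<^sup>-\<close>.\<close>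

definition mesh_edges :: "point \<Rightarrow> point \<Rightarrow> elem set \<Rightarrow> edge set \<Rightarrow> bool" where
  "mesh_edges p q \<T> \<E> \<longleftrightarrow>
     \<E> \<subseteq> oriented_edges p q \<T> \<and> (\<forall>F\<in>oriented_edges p q \<T>. F \<in> \<E> \<longleftrightarrow> flip F \<notin> \<E>)"

text \<open>Unit normal on the edge, outward from \<open>K\<^sup>+\<close> and hence pointing towards \<open>K\<^sup>-\<close>.\<close>

definition normal :: "edge \<Rightarrow> point" where
  "normal F = (THE n. norm n = 1 \<and> (\<forall>x\<in>edge_set F. \<forall>y\<in>Kplus F. n \<bullet> (y - x) \<le> 0))"

text \<open>
  Arc length integral over a segment; the value does not depend on which endpoint is called \<open>a\<close>.
\<close>

definition segment_integral :: "point set \<Rightarrow> (point \<Rightarrow> 'v) \<Rightarrow> 'v::real_normed_vector" where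
  "segment_integral S f =
     (let (a, b) = (SOME (a, b). S = closed_segment a b)
      in dist a b *\<^sub>R integral {0..1} (\<lambda>s. f (linepath a b s)))"

definition edge_integral :: "edge \<Rightarrow> (point \<Rightarrow> 'v) \<Rightarrow> 'v::real_normed_vector" where
  "edge_integral F f = segment_integral (edge_set F) f"

text \<open>
  Integral over \<open>\<partial>K\<close>. The integrand takes the edge, oriented such that \<open>K\<^sup>+ = K\<close>, as an argument,
  so that \<open>normal F\<close> is the outward normal of \<open>K\<close>.
\<close>

definition boundary_integral ::
  "point \<Rightarrow> point \<Rightarrow> elem set \<Rightarrow> elem \<Rightarrow> (edge \<Rightarrow> point \<Rightarrow> 'v) \<Rightarrow> 'v::real_normed_vector" where
  "boundary_integral p q \<T> K f = (\<Sum>F\<in>{F \<in> oriented_edges p q \<T>. Kplus F = K}. edge_integral F (f F))"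

section \<open>Piecewise polynomials, traces\<close>

text \<open>
  A piecewise polynomial \<open>v\<close> is given by the family of its restrictions: \<open>v K\<close> is the polynomial
  that agrees with \<open>v\<close> on \<open>K\<close> (unique, since \<open>K\<close> has interior points). This makes the traces on
  an edge from its two sides available.
\<close>

type_synonym 'v broken = "elem \<Rightarrow> point \<Rightarrow> 'v"

definition polys :: "nat \<Rightarrow> (point \<Rightarrow> real) set" where
  "polys k = {f. \<exists>c :: nat \<Rightarrow> nat \<Rightarrow> real. \<forall>x. f x = (\<Sum>i\<le>k. \<Sum>j\<le>k - i. c i j * (x $ 1) ^ i * (x $ 2) ^ j)}"

definition Vh :: "nat \<Rightarrow> elem set \<Rightarrow> real broken set" where
  "Vh k \<T> = {v. \<forall>K\<in>\<T>. v K \<in> polys k}"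

definition VVh :: "nat \<Rightarrow> elem set \<Rightarrow> point broken set" where
  "VVh k \<T> = {v. \<forall>i. (\<lambda>K x. v K x $ i) \<in> Vh k \<T>}"

definition trace_plus :: "edge \<Rightarrow> 'v broken \<Rightarrow> point \<Rightarrow> 'v" where
  "trace_plus F \<phi> x = \<phi> (Kplus F) x"

definition trace_minus :: "edge \<Rightarrow> 'v broken \<Rightarrow> point \<Rightarrow> 'v" where
  "trace_minus F \<phi> x = \<phi> (Kminus F) (x - shift F)"

definition jump :: "edge \<Rightarrow> 'v broken \<Rightarrow> point \<Rightarrow> 'v::real_vector" where
  "jump F \<phi> x = trace_plus F \<phi> x - trace_minus F \<phi> x"

definition avg :: "edge \<Rightarrow> 'v broken \<Rightarrow> point \<Rightarrow> 'v::real_vector" where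
  "avg F \<phi> x = (1 / 2) *\<^sub>R (trace_plus F \<phi> x + trace_minus F \<phi> x)"

definition grad :: "(point \<Rightarrow> real) \<Rightarrow> point \<Rightarrow> point" where
  "grad f x = (THE D. GDERIV f x :> D)"

definition outer :: "point \<Rightarrow> point \<Rightarrow> real ^ 2 ^ 2" where
  "outer a b = (\<chi> i j. a $ i * b $ j)"

section \<open>Numerical fluxes\<close>

definition alpha :: "real \<Rightarrow> real broken \<Rightarrow> point broken \<Rightarrow> edge \<Rightarrow> point \<Rightarrow> real" where
  "alpha g h u F x =
     max (sqrt (g * trace_plus F h x) + \<bar>trace_plus F u x \<bullet> normal F\<bar>)
         (sqrt (g * trace_minus F h x) + \<bar>trace_minus F u x \<bullet> normal F\<bar>)"

definition mass_flux ::
  "real \<Rightarrow> real broken \<Rightarrow> real broken \<Rightarrow> point broken \<Rightarrow> edge \<Rightarrow> point \<Rightarrow> real" where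
  "mass_flux g b h u F x =
     avg F (\<lambda>K y. h K y *\<^sub>R u K y) x \<bullet> normal F
     + 1 / 2 * alpha g h u F x * jump F (\<lambda>K y. h K y + b K y) x"

definition momentum_flux ::
  "real \<Rightarrow> real broken \<Rightarrow> real broken \<Rightarrow> point broken \<Rightarrow> edge \<Rightarrow> point \<Rightarrow> point" where
  "momentum_flux g b h u F x =
     (avg F (\<lambda>K y. h K y *\<^sub>R u K y) x \<bullet> normal F) *\<^sub>R avg F u x
     + (1 / 2 * alpha g h u F x) *\<^sub>R jump F (\<lambda>K y. (h K y + b K y) *\<^sub>R u K y) x"

section \<open>Operators and the semi-discrete scheme\<close>

definition Mh :: "elem set \<Rightarrow> real broken \<Rightarrow> real broken \<Rightarrow> real" where
  "Mh \<T> w e = (\<Sum>K\<in>\<T>. integral K (\<lambda>x. w K x * e K x))"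

definition MMh :: "elem set \<Rightarrow> point broken \<Rightarrow> point broken \<Rightarrow> real" where
  "MMh \<T> w v = (\<Sum>K\<in>\<T>. integral K (\<lambda>x. w K x \<bullet> v K x))"

definition Ah ::
  "elem set \<Rightarrow> edge set \<Rightarrow> real \<Rightarrow> real broken \<Rightarrow> real broken \<Rightarrow> point broken \<Rightarrow> real broken \<Rightarrow> real" where
  "Ah \<T> \<E> g b h u e =
     - (\<Sum>K\<in>\<T>. integral K (\<lambda>x. (h K x *\<^sub>R u K x) \<bullet> grad (e K) x))
     + (\<Sum>F\<in>\<E>. edge_integral F (\<lambda>x. mass_flux g b h u F x * jump F e x))"

text \<open>The inner product of \<^typ>\<open>real ^ 2 ^ 2\<close> is the Frobenius product of matrices.\<close>

definition Bh ::
  "elem set \<Rightarrow> edge set \<Rightarrow> real \<Rightarrow> real broken \<Rightarrow> real broken \<Rightarrow> point broken \<Rightarrow> point broken \<Rightarrow> real" where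
  "Bh \<T> \<E> g b h u v =
     - (\<Sum>K\<in>\<T>. integral K (\<lambda>x. h K x * (outer (u K x) (u K x) \<bullet> jacobian (v K) (at x))))
     + (\<Sum>F\<in>\<E>. edge_integral F (\<lambda>x. momentum_flux g b h u F x \<bullet> jump F v x))"

definition Ch ::
  "elem set \<Rightarrow> edge set \<Rightarrow> real \<Rightarrow> real broken \<Rightarrow> real broken \<Rightarrow> point broken \<Rightarrow> real" where
  "Ch \<T> \<E> g b h v =
     (\<Sum>K\<in>\<T>. integral K (\<lambda>x. g * h K x * (grad (\<lambda>y. h K y + b K y) x \<bullet> v K x)))
     - (\<Sum>F\<in>\<E>. edge_integral F (\<lambda>x.
          g * jump F (\<lambda>K y. h K y + b K y) x * (avg F (\<lambda>K y. h K y *\<^sub>R v K y) x \<bullet> normal F)))"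

definition time_deriv :: "real set \<Rightarrow> (real \<Rightarrow> 'v broken) \<Rightarrow> real \<Rightarrow> 'v::real_normed_vector broken" where
  "time_deriv I \<phi> t K x = vector_derivative (\<lambda>s. \<phi> s K x) (at t within I)"

definition dg_solution ::
  "nat \<Rightarrow> elem set \<Rightarrow> edge set \<Rightarrow> real \<Rightarrow> real broken \<Rightarrow> real set
     \<Rightarrow> (real \<Rightarrow> real broken) \<Rightarrow> (real \<Rightarrow> point broken) \<Rightarrow> bool" where
  "dg_solution k \<T> \<E> g b I h u \<longleftrightarrow> (\<forall>t\<in>I.
     h t \<in> Vh k \<T> \<and> u t \<in> VVh k \<T> \<and>
     (\<forall>K\<in>\<T>. \<forall>x\<in>K. h t K x > 0 \<and>
        (\<lambda>s. h s K x) differentiable (at t within I) \<and>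
        (\<lambda>s. u s K x) differentiable (at t within I)) \<and>
     (\<forall>e\<in>Vh k \<T>. Mh \<T> (time_deriv I h t) e + Ah \<T> \<E> g b (h t) (u t) e = 0) \<and>
     (\<forall>v\<in>VVh k \<T>.
        MMh \<T> (time_deriv I (\<lambda>s K x. h s K x *\<^sub>R u s K x) t) v
        + Bh \<T> \<E> g b (h t) (u t) v + Ch \<T> \<E> g b (h t) v
        - Mh \<T> (time_deriv I h t) (\<lambda>K x. 1 / 2 * (u t K x \<bullet> v K x))
        - Ah \<T> \<E> g b (h t) (u t) (\<lambda>K x. 1 / 2 * (u t K x \<bullet> v K x)) = 0))"

definition entropy :: "elem set \<Rightarrow> real \<Rightarrow> real broken \<Rightarrow> real broken \<Rightarrow> point broken \<Rightarrow> real" where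
  "entropy \<T> g b h u =
     (\<Sum>K\<in>\<T>. integral K (\<lambda>x. 1 / 2 * h K x * (norm (u K x))\<^sup>2 + 1 / 2 * g * (h K x)\<^sup>2 + g * h K x * b K x))"

definition entropy_production ::
  "edge set \<Rightarrow> real \<Rightarrow> real broken \<Rightarrow> real broken \<Rightarrow> point broken \<Rightarrow> real" where
  "entropy_production \<E> g b h u =
     - (\<Sum>F\<in>\<E>. edge_integral F (\<lambda>x. 1 / 2 * alpha g h u F x *
          (g * (jump F (\<lambda>K y. h K y + b K y) x)\<^sup>2
           + avg F (\<lambda>K y. h K y + b K y) x * (jump F u x \<bullet> jump F u x))))"

end

theory Submission
  imports Defs
begin

text \<open>
  All three parts test the scheme with functions for which most terms cancel.

  \<^item> Conservation. A test function that is constant on one element and zero elsewhere has no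
  gradient, so only edge terms remain (\<open>Ah_element_indicator\<close>, \<open>Bh_element_indicator\<close>). Every side
  of an element belongs to exactly one oriented edge and \<open>\<E>\<close> contains one of its two orientations;
  since the fluxes change sign with the orientation, the sum over \<open>\<E>\<close> becomes the integral over the
  boundary of the element (\<open>edge_sum_element\<close>). The correction with \<open>1/2 u \<bullet> v\<close> in the momentum
  equation vanishes because this is itself an admissible test function when \<open>v\<close> is elementwise
  constant. Only the pressure needs the divergence theorem, applied to \<open>1/2 g h^2\<close>
  (\<open>pressure_balance\<close>).

  \<^item> Energy. The rate of the energy density is
  \<open>(h u)_t \<bullet> u - 1/2 h_t |u|^2 + g (h + b) h_t\<close>, that is, the scheme tested with \<open>v = u\<close> and
  \<open>e = g (h + b)\<close>. Volume terms cancel pointwise, and on the edges the product rule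
  \<open>[a b] = {a} [b] + [a] {b}\<close> leaves the production term (\<open>entropy_identity\<close>).

  \<^item> Lake at rest. The production has no sign while \<open>{h + b}\<close> may be negative, so decay of the
  energy is not available. Instead, the energy relative to the state at rest,
  \<open>1/2 h |u|^2 + 1/2 g (h + b - C)^2\<close>, has the same production because the total mass is conserved.
  On a compact time interval the solution is bounded and \<open>h\<close> is bounded away from zero, and point
  values of polynomials are controlled by their mean squares (\<open>polys_bounded_by_L2\<close>); hence the
  production is at most \<open>L\<close> times the relative energy (\<open>production_le_relative_energy\<close>) and
  Gronwall's inequality keeps it at zero.

  The time derivative is only assumed pointwise. Interpolating at finitely many points of \<open>K\<close> writes
  the solution as a finite sum of products \<open>c(t) G(x)\<close>, for which differentiation under the integral
  is elementary (\<open>separable_polys\<close>, \<open>has_derivative_integral_separable\<close>).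
\<close>

section \<open>The divergence theorem on a triangle\<close>

definition cross2 :: "point \<Rightarrow> point \<Rightarrow> real" where
  "cross2 v w = v $ 1 * w $ 2 - v $ 2 * w $ 1"

text \<open>
  The Duffy map: it collapses the top side of the unit square to the vertex \<open>c\<close>. Pulling integrals
  back to a square instead of a triangle keeps the integrand continuous on a box, so the iterated
  integral for continuous functions suffices.
\<close>

definition duffy :: "point \<Rightarrow> point \<Rightarrow> point \<Rightarrow> point \<Rightarrow> point" where
  "duffy a b c x = a + (x $ 1 * (1 - x $ 2)) *\<^sub>R (b - a) + (x $ 2) *\<^sub>R (c - a)"

lemma has_derivative_duffy:
  "(duffy a b c has_derivative
     (\<lambda>v. (v $ 1 * (1 - x $ 2) - x $ 1 * v $ 2) *\<^sub>R (b - a) + (v $ 2) *\<^sub>R (c - a))) (at x within S)"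
  unfolding duffy_def
  by (auto intro!: derivative_eq_intros bounded_linear.has_derivative[OF bounded_linear_vec_nth]
      simp: algebra_simps)

lemma det_duffy:
  "det (matrix (\<lambda>v. (v $ 1 * (1 - x $ 2) - x $ 1 * v $ 2) *\<^sub>R (b - a) + (v $ 2) *\<^sub>R (c - a)))
     = (1 - x $ 2) * cross2 (b - a) (c - a)"
  by (simp add: det_2 matrix_def axis_def cross2_def algebra_simps)

lemma cross2_solve:
  assumes "cross2 v w \<noteq> 0" "s *\<^sub>R v + t *\<^sub>R w = s' *\<^sub>R v + t' *\<^sub>R w"
  shows "s = s'" "t = t'"
proof -
  have 1: "(s - s') * v $ i + (t - t') * w $ i = 0" for i
    using assms(2) by (simp add: vec_eq_iff algebra_simps)
  have "(s - s') * cross2 v w = ((s - s') * v $ 1 + (t - t') * w $ 1) * w $ 2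
      - ((s - s') * v $ 2 + (t - t') * w $ 2) * w $ 1"
    "(t - t') * cross2 v w = ((s - s') * v $ 2 + (t - t') * w $ 2) * v $ 1
      - ((s - s') * v $ 1 + (t - t') * w $ 1) * v $ 2"
    by (simp_all add: cross2_def algebra_simps)
  then have "(s - s') * cross2 v w = 0" "(t - t') * cross2 v w = 0"
    unfolding 1 by simp_all
  then show "s = s'" "t = t'" using assms(1) by simp_all
qed

lemma continuous_on_vector_2:
  fixes f g :: "'a::topological_space \<Rightarrow> real"
  assumes "continuous_on S f" "continuous_on S g"
  shows "continuous_on S (\<lambda>x. vector [f x, g x] :: point)"
proof -
  have "continuous_on S (\<lambda>x. (\<chi> i. if i = 1 then f x else g x) :: point)"
  proof (intro continuous_on_vec_lambda)
    show "continuous_on S (\<lambda>x. if i = 1 then f x else g x)" for i :: 2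
      using assms by (cases "i = 1") auto
  qed
  moreover have "(\<chi> i. if i = 1 then f x else g x) = (vector [f x, g x] :: point)" for x
    by (simp add: vec_eq_iff forall_2)
  ultimately show ?thesis by simp
qed

lemma absolutely_integrable_continuous_on_compact:
  fixes f :: "'a::euclidean_space \<Rightarrow> 'b::euclidean_space"
  assumes "compact S" "continuous_on S f"
  shows "f absolutely_integrable_on S"
proof -
  have "integrable lborel (\<lambda>x. indicator S x *\<^sub>R f x)"
    by (rule borel_integrable_compact[OF assms])
  then have "integrable lebesgue (\<lambda>x. indicator S x *\<^sub>R f x)"
    by (subst integrable_completion) auto
  then show ?thesis by (simp add: set_integrable_def)
qed

text \<open>
  Exchanging the coordinates identifies \<^typ>\<open>real ^ 2\<close> with \<^typ>\<open>real \<times> real\<close> and maps boxes to boxes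
  of equal content, which is all that the transfer of the integral requires.
\<close>

lemma integral_unit_square:
  fixes f :: "point \<Rightarrow> real"
  assumes "continuous_on UNIV f"
  shows "integral (cbox 0 1) f = integral {0..1} (\<lambda>t. integral {0..1} (\<lambda>s. f (vector [s, t])))"
proof -
  let ?g = "\<lambda>x :: real \<times> real. vector [snd x, fst x] :: point"
  let ?h = "\<lambda>x :: point. (x $ 2, x $ 1)"
  have g: "?g ` cbox u v = cbox (?g u) (?g v)" for u v
  proof (intro set_eqI iffI)
    fix x assume "x \<in> ?g ` cbox u v"
    then show "x \<in> cbox (?g u) (?g v)"
      by (cases u; cases v) (auto simp: mem_box_cart forall_2 cbox_Pair_eq)
  next
    fix x assume "x \<in> cbox (?g u) (?g v)"
    then have "?h x \<in> cbox u v" "x = ?g (?h x)"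
      by (cases u; cases v, auto simp: mem_box_cart forall_2 cbox_Pair_eq vec_eq_iff)+
    then show "x \<in> ?g ` cbox u v" by blast
  qed
  have h: "?h ` cbox u v = cbox (?h u) (?h v)" for u v
  proof (intro set_eqI iffI)
    fix x assume "x \<in> ?h ` cbox u v"
    then show "x \<in> cbox (?h u) (?h v)"
      by (auto simp: mem_box_cart forall_2 cbox_Pair_eq)
  next
    fix x assume "x \<in> cbox (?h u) (?h v)"
    then have "?g x \<in> cbox u v" "x = ?h (?g x)"
      by (cases x, auto simp: mem_box_cart forall_2 cbox_Pair_eq)+
    then show "x \<in> ?h ` cbox u v" by blast
  qed
  have cg: "continuous_on UNIV ?g"
    by (intro continuous_on_vector_2 continuous_intros)
  have "(f has_integral integral (cbox 0 1) f) (cbox 0 1)"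
    by (meson assms continuous_on_subset integrable_continuous integrable_integral subset_UNIV)
  then have "((\<lambda>x. f (?g x)) has_integral (1 / 1) *\<^sub>R integral (cbox 0 1) f) (?h ` cbox 0 1)"
  proof (rule has_integral_twiddle[rotated 7])
    show "measure lborel (?g ` cbox u v) = 1 * measure lborel (cbox u v)" for u v
    proof -
      obtain u1 u2 v1 v2 where uv: "u = (u1, u2)" "v = (v1, v2)" by (metis surj_pair)
      have ex: "(\<exists>i::2. P i) \<longleftrightarrow> P 1 \<or> P 2" for P by (metis exhaust_2)
      have "measure lborel (cbox (vector [u2, u1]) (vector [v2, v1] :: point)) =
          (if u1 \<le> v1 \<and> u2 \<le> v2 then (v1 - u1) * (v2 - u2) else 0)"
        unfolding content_cbox_if_cart interval_eq_empty_cart ex by (auto simp: UNIV_2)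
      then show ?thesis
        unfolding g uv by (simp add: content_Pair content_real_if)
    qed
    show "continuous (at x) ?g" for x
      using cg continuous_on_eq_continuous_at[OF open_UNIV] by blast
    show "?g (?h x) = x" for x :: point by (simp add: vec_eq_iff forall_2)
    show "\<exists>w z. ?g ` cbox u v = cbox w z" for u v using g by blast
    show "\<exists>w z. ?h ` cbox u v = cbox w z" for u v using h by blast
  qed auto
  then have "integral (cbox 0 1) f = integral (cbox (0, 0) (1, 1)) (\<lambda>x. f (?g x))"
    unfolding h by (simp add: integral_unique)
  also have "\<dots> = integral (cbox 0 1) (\<lambda>t. integral (cbox 0 1) (\<lambda>s. f (?g (t, s))))"
    by (intro integral_prod_continuous continuous_on_compose2[OF assms])
      (auto intro: continuous_on_subset[OF cg])
  finally show ?thesis by simp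
qed

text \<open>
  The vertex \<open>c\<close> is the image of the collapsed side; leaving it out makes the map injective.
\<close>

lemma duffy_image:
  assumes "cross2 (b - a) (c - a) \<noteq> 0"
  shows "duffy a b c ` {x. 0 \<le> x $ 1 \<and> x $ 1 \<le> 1 \<and> 0 \<le> x $ 2 \<and> x $ 2 < 1} = convex hull {a, b, c} - {c}"
    (is "_ ` ?S = _")
proof (intro set_eqI iffI)
  fix y assume "y \<in> duffy a b c ` ?S"
  then obtain x where x: "x \<in> ?S" "y = duffy a b c x" by auto
  define s t where "s = x $ 1 * (1 - x $ 2)" and "t = x $ 2"
  have "x $ 1 * (1 - x $ 2) + x $ 2 \<le> 1 * (1 - x $ 2) + x $ 2"
    using x by (intro add_right_mono mult_right_mono) auto
  then have "0 \<le> s" "0 \<le> t" "s + t \<le> 1" "y = a + s *\<^sub>R (b - a) + t *\<^sub>R (c - a)"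
    using x by (auto simp: s_def t_def duffy_def)
  then have "y \<in> convex hull {a, b, c}"
    unfolding convex_hull_3_alt by blast
  moreover have "y \<noteq> c"
  proof
    assume "y = c"
    then have "(x $ 1 * (1 - x $ 2)) *\<^sub>R (b - a) + (x $ 2) *\<^sub>R (c - a) = 0 *\<^sub>R (b - a) + 1 *\<^sub>R (c - a)"
      using x by (simp add: duffy_def algebra_simps)
    from cross2_solve[OF assms this] show False using x by auto
  qed
  ultimately show "y \<in> convex hull {a, b, c} - {c}" by auto
next
  fix y assume "y \<in> convex hull {a, b, c} - {c}"
  then obtain s t where y: "y = a + s *\<^sub>R (b - a) + t *\<^sub>R (c - a)" "0 \<le> s" "0 \<le> t" "s + t \<le> 1" "y \<noteq> c"
    unfolding convex_hull_3_alt by auto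
  have "t \<noteq> 1"
    using y by (cases "t = 1") auto
  then have "t < 1" using y by auto
  let ?x = "vector [s / (1 - t), t] :: point"
  have "s / (1 - t) * (1 - t) = s" "0 \<le> s / (1 - t)" "s / (1 - t) \<le> 1"
    using \<open>t < 1\<close> y by auto
  then have "y = duffy a b c ?x" "?x \<in> ?S"
    using \<open>t < 1\<close> y by (auto simp: duffy_def)
  then show "y \<in> duffy a b c ` ?S" by blast
qed

lemma integral_triangle:
  fixes f :: "point \<Rightarrow> real"
  assumes nz: "cross2 (b - a) (c - a) \<noteq> 0" and f: "continuous_on UNIV f"
  shows "integral (convex hull {a, b, c}) f = \<bar>cross2 (b - a) (c - a)\<bar> *
     integral {0..1} (\<lambda>t. integral {0..1} (\<lambda>s.
       (1 - t) * f (a + (s * (1 - t)) *\<^sub>R (b - a) + t *\<^sub>R (c - a))))"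
proof -
  let ?S = "{x :: point. 0 \<le> x $ 1 \<and> x $ 1 \<le> 1 \<and> 0 \<le> x $ 2 \<and> x $ 2 < 1}"
  let ?F = "\<lambda>x. vec (f x) :: real ^ 1"
  let ?G = "\<lambda>x :: point. (1 - x $ 2) * f (duffy a b c x)"
  let ?D = "\<bar>cross2 (b - a) (c - a)\<bar>"
  have contG: "continuous_on UNIV ?G"
    unfolding duffy_def
    by (intro continuous_intros continuous_on_compose2[OF f]) auto
  have S_box: "?S \<subseteq> cbox 0 1" "cbox 0 1 - ?S \<subseteq> {x. x $ 2 = 1}"
    by (auto simp: mem_box_cart forall_2)
  have neg: "negligible (cbox 0 (1 :: point) - ?S)"
  proof (rule negligible_subset[OF _ S_box(2)])
    have "{x :: point. x $ 2 = 1} = {x. axis 2 1 \<bullet> x = 1}" by (simp add: inner_axis')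
    then show "negligible {x :: point. x $ 2 = 1}"
      using negligible_hyperplane[of "axis 2 1 :: point" 1] by (simp add: axis_eq_0_iff)
  qed
  have S: "?S \<in> sets lebesgue"
  proof -
    have "?S = cbox 0 1 - (cbox 0 1 - ?S)" using S_box by auto
    moreover have "\<dots> \<in> sets lebesgue"
      using neg by (auto simp: negligible_iff_null_sets simp del: Diff_Diff_Int)
    ultimately show ?thesis by simp
  qed
  have inj: "inj_on (duffy a b c) ?S"
  proof (rule inj_onI)
    fix x y assume xy: "x \<in> ?S" "y \<in> ?S" "duffy a b c x = duffy a b c y"
    have "(x $ 1 * (1 - x $ 2)) *\<^sub>R (b - a) + (x $ 2) *\<^sub>R (c - a)
        = (y $ 1 * (1 - y $ 2)) *\<^sub>R (b - a) + (y $ 2) *\<^sub>R (c - a)"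
      using xy(3) by (simp add: duffy_def)
    from cross2_solve[OF nz this] show "x = y" using xy by (auto simp: vec_eq_iff forall_2)
  qed
  have F: "?F absolutely_integrable_on (convex hull {a, b, c})"
  proof (intro absolutely_integrable_continuous_on_compact finite_imp_compact_convex_hull)
    show "continuous_on (convex hull {a, b, c}) ?F"
      unfolding vec_def by (intro continuous_on_vec_lambda continuous_on_subset[OF f]) simp
  qed auto
  then have int_hull: "?F absolutely_integrable_on (convex hull {a, b, c} - {c})"
    by (rule absolutely_integrable_spike_set) (auto intro: negligible_subset[of "{c}"])
  have cv: "(\<lambda>x. \<bar>(1 - x $ 2) * cross2 (b - a) (c - a)\<bar> *\<^sub>R ?F (duffy a b c x)) absolutely_integrable_on ?S \<and>
      integral ?S (\<lambda>x. \<bar>(1 - x $ 2) * cross2 (b - a) (c - a)\<bar> *\<^sub>R ?F (duffy a b c x))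
        = integral (convex hull {a, b, c} - {c}) ?F"
    using has_absolute_integral_change_of_variables[OF S has_derivative_duffy inj, of ?F
        "integral (convex hull {a, b, c} - {c}) ?F"] int_hull
    unfolding det_duffy duffy_image[OF nz] by blast
  have "integral (convex hull {a, b, c}) f = integral (convex hull {a, b, c}) (\<lambda>x. ?F x $ 1)"
    by simp
  also have "\<dots> = integral (convex hull {a, b, c}) ?F $ 1"
    using F by (intro integral_component_eq_cart) (rule set_lebesgue_integral_eq_integral)
  also have "\<dots> = integral (convex hull {a, b, c} - {c}) ?F $ 1"
    by (subst integral_spike_set[of "convex hull {a, b, c}" "convex hull {a, b, c} - {c}"])
      (auto intro: negligible_subset[of "{c}"])
  also have "\<dots> = integral ?S (\<lambda>x. \<bar>(1 - x $ 2) * cross2 (b - a) (c - a)\<bar> *\<^sub>R ?F (duffy a b c x)) $ 1"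
    using cv by simp
  also have "\<dots> = integral ?S (\<lambda>x. \<bar>(1 - x $ 2) * cross2 (b - a) (c - a)\<bar> * f (duffy a b c x))"
    using cv by (subst integral_component_eq_cart[symmetric]) (auto dest: set_lebesgue_integral_eq_integral)
  also have "\<dots> = integral ?S (\<lambda>x. ?D * ?G x)"
    by (intro integral_cong) (auto simp: abs_mult)
  also have "\<dots> = ?D * integral ?S ?G" by simp
  also have "integral ?S ?G = integral (cbox 0 1) ?G"
    by (intro integral_spike_set negligible_subset[OF neg]) (use S_box in auto)
  also have "\<dots> = integral {0..1} (\<lambda>t. integral {0..1} (\<lambda>s. ?G (vector [s, t])))"
    by (rule integral_unit_square[OF contG])
  finally show ?thesis by (simp add: duffy_def)
qed

lemma integral_linepath_reverse:
  "integral {0..1} (\<lambda>s. f (linepath b a s)) = integral {0..1} (\<lambda>s. f (linepath a b s))"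
proof -
  have rev: "((\<lambda>s. f (linepath y x s)) has_integral i) {0..1}"
    if "((\<lambda>s. f (linepath x y s)) has_integral i) {0..1}" for x y i
  proof -
    have "(\<lambda>s::real. 1 - s) ` {0..1} = {0..1}"
      using image_affinity_atLeastAtMost[of "-1" 1 0 "1::real"] by simp
    then show ?thesis
      using has_integral_affinity01[OF that, of "-1" 1] by (simp add: linepath_def add.commute)
  qed
  then have "((\<lambda>s. f (linepath b a s)) has_integral i) {0..1}
      \<longleftrightarrow> ((\<lambda>s. f (linepath a b s)) has_integral i) {0..1}" for i
    by blast
  then show ?thesis unfolding integral_def integrable_on_def by simp
qed

text \<open>
  In the inner variable of the Duffy parametrization the point moves parallel to \<open>b - a\<close> with speed
  \<open>1 - t\<close>, which is exactly the remaining factor of the Jacobian. The inner integral is therefore an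
  increment of \<open>f\<close> between the two other sides.
\<close>

lemma integral_triangle_side_derivative:
  fixes f :: "point \<Rightarrow> real"
  assumes nz: "cross2 (b - a) (c - a) \<noteq> 0"
    and der: "\<And>x. (f has_derivative (\<lambda>v. G x \<bullet> v)) (at x)" and G: "continuous_on UNIV G"
  shows "integral (convex hull {a, b, c}) (\<lambda>x. G x \<bullet> (b - a)) = \<bar>cross2 (b - a) (c - a)\<bar> *
     (integral {0..1} (\<lambda>t. f (linepath b c t)) - integral {0..1} (\<lambda>t. f (linepath a c t)))"
proof -
  let ?p = "\<lambda>t s. a + (s * (1 - t)) *\<^sub>R (b - a) + t *\<^sub>R (c - a)"
  have contf: "continuous_on UNIV f"
    using der by (meson continuous_at_imp_continuous_on has_derivative_continuous)
  have inner: "integral {0..1} (\<lambda>s. (1 - t) * (G (?p t s) \<bullet> (b - a)))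
      = f (linepath b c t) - f (linepath a c t)" for t
  proof -
    have "((\<lambda>s. f (?p t s)) has_derivative (\<lambda>h. G (?p t s) \<bullet> ((h * (1 - t)) *\<^sub>R (b - a)))) (at s within {0..1})" for s
      by (rule has_derivative_compose[of "?p t", OF _ der]) (auto intro!: derivative_eq_intros)
    then have "((\<lambda>s. f (?p t s)) has_vector_derivative (1 - t) * (G (?p t s) \<bullet> (b - a))) (at s within {0..1})" for s
      unfolding has_vector_derivative_def by (simp add: mult_ac inner_scaleR_right)
    then have "((\<lambda>s. (1 - t) * (G (?p t s) \<bullet> (b - a))) has_integral f (?p t 1) - f (?p t 0)) {0..1}"
      by (intro fundamental_theorem_of_calculus) auto
    moreover have "?p t 1 = linepath b c t" "?p t 0 = linepath a c t"
      by (simp_all add: linepath_def algebra_simps)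
    ultimately show ?thesis by (metis (no_types, lifting) integral_unique)
  qed
  have "(\<lambda>t. f (linepath x y t)) integrable_on {0..1}" for x y
    by (intro integrable_continuous_real continuous_on_compose2[OF contf]) (auto intro: continuous_intros)
  then show ?thesis
    by (subst integral_triangle[OF nz])
      (auto intro!: continuous_intros G simp: inner integral_diff simp del: integral_mult_right)
qed

text \<open>
  Both sides are twice the area of the triangle: base length times height over the base.
\<close>

lemma scaled_normal:
  assumes n: "norm n = 1" "n \<bullet> (c - b) = 0" "n \<bullet> (a - b) \<le> 0"
  shows "dist b c * (n \<bullet> (b - a)) = \<bar>cross2 (b - a) (c - a)\<bar>"
proof -
  define v where "v = b - a"
  define r where "r = c - b"
  define l where "l = n $ 1 * r $ 2 - n $ 2 * r $ 1"
  have n1: "n $ 1 * n $ 1 + n $ 2 * n $ 2 = 1"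
    using n(1) by (simp add: norm_eq_1 inner_vec_def sum_2)
  have nr: "n $ 1 * r $ 1 + n $ 2 * r $ 2 = 0"
    using n(2) by (simp add: r_def inner_vec_def sum_2)
  \<comment> \<open>A unit vector orthogonal to the side determines the side up to the factor \<open>l\<close>.\<close>
  have r1: "r $ 1 = - n $ 2 * l" and r2: "r $ 2 = n $ 1 * l"
    using n1 nr unfolding l_def by algebra+
  have "(dist b c * (n \<bullet> v))\<^sup>2 = (r \<bullet> r) * (n \<bullet> v)\<^sup>2"
    by (simp add: power_mult_distrib dist_norm norm_minus_commute[of b c] r_def power2_norm_eq_inner)
  also have "\<dots> = (cross2 v r)\<^sup>2"
    using n1 by (simp add: inner_vec_def sum_2 cross2_def r1 r2) algebra
  also have "cross2 v r = cross2 (b - a) (c - a)"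
    by (simp add: cross2_def v_def r_def algebra_simps)
  finally have "\<bar>dist b c * (n \<bullet> v)\<bar> = \<bar>cross2 (b - a) (c - a)\<bar>"
    by (simp add: power2_eq_iff abs_eq_iff)
  moreover have "0 \<le> n \<bullet> v" using n(3) by (simp add: v_def inner_diff_right)
  ultimately show ?thesis by (simp add: v_def abs_mult)
qed

lemma cross2_span:
  assumes "cross2 v w \<noteq> 0"
  obtains s t where "x = s *\<^sub>R v + t *\<^sub>R w"
proof
  show "x = (cross2 x w / cross2 v w) *\<^sub>R v + (cross2 v x / cross2 v w) *\<^sub>R w"
    using assms by (simp add: vec_eq_iff forall_2 field_simps) (simp add: cross2_def algebra_simps)
qed

text \<open>
  The direction \<open>w\<close> is a combination of two side directions, for each of which the integral is known;
  \<open>scaled_normal\<close> turns the coefficients into normal components.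
\<close>

lemma divergence_theorem_triangle:
  fixes f :: "point \<Rightarrow> real"
  assumes nz: "cross2 (b - a) (c - a) \<noteq> 0"
    and der: "\<And>x. (f has_derivative (\<lambda>v. G x \<bullet> v)) (at x)" and G: "continuous_on UNIV G"
    and na: "norm na = 1" "na \<bullet> (c - b) = 0" "na \<bullet> (a - b) \<le> 0"
    and nb: "norm nb = 1" "nb \<bullet> (c - a) = 0" "nb \<bullet> (b - a) \<le> 0"
    and nc: "norm nc = 1" "nc \<bullet> (b - a) = 0" "nc \<bullet> (c - a) \<le> 0"
  shows "integral (convex hull {a, b, c}) (\<lambda>x. G x \<bullet> w) =
     (na \<bullet> w) * (dist b c * integral {0..1} (\<lambda>t. f (linepath b c t)))
     + (nb \<bullet> w) * (dist a c * integral {0..1} (\<lambda>t. f (linepath a c t)))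
     + (nc \<bullet> w) * (dist a b * integral {0..1} (\<lambda>t. f (linepath a b t)))"
proof -
  let ?K = "convex hull {a, b, c}"
  let ?D = "\<bar>cross2 (b - a) (c - a)\<bar>"
  obtain s t where w: "w = s *\<^sub>R (b - a) + t *\<^sub>R (c - a)" by (rule cross2_span[OF nz])
  have intG: "(\<lambda>x. G x \<bullet> v) integrable_on ?K" for v
    by (intro set_lebesgue_integral_eq_integral(1) absolutely_integrable_continuous_on_compact
        finite_imp_compact_convex_hull continuous_intros continuous_on_subset[OF G]) auto
  have sym: "cross2 (c - a) (b - a) = - cross2 (b - a) (c - a)"
    by (simp add: cross2_def algebra_simps)
  have 1: "integral ?K (\<lambda>x. G x \<bullet> (b - a)) = ?D *
     (integral {0..1} (\<lambda>t. f (linepath b c t)) - integral {0..1} (\<lambda>t. f (linepath a c t)))"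
    by (rule integral_triangle_side_derivative[OF nz der G])
  have 2: "integral ?K (\<lambda>x. G x \<bullet> (c - a)) = ?D *
     (integral {0..1} (\<lambda>t. f (linepath b c t)) - integral {0..1} (\<lambda>t. f (linepath a b t)))"
    using integral_triangle_side_derivative[of c a b, OF _ der G] nz
    by (simp add: sym insert_commute integral_linepath_reverse[of f c b])
  have Na: "dist b c * (na \<bullet> (b - a)) = ?D" "dist b c * (na \<bullet> (c - a)) = ?D"
    using scaled_normal[OF na] na(2) by (auto simp: inner_diff_right)
  have Nb: "dist a c * (nb \<bullet> (b - a)) = - ?D"
    using scaled_normal[OF nb] by (simp add: cross2_def inner_diff_right algebra_simps abs_minus_commute)
  have Nc: "dist a b * (nc \<bullet> (c - a)) = - ?D"
    using scaled_normal[OF nc] by (simp add: cross2_def inner_diff_right algebra_simps abs_minus_commute)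
  have factor: "(s * X + t * Y) * (d * m) = (s * (d * X) + t * (d * Y)) * m" for X Y d m :: real
    by (simp add: algebra_simps)
  have "integral ?K (\<lambda>x. G x \<bullet> w) = s * integral ?K (\<lambda>x. G x \<bullet> (b - a)) + t * integral ?K (\<lambda>x. G x \<bullet> (c - a))"
    unfolding w inner_add_right inner_scaleR_right
    by (subst integral_add) (auto intro!: integrable_on_mult_right intG)
  also have "\<dots> = (na \<bullet> w) * (dist b c * integral {0..1} (\<lambda>t. f (linepath b c t)))
     + (nb \<bullet> w) * (dist a c * integral {0..1} (\<lambda>t. f (linepath a c t)))
     + (nc \<bullet> w) * (dist a b * integral {0..1} (\<lambda>t. f (linepath a b t)))"
    unfolding 1 2 w inner_add_right inner_scaleR_right nb(2) nc(2) factor Na Nb Nc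
    by (simp add: algebra_simps)
  finally show ?thesis .
qed

section \<open>Interpolation in finite-dimensional function spaces\<close>

definition lin_comb :: "'j set \<Rightarrow> ('j \<Rightarrow> 'a \<Rightarrow> real) \<Rightarrow> ('a \<Rightarrow> real) set" where
  "lin_comb J B = {f. \<exists>c. \<forall>a. f a = (\<Sum>j\<in>J. c j * B j a)}"

lemma lin_combI: "(\<And>a. f a = (\<Sum>j\<in>J. c j * B j a)) \<Longrightarrow> f \<in> lin_comb J B"
  unfolding lin_comb_def by blast

lemma lin_comb_add:
  assumes "f \<in> lin_comb J B" "g \<in> lin_comb J B"
  shows "(\<lambda>a. f a + g a) \<in> lin_comb J B"
proof -
  obtain c d where "\<forall>a. f a = (\<Sum>j\<in>J. c j * B j a)" "\<forall>a. g a = (\<Sum>j\<in>J. d j * B j a)"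
    using assms unfolding lin_comb_def by blast
  then have "\<forall>a. f a + g a = (\<Sum>j\<in>J. (c j + d j) * B j a)"
    by (simp add: sum.distrib algebra_simps)
  then show ?thesis by (intro lin_combI[where c = "\<lambda>j. c j + d j"]) (rule spec)
qed

lemma lin_comb_scale:
  assumes "f \<in> lin_comb J B"
  shows "(\<lambda>a. r * f a) \<in> lin_comb J B"
proof -
  obtain c where "\<forall>a. f a = (\<Sum>j\<in>J. c j * B j a)"
    using assms unfolding lin_comb_def by blast
  then have "\<forall>a. r * f a = (\<Sum>j\<in>J. (r * c j) * B j a)"
    by (simp add: sum_distrib_left algebra_simps)
  then show ?thesis by (intro lin_combI[where c = "\<lambda>j. r * c j"]) (rule spec)
qed

lemma lin_comb_zero: "(\<lambda>a. 0) \<in> lin_comb J B"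
  by (rule lin_combI[where c = "\<lambda>j. 0"]) simp

lemma lin_comb_sum:
  assumes "finite X" "\<And>x. x \<in> X \<Longrightarrow> f x \<in> lin_comb J B"
  shows "(\<lambda>a. \<Sum>x\<in>X. f x a) \<in> lin_comb J B"
  using assms by (induction X rule: finite_induct) (auto intro: lin_comb_zero lin_comb_add)

lemma lin_comb_diff:
  assumes "f \<in> lin_comb J B" "g \<in> lin_comb J B"
  shows "(\<lambda>a. f a - g a) \<in> lin_comb J B"
  using lin_comb_add[OF assms(1) lin_comb_scale[OF assms(2), of "-1"]] by simp

lemma lin_comb_base: "finite J \<Longrightarrow> j \<in> J \<Longrightarrow> B j \<in> lin_comb J B"
  by (rule lin_combI[where c = "\<lambda>i. if i = j then 1 else 0"])
    (simp add: if_distrib[of "\<lambda>x. x * _"] cong: if_cong)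

lemma lin_comb_insertE:
  assumes "finite J" "i \<notin> J" "f \<in> lin_comb (insert i J) B"
  obtains f' c where "f' \<in> lin_comb J B" "\<And>a. f a = f' a + c * B i a"
proof -
  obtain c where c: "\<forall>a. f a = (\<Sum>j\<in>insert i J. c j * B j a)"
    using assms(3) unfolding lin_comb_def by blast
  show thesis
    by (rule that[of "\<lambda>a. \<Sum>j\<in>J. c j * B j a" "c i"]) (use assms c in \<open>auto intro: lin_combI simp: add.commute\<close>)
qed

lemma lin_comb_mono:
  assumes "finite J" "i \<notin> J" "f \<in> lin_comb J B"
  shows "f \<in> lin_comb (insert i J) B"
proof -
  obtain c where c: "\<forall>a. f a = (\<Sum>j\<in>J. c j * B j a)"
    using assms(3) unfolding lin_comb_def by blast
  have "(\<Sum>j\<in>insert i J. (c(i := 0)) j * B j a) = (\<Sum>j\<in>J. c j * B j a)" for a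
    using assms by (auto intro!: sum.cong)
  then show ?thesis using c by (intro lin_combI[where c = "c(i := 0)"]) simp
qed

text \<open>
  A finite-dimensional space of functions on \<open>A\<close> has finitely many nodes in \<open>A\<close> that determine it,
  with a dual basis. It is used with points of an element as \<open>A\<close> (interpolation) and with polynomials as
  \<open>A\<close>, where a function is the family of its moments (reproducing formula). The nodes are collected one
  generator at a time: if the interpolation error \<open>r\<close> of the new generator does not vanish at some \<open>y\<close>,
  then \<open>y\<close> becomes a node with basis function \<open>r / r y\<close> and the old basis is corrected at \<open>y\<close>.
\<close>

lemma lagrange_basis:
  assumes "finite J"
  shows "\<exists>X L. finite X \<and> X \<subseteq> A \<and> (\<forall>x\<in>X. L x \<in> lin_comb J B)
    \<and> (\<forall>x\<in>X. \<forall>y\<in>X. L x y = (if x = y then 1 else 0))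
    \<and> (\<forall>f\<in>lin_comb J B. \<forall>a\<in>A. f a = (\<Sum>x\<in>X. f x * L x a))"
  using assms
proof (induction J rule: finite_induct)
  case empty
  show ?case by (intro exI[of _ "{}"]) (auto simp: lin_comb_def)
next
  case (insert i J)
  from insert.IH obtain X L where XL: "finite X" "X \<subseteq> A" "\<forall>x\<in>X. L x \<in> lin_comb J B"
    "\<forall>x\<in>X. \<forall>y\<in>X. L x y = (if x = y then 1 else 0)"
    "\<forall>f\<in>lin_comb J B. \<forall>a\<in>A. f a = (\<Sum>x\<in>X. f x * L x a)"
    by (elim exE conjE) (rule that)
  note X = XL(1,2) XL(3)[rule_format] and dual = XL(4)[rule_format] and L = XL(5)[rule_format]
  note up = lin_comb_mono[OF insert.hyps]
  define r where "r a = B i a - (\<Sum>x\<in>X. B i x * L x a)" for a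
  have r_in: "r \<in> lin_comb (insert i J) B"
    unfolding r_def
  proof (rule lin_comb_diff)
    show "B i \<in> lin_comb (insert i J) B" by (rule lin_comb_base) (use insert.hyps in auto)
    show "(\<lambda>a. \<Sum>x\<in>X. B i x * L x a) \<in> lin_comb (insert i J) B"
      by (rule lin_comb_sum[OF X(1)], rule lin_comb_scale, rule up, rule X(3))
  qed
  have r0: "r y = 0" if "y \<in> X" for y
  proof -
    have "(\<Sum>x\<in>X. B i x * L x y) = (\<Sum>x\<in>X. if x = y then B i x else 0)"
      by (rule sum.cong) (use that dual in auto)
    then show ?thesis using X(1) that by (simp add: r_def)
  qed
  have split: "\<exists>f' c. f' \<in> lin_comb J B \<and> (\<forall>a. f a = f' a + c * r a)"
    if f: "f \<in> lin_comb (insert i J) B" for f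
  proof -
    obtain f' c where f': "f' \<in> lin_comb J B" "\<And>a. f a = f' a + c * B i a"
      by (rule lin_comb_insertE[OF insert.hyps f]) (rule that)
    have "(\<lambda>a. f' a + c * (\<Sum>x\<in>X. B i x * L x a)) \<in> lin_comb J B"
      by (rule lin_comb_add[OF f'(1)], rule lin_comb_scale, rule lin_comb_sum[OF X(1)],
          rule lin_comb_scale, rule X(3))
    moreover have "f a = (f' a + c * (\<Sum>x\<in>X. B i x * L x a)) + c * r a" for a
      by (simp add: f'(2) r_def algebra_simps)
    ultimately show ?thesis by blast
  qed
  show ?case
  proof (cases "\<forall>a\<in>A. r a = 0")
    case True
    have "f a = (\<Sum>x\<in>X. f x * L x a)" if f: "f \<in> lin_comb (insert i J) B" and a: "a \<in> A" for f a
    proof -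
      obtain f' c where f': "f' \<in> lin_comb J B" "\<And>a. f a = f' a + c * r a"
        using split[OF f] by (elim exE conjE) (rule that, auto)
      then have eq: "f a = f' a" if "a \<in> A" for a using True that by simp
      have "f a = (\<Sum>x\<in>X. f' x * L x a)" using L[OF f'(1) a] eq[OF a] by simp
      also have "\<dots> = (\<Sum>x\<in>X. f x * L x a)" by (rule sum.cong) (use X(2) eq in auto)
      finally show ?thesis .
    qed
    then show ?thesis
      by (intro exI[of _ X] exI[of _ L] conjI ballI) (use X(2) in \<open>auto simp: dual intro: X up\<close>)
  next
    case False
    then obtain y where y: "y \<in> A" "r y \<noteq> 0" by blast
    then have yX: "y \<notin> X" using r0 by blast
    define M where "M x = (if x = y then (\<lambda>a. 1 / r y * r a) else (\<lambda>a. L x a - L x y * (1 / r y * r a)))" for x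
    have "M x \<in> lin_comb (insert i J) B" if "x \<in> insert y X" for x
    proof (cases "x = y")
      case True
      then show ?thesis unfolding M_def using lin_comb_scale[OF r_in, of "1 / r y"] by simp
    next
      case False
      then have "L x \<in> lin_comb (insert i J) B" using that X(3) up by blast
      from lin_comb_diff[OF this lin_comb_scale[OF lin_comb_scale[OF r_in]], of "L x y" "1 / r y"] False
      show ?thesis unfolding M_def by simp
    qed
    moreover have "M x z = (if x = z then 1 else 0)" if "x \<in> insert y X" "z \<in> insert y X" for x z
      using that yX y(2) by (auto simp: M_def r0 dual)
    moreover have "f a = (\<Sum>x\<in>insert y X. f x * M x a)"
      if f: "f \<in> lin_comb (insert i J) B" and a: "a \<in> A" for f a
    proof -
      obtain f' c where f': "f' \<in> lin_comb J B" "\<And>a. f a = f' a + c * r a"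
        using split[OF f] by (elim exE conjE) (rule that, auto)
      have "(\<Sum>x\<in>insert y X. f x * M x a) = f y * (r a / r y) + (\<Sum>x\<in>X. f' x * (L x a - L x y * (r a / r y)))"
      proof -
        have "(\<Sum>x\<in>X. f x * M x a) = (\<Sum>x\<in>X. f' x * (L x a - L x y * (r a / r y)))"
          by (rule sum.cong) (use yX in \<open>auto simp: M_def f'(2) r0\<close>)
        then show ?thesis using X(1) yX by (simp add: M_def)
      qed
      also have "\<dots> = f y * (r a / r y) + (f' a - f' y * (r a / r y))"
        unfolding L[OF f'(1) a] L[OF f'(1) y(1)]
        by (simp add: algebra_simps sum_subtractf sum_distrib_left sum_distrib_right sum_divide_distrib)
      also have "\<dots> = f a" using y(2) by (simp add: f'(2) field_simps)
      finally show ?thesis by simp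
    qed
    ultimately show ?thesis
      by (intro exI[of _ "insert y X"] exI[of _ M] conjI ballI) (use X(1,2) y(1) in \<open>simp_all\<close>)
  qed
qed

definition monomial :: "nat \<times> nat \<Rightarrow> point \<Rightarrow> real" where
  "monomial ij x = (x $ 1) ^ fst ij * (x $ 2) ^ snd ij"

lemma polys_eq_lin_comb: "polys k = lin_comb (SIGMA i:{..k}. {..k - i}) monomial"
proof -
  have eq: "(\<Sum>i\<le>k. \<Sum>j\<le>k - i. c i j * (x $ 1) ^ i * (x $ 2) ^ j)
      = (\<Sum>ij\<in>(SIGMA i:{..k}. {..k - i}). case_prod c ij * monomial ij x)" for c x
    by (subst sum.Sigma) (auto simp: monomial_def mult.assoc intro!: sum.cong)
  show ?thesis
  proof (intro set_eqI iffI)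
    fix f assume "f \<in> polys k"
    then obtain c where "\<forall>x. f x = (\<Sum>i\<le>k. \<Sum>j\<le>k - i. c i j * (x $ 1) ^ i * (x $ 2) ^ j)"
      unfolding polys_def mem_Collect_eq by (elim exE) (rule that)
    then show "f \<in> lin_comb (SIGMA i:{..k}. {..k - i}) monomial"
      unfolding eq by (intro lin_combI[where c = "case_prod c"]) (rule spec)
  next
    fix f assume "f \<in> lin_comb (SIGMA i:{..k}. {..k - i}) monomial"
    then obtain c where "\<forall>x. f x = (\<Sum>ij\<in>(SIGMA i:{..k}. {..k - i}). c ij * monomial ij x)"
      unfolding lin_comb_def mem_Collect_eq by (elim exE) (rule that)
    then have "\<forall>x. f x = (\<Sum>i\<le>k. \<Sum>j\<le>k - i. curry c i j * (x $ 1) ^ i * (x $ 2) ^ j)"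
      unfolding eq by simp
    then show "f \<in> polys k" unfolding polys_def mem_Collect_eq by (rule exI[where x = "curry c"])
  qed
qed

lemma polys_const: "(\<lambda>x. r) \<in> polys k"
proof -
  have "(\<lambda>x. r * monomial (0, 0) x) \<in> polys k"
    unfolding polys_eq_lin_comb by (intro lin_comb_scale lin_comb_base) auto
  then show ?thesis by (simp add: monomial_def)
qed

lemma polys_add: "f \<in> polys k \<Longrightarrow> g \<in> polys k \<Longrightarrow> (\<lambda>x. f x + g x) \<in> polys k"
  unfolding polys_eq_lin_comb by (rule lin_comb_add)

lemma polys_scale: "f \<in> polys k \<Longrightarrow> (\<lambda>x. r * f x) \<in> polys k"
  unfolding polys_eq_lin_comb by (rule lin_comb_scale)

lemma polys_interpolation:
  obtains X L where "finite X" "X \<subseteq> K" "\<And>x. x \<in> X \<Longrightarrow> L x \<in> polys k"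
    "\<And>f y. f \<in> polys k \<Longrightarrow> y \<in> K \<Longrightarrow> f y = (\<Sum>x\<in>X. f x * L x y)"
proof -
  have "finite (SIGMA i:{..k}. {..k - i})" by auto
  from lagrange_basis[OF this, of K monomial, folded polys_eq_lin_comb]
  obtain X L where XL: "finite X" "X \<subseteq> K" "\<forall>x\<in>X. L x \<in> polys k"
    "\<forall>f\<in>polys k. \<forall>y\<in>K. f y = (\<Sum>x\<in>X. f x * L x y)"
    by (elim exE conjE) (rule that)
  show thesis by (rule that[OF XL(1,2) XL(3)[rule_format] XL(4)[rule_format]])
qed

section \<open>Continuously differentiable functions\<close>

text \<open>
  The gradient is part of the definition through \<^const>\<open>grad\<close>, so that statements about the
  operators of the scheme apply directly.
\<close>

definition C1 :: "(point \<Rightarrow> real) \<Rightarrow> bool" where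
  "C1 f \<longleftrightarrow> (\<forall>x. (f has_derivative (\<lambda>v. grad f x \<bullet> v)) (at x)) \<and> continuous_on UNIV (grad f)"

lemma grad_eqI:
  assumes "(f has_derivative (\<lambda>v. D \<bullet> v)) (at x)"
  shows "grad f x = D"
proof -
  have "GDERIV f x :> D" using assms by (simp add: gderiv_def inner_commute)
  moreover have "E = D" if "GDERIV f x :> E" for E
  proof -
    have "(f has_derivative (\<lambda>v. E \<bullet> v)) (at x)" using that by (simp add: gderiv_def inner_commute)
    from has_derivative_unique[OF this assms] have "(\<lambda>v. E \<bullet> v) = (\<lambda>v. D \<bullet> v)" .
    then show ?thesis by (metis inner_eq_zero_iff inner_diff_left right_minus_eq)
  qed
  ultimately show ?thesis unfolding grad_def by blast
qed

lemma C1I: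
  assumes der: "\<And>x. (f has_derivative (\<lambda>v. G x \<bullet> v)) (at x)" and G: "continuous_on UNIV G"
  shows "C1 f" "grad f = G"
proof -
  show eq: "grad f = G" using grad_eqI[OF der] by blast
  then show "C1 f" unfolding C1_def using assms by simp
qed

lemma C1_has_derivative: "C1 f \<Longrightarrow> (f has_derivative (\<lambda>v. grad f x \<bullet> v)) (at x)"
  and C1_continuous_grad: "C1 f \<Longrightarrow> continuous_on UNIV (grad f)"
  by (simp_all add: C1_def)

lemma C1_continuous: "C1 f \<Longrightarrow> continuous_on UNIV f"
  using C1_has_derivative by (meson continuous_at_imp_continuous_on has_derivative_continuous)

lemma C1_const: "C1 (\<lambda>x. r)"
  and grad_const: "grad (\<lambda>x. r) = (\<lambda>x. 0)"
  by (rule C1I[where G = "\<lambda>x. 0"]; simp)+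

lemma C1_component: "C1 (\<lambda>x. x $ i)"
  by (rule C1I(1)[where G = "\<lambda>x. axis i 1"])
    (auto simp: inner_axis' intro: bounded_linear_imp_has_derivative bounded_linear_vec_nth)

lemma C1_add:
  assumes "C1 f" "C1 g"
  shows "C1 (\<lambda>x. f x + g x)" "grad (\<lambda>x. f x + g x) = (\<lambda>x. grad f x + grad g x)"
proof -
  have "((\<lambda>x. f x + g x) has_derivative (\<lambda>v. (grad f x + grad g x) \<bullet> v)) (at x)" for x
    using has_derivative_add[OF C1_has_derivative[OF assms(1)] C1_has_derivative[OF assms(2)]]
    by (simp add: inner_add_left)
  moreover have "continuous_on UNIV (\<lambda>x. grad f x + grad g x)"
    by (intro continuous_intros C1_continuous_grad assms)
  ultimately show "C1 (\<lambda>x. f x + g x)" "grad (\<lambda>x. f x + g x) = (\<lambda>x. grad f x + grad g x)"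
    by (rule C1I)+
qed

lemma C1_mult:
  assumes "C1 f" "C1 g"
  shows "C1 (\<lambda>x. f x * g x)" "grad (\<lambda>x. f x * g x) = (\<lambda>x. f x *\<^sub>R grad g x + g x *\<^sub>R grad f x)"
proof -
  have "((\<lambda>x. f x * g x) has_derivative (\<lambda>v. (f x *\<^sub>R grad g x + g x *\<^sub>R grad f x) \<bullet> v)) (at x)" for x
    using has_derivative_mult[OF C1_has_derivative[OF assms(1)] C1_has_derivative[OF assms(2)]]
    by (simp add: inner_add_left mult.commute)
  moreover have "continuous_on UNIV (\<lambda>x. f x *\<^sub>R grad g x + g x *\<^sub>R grad f x)"
    by (intro continuous_intros C1_continuous_grad C1_continuous assms)
  ultimately show "C1 (\<lambda>x. f x * g x)" "grad (\<lambda>x. f x * g x) = (\<lambda>x. f x *\<^sub>R grad g x + g x *\<^sub>R grad f x)"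
    by (rule C1I)+
qed

lemma C1_power: "C1 f \<Longrightarrow> C1 (\<lambda>x. f x ^ n)"
  by (induction n) (auto intro: C1_const C1_mult)

lemma C1_sum: "finite A \<Longrightarrow> (\<And>i. i \<in> A \<Longrightarrow> C1 (f i)) \<Longrightarrow> C1 (\<lambda>x. \<Sum>i\<in>A. f i x)"
  by (induction A rule: finite_induct) (auto intro: C1_const C1_add)

lemma polys_C1:
  assumes "f \<in> polys k"
  shows "C1 f"
proof -
  obtain c where "\<forall>x. f x = (\<Sum>i\<le>k. \<Sum>j\<le>k - i. c i j * (x $ 1) ^ i * (x $ 2) ^ j)"
    using assms unfolding polys_def mem_Collect_eq by (elim exE) (rule that)
  then have f: "f = (\<lambda>x. \<Sum>i\<le>k. \<Sum>j\<le>k - i. c i j * (x $ 1) ^ i * (x $ 2) ^ j)" by (intro ext) (rule spec)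
  show ?thesis unfolding f
    by (auto intro!: C1_sum C1_mult C1_power C1_component C1_const)
qed

section \<open>Differentiation under the integral for separable functions\<close>

lemma integrable_on_compact:
  fixes f :: "'a::euclidean_space \<Rightarrow> 'b::euclidean_space"
  assumes "compact S" "continuous_on S f"
  shows "f integrable_on S"
  by (rule set_lebesgue_integral_eq_integral(1)[OF absolutely_integrable_continuous_on_compact[OF assms]])

text \<open>
  Finite sums of products of a differentiable function of time and a continuous function of space.
  Equality is only required on \<open>I\<close> and \<open>K\<close>, since nothing is known about a solution elsewhere.
\<close>

inductive separable :: "real set \<Rightarrow> point set \<Rightarrow> (real \<Rightarrow> point \<Rightarrow> real) \<Rightarrow> bool" for I K where
  product: "(\<And>t. t \<in> I \<Longrightarrow> c differentiable (at t within I)) \<Longrightarrow> continuous_on K G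
    \<Longrightarrow> (\<And>s x. s \<in> I \<Longrightarrow> x \<in> K \<Longrightarrow> f s x = c s * G x) \<Longrightarrow> separable I K f"
| add: "separable I K f \<Longrightarrow> separable I K g
    \<Longrightarrow> (\<And>s x. s \<in> I \<Longrightarrow> x \<in> K \<Longrightarrow> k s x = f s x + g s x) \<Longrightarrow> separable I K k"

lemma separable_space: "continuous_on K G \<Longrightarrow> separable I K (\<lambda>s. G)"
  by (rule product[where c = "\<lambda>s. 1" and G = G]) simp_all

lemma separable_cong:
  assumes "separable I K f" "\<And>s x. s \<in> I \<Longrightarrow> x \<in> K \<Longrightarrow> g s x = f s x"
  shows "separable I K g"
  by (rule add[OF assms(1) separable_space[of K "\<lambda>x. 0"]]) (use assms(2) in auto)

lemma separable_add: "separable I K f \<Longrightarrow> separable I K g \<Longrightarrow> separable I K (\<lambda>s x. f s x + g s x)"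
  by (rule add[of I K f g]) auto

lemma separable_sum:
  assumes "finite A" "\<And>i. i \<in> A \<Longrightarrow> separable I K (f i)"
  shows "separable I K (\<lambda>s x. \<Sum>i\<in>A. f i s x)"
  using assms
proof (induction A rule: finite_induct)
  case empty
  then show ?case using separable_space[of K "\<lambda>x. 0"] by simp
next
  case (insert i A)
  then show ?case using separable_add[of I K "f i" "\<lambda>s x. \<Sum>i\<in>A. f i s x"] by simp
qed

lemma separable_mult:
  assumes "separable I K f" "separable I K g"
  shows "separable I K (\<lambda>s x. f s x * g s x)"
  using assms
proof (induction f)
  case (product c G f)
  note f = product.hyps
  from product.prems show ?case
  proof (induction g)
    case (product d H g)
    show ?case
    proof (rule separable.product)
      show "(\<lambda>s. c s * d s) differentiable (at t within I)" if "t \<in> I" for t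
        using f(1) product.hyps(1) that by (intro differentiable_mult)
      show "continuous_on K (\<lambda>x. G x * H x)"
        by (intro continuous_on_mult f product.hyps)
      show "f s x * g s x = (c s * d s) * (G x * H x)" if "s \<in> I" "x \<in> K" for s x
        using f(3)[OF that] product.hyps(3)[OF that] by simp
    qed
  next
    case (add g1 g2 g)
    show ?case
      by (rule separable.add[OF add.IH]) (simp add: add.hyps algebra_simps)
  qed
next
  case (add f1 f2 f)
  show ?case
    by (rule separable.add[OF add.IH(1)[OF add.prems] add.IH(2)[OF add.prems]])
      (simp add: add.hyps algebra_simps)
qed

lemma separable_continuous:
  assumes "separable I K f"
  shows "continuous_on (I \<times> K) (\<lambda>(s, x). f s x)"
  using assms
proof (induction f)
  case (product c G f)
  have "continuous_on I c"
    unfolding continuous_on_eq_continuous_within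
    by (intro ballI differentiable_imp_continuous_within product.hyps(1))
  then have "continuous_on (I \<times> K) (\<lambda>z. c (fst z))"
    by (rule continuous_on_compose2[OF _ continuous_on_fst[OF continuous_on_id]]) auto
  moreover have "continuous_on (I \<times> K) (\<lambda>z. G (snd z))"
    by (rule continuous_on_compose2[OF product.hyps(2) continuous_on_snd[OF continuous_on_id]]) auto
  ultimately have "continuous_on (I \<times> K) (\<lambda>z. c (fst z) * G (snd z))"
    by (rule continuous_on_mult)
  then show ?case
    by (rule continuous_on_eq) (auto simp: product.hyps(3))
next
  case (add f g k)
  have "continuous_on (I \<times> K) (\<lambda>z. (case z of (s, x) \<Rightarrow> f s x) + (case z of (s, x) \<Rightarrow> g s x))"
    by (intro continuous_on_add add.IH)
  then show ?case
    by (rule continuous_on_eq) (auto simp: add.hyps(3))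
qed

text \<open>
  The derivative is constructed together with its integral; \<open>has_derivative_integral_separable\<close>
  then identifies it with any given pointwise derivative.
\<close>

lemma separable_derivative:
  assumes "separable I K f" and K: "compact K" and t: "t \<in> I"
  shows "\<exists>f'. continuous_on K f' \<and> (\<forall>x\<in>K. ((\<lambda>s. f s x) has_real_derivative f' x) (at t within I))
    \<and> ((\<lambda>s. integral K (f s)) has_real_derivative integral K f') (at t within I)"
  using assms(1)
proof (induction f)
  case (product c G f)
  obtain c' where c': "(c has_real_derivative c') (at t within I)"
    using product.hyps(1)[OF t] by (auto simp: real_differentiable_def)
  have "((\<lambda>s. f s x) has_real_derivative c' * G x) (at t within I)" if "x \<in> K" for x
    using t product.hyps(3) that
    by (intro has_field_derivative_transform_within[OF DERIV_cmult_right[OF c'] zero_less_one]) auto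
  moreover have "((\<lambda>s. integral K (f s)) has_real_derivative c' * integral K G) (at t within I)"
  proof (rule has_field_derivative_transform_within[OF DERIV_cmult_right[OF c'] zero_less_one t])
    fix s assume "s \<in> I"
    then have "integral K (f s) = integral K (\<lambda>x. c s * G x)"
      by (intro integral_cong product.hyps(3))
    then show "c s * integral K G = integral K (f s)" by simp
  qed
  ultimately show ?case
    by (intro exI[of _ "\<lambda>x. c' * G x"]) (auto intro: continuous_intros product.hyps(2))
next
  case (add f g k)
  obtain f' where f': "continuous_on K f'" "\<forall>x\<in>K. ((\<lambda>s. f s x) has_real_derivative f' x) (at t within I)"
    "((\<lambda>s. integral K (f s)) has_real_derivative integral K f') (at t within I)"
    using add.IH(1) by (elim exE conjE) (rule that)
  obtain g' where g': "continuous_on K g'" "\<forall>x\<in>K. ((\<lambda>s. g s x) has_real_derivative g' x) (at t within I)"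
    "((\<lambda>s. integral K (g s)) has_real_derivative integral K g') (at t within I)"
    using add.IH(2) by (elim exE conjE) (rule that)
  have slice: "continuous_on K (q s)" if "separable I K q" "s \<in> I" for q s
  proof -
    have "continuous_on K (Pair s)" by (intro continuous_intros)
    then show ?thesis
      using continuous_on_compose2[OF separable_continuous[OF that(1)], of K "Pair s"] that(2) by auto
  qed
  have "((\<lambda>s. k s x) has_real_derivative f' x + g' x) (at t within I)" if "x \<in> K" for x
    using f'(2) g'(2) that
    by (intro has_field_derivative_transform_within[OF DERIV_add zero_less_one t, of "\<lambda>s. f s x" _ "\<lambda>s. g s x"])
      (auto simp: add.hyps(3))
  moreover have "((\<lambda>s. integral K (k s)) has_real_derivative integral K (\<lambda>x. f' x + g' x)) (at t within I)"
  proof -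
    have "integral K (\<lambda>x. f' x + g' x) = integral K f' + integral K g'"
      by (intro integral_add integrable_on_compact K f'(1) g'(1))
    moreover have "integral K (f s) + integral K (g s) = integral K (k s)" if "s \<in> I" for s
    proof -
      have "integral K (k s) = integral K (\<lambda>x. f s x + g s x)"
        using that by (intro integral_cong add.hyps(3))
      also have "\<dots> = integral K (f s) + integral K (g s)"
        by (intro integral_add integrable_on_compact K slice add.hyps that)
      finally show ?thesis ..
    qed
    ultimately show ?thesis
      by (auto intro!: has_field_derivative_transform_within[OF DERIV_add[OF f'(3) g'(3)] zero_less_one t])
  qed
  ultimately show ?case
    by (intro exI[of _ "\<lambda>x. f' x + g' x"]) (auto intro: continuous_intros f'(1) g'(1))
qed

lemma has_derivative_integral_separable:
  assumes f: "separable I K f" and K: "compact K" and t: "t \<in> I" "at t within I \<noteq> bot"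
    and der: "\<And>x. x \<in> K \<Longrightarrow> ((\<lambda>s. f s x) has_real_derivative D x) (at t within I)"
  shows "((\<lambda>s. integral K (f s)) has_real_derivative integral K D) (at t within I)" "continuous_on K D"
proof -
  obtain f' where f': "continuous_on K f'" "\<forall>x\<in>K. ((\<lambda>s. f s x) has_real_derivative f' x) (at t within I)"
    "((\<lambda>s. integral K (f s)) has_real_derivative integral K f') (at t within I)"
    using separable_derivative[OF f K t(1)] by (elim exE conjE) (rule that)
  have eq: "f' x = D x" if "x \<in> K" for x
    by (rule has_field_derivative_unique[OF bspec[OF f'(2) that] der[OF that] t(2)])
  then have "integral K f' = integral K D" by (rule integral_cong)
  then show "((\<lambda>s. integral K (f s)) has_real_derivative integral K D) (at t within I)" using f'(3) by simp
  show "continuous_on K D" by (rule continuous_on_eq[OF f'(1) eq])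
qed

text \<open>
  Pointwise differentiability at the interpolation nodes already makes all coefficients
  differentiable.
\<close>

lemma separable_polys:
  assumes poly: "\<And>s. s \<in> I \<Longrightarrow> f s \<in> polys k"
    and diff: "\<And>t x. t \<in> I \<Longrightarrow> x \<in> K \<Longrightarrow> (\<lambda>s. f s x) differentiable (at t within I)"
  shows "separable I K f"
proof -
  obtain X L where X: "finite X" "X \<subseteq> K" "\<And>x. x \<in> X \<Longrightarrow> L x \<in> polys k"
    "\<And>f y. f \<in> polys k \<Longrightarrow> y \<in> K \<Longrightarrow> f y = (\<Sum>x\<in>X. f x * L x y)"
    by (rule polys_interpolation[of K k]) (rule that)
  have "separable I K (\<lambda>s y. \<Sum>x\<in>X. f s x * L x y)"
  proof (rule separable_sum[OF X(1)])
    fix x assume x: "x \<in> X"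
    then have "continuous_on K (L x)"
      using C1_continuous[OF polys_C1[OF X(3)]] continuous_on_subset by blast
    then show "separable I K (\<lambda>s y. f s x * L x y)"
      using diff x X(2) by (intro product[where c = "\<lambda>s. f s x" and G = "L x"]) auto
  qed
  then show ?thesis
    by (rule separable_cong) (use X(4) poly in blast)
qed

section \<open>Point values of polynomials and their mean squares\<close>

lemma integral_zero_imp_zero:
  fixes f :: "point \<Rightarrow> real"
  assumes K: "compact K" "convex K" "interior K \<noteq> {}" and f: "continuous_on K f"
    and nonneg: "\<And>x. x \<in> K \<Longrightarrow> 0 \<le> f x" and int: "integral K f = 0" and x: "x \<in> K"
  shows "f x = 0"
proof -
  have cl: "closure (interior K) = K"
    using convex_closure_interior[OF K(2,3)] compact_imp_closed[OF K(1)] by simp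
  have meas: "interior K \<in> sets lborel" "K \<in> sets lborel" using compact_imp_closed[OF K(1)] by auto
  have "negligible (frontier K)" by (rule negligible_convex_frontier[OF K(2)])
  then have "negligible (K - interior K)"
    using K(1) by (simp add: frontier_def compact_imp_closed)
  then have "K - interior K \<in> null_sets lborel"
    using meas by (simp add: negligible_iff_null_sets null_sets_completion_iff)
  then have same: "emeasure lborel K = emeasure lborel (interior K)"
    using emeasure_Diff_null_set[of "K - interior K" lborel K] meas interior_subset[of K]
    by (simp add: double_diff)
  show ?thesis
  proof (rule has_integral_0_closure_imp_0[of "interior K" f x])
    show "0 < emeasure lborel (interior K)"
      using open_not_negligible[OF open_interior K(3)] meas(1)
      by (simp add: negligible_iff_emeasure0 zero_less_iff_neq_zero)
    show "emeasure lborel (interior K) < \<infinity>"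
      using emeasure_compact_finite[OF K(1)] same by simp
    show "(f has_integral 0) (closure (interior K))"
      unfolding cl using integrable_integral[OF integrable_on_compact[OF K(1) f]] int by simp
  qed (use cl f nonneg x same interior_subset[of K] in auto)
qed

lemma integral_Cauchy_Schwarz:
  fixes f g :: "point \<Rightarrow> real"
  assumes K: "compact K" "convex K" "interior K \<noteq> {}" and fg: "continuous_on K f" "continuous_on K g"
  shows "(integral K (\<lambda>x. f x * g x))\<^sup>2 \<le> integral K (\<lambda>x. (f x)\<^sup>2) * integral K (\<lambda>x. (g x)\<^sup>2)"
proof -
  define F2 G2 FG where "F2 = integral K (\<lambda>x. (f x)\<^sup>2)" and "G2 = integral K (\<lambda>x. (g x)\<^sup>2)"
    and "FG = integral K (\<lambda>x. f x * g x)"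
  note int = integrable_on_compact[OF K(1)]
  have "G2 \<ge> 0" unfolding G2_def by (intro integral_nonneg int continuous_intros fg) auto
  show ?thesis
  proof (cases "G2 = 0")
    case True
    have "(g x)\<^sup>2 = 0" if "x \<in> K" for x
      by (rule integral_zero_imp_zero[OF K _ _ True[unfolded G2_def] that]) (auto intro: continuous_intros fg)
    then have "FG = integral K (\<lambda>x. 0)" unfolding FG_def by (intro integral_cong) auto
    then show ?thesis using True by (simp add: FG_def G2_def)
  next
    case False
    have "0 \<le> integral K (\<lambda>x. (G2 * f x - FG * g x)\<^sup>2)"
      by (intro integral_nonneg int continuous_intros fg) auto
    also have "\<dots> = integral K (\<lambda>x. G2\<^sup>2 * (f x)\<^sup>2 - (2 * G2 * FG * (f x * g x) - FG\<^sup>2 * (g x)\<^sup>2))"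
      by (intro integral_cong) (simp add: power2_eq_square algebra_simps)
    also have "\<dots> = G2\<^sup>2 * F2 - (2 * G2 * FG * FG - FG\<^sup>2 * G2)"
      unfolding F2_def G2_def FG_def
      by (subst integral_diff; (subst integral_diff)?; (intro int continuous_intros fg)?; simp)
    also have "\<dots> = G2 * (F2 * G2 - FG\<^sup>2)" by (simp add: power2_eq_square algebra_simps)
    finally show ?thesis
      using False \<open>G2 \<ge> 0\<close> by (simp add: zero_le_mult_iff F2_def G2_def FG_def)
  qed
qed

text \<open>
  Equivalence of norms, obtained from a reproducing formula
  \<open>f y = (\<Sum>x\<in>X. P f x * m x y)\<close> with finitely many moments \<open>P f x = \<integral> f x\<close> of \<open>f\<close>
  against polynomials \<open>x\<close>. The formula holds because the remainder \<open>r\<close> is a polynomial all of whose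
  moments vanish, in particular the one against \<open>r\<close> itself.
\<close>

lemma polys_bounded_by_L2:
  assumes K: "compact K" "convex K" "interior K \<noteq> {}"
  obtains C where "C \<ge> 0" "\<And>f x. f \<in> polys k \<Longrightarrow> x \<in> K \<Longrightarrow> (f x)\<^sup>2 \<le> C * integral K (\<lambda>y. (f y)\<^sup>2)"
proof -
  define J where "J = (SIGMA i:{..k}. {..k - i})"
  define B where "B j a = integral K (\<lambda>x. monomial j x * a x)" for j a
  have J: "finite J" by (simp add: J_def)
  have polys: "polys k = lin_comb J monomial" unfolding J_def by (rule polys_eq_lin_comb)
  have cont: "continuous_on K f" if "f \<in> polys k" for f
    using C1_continuous[OF polys_C1[OF that]] continuous_on_subset by blast
  have mono: "monomial j \<in> polys k" if "j \<in> J" for j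
    unfolding polys by (rule lin_comb_base[OF J that])
  note int = integrable_on_compact[OF K(1)]
  have B_sum: "(\<Sum>j\<in>J. c j * B j a) = integral K (\<lambda>x. (\<Sum>j\<in>J. c j * monomial j x) * a x)"
    if a: "a \<in> polys k" for c a
  proof -
    have "integral K (\<lambda>x. (\<Sum>j\<in>J. c j * monomial j x) * a x) = integral K (\<lambda>x. \<Sum>j\<in>J. c j * (monomial j x * a x))"
      by (simp add: sum_distrib_right mult.assoc)
    also have "\<dots> = (\<Sum>j\<in>J. integral K (\<lambda>x. c j * (monomial j x * a x)))"
      by (intro integral_sum int J continuous_intros cont mono a)
    finally show ?thesis by (simp add: B_def)
  qed
  from lagrange_basis[OF J, of "polys k" B]
  obtain X L where XL: "finite X" "X \<subseteq> polys k" "\<forall>x\<in>X. L x \<in> lin_comb J B"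
    "\<forall>f\<in>lin_comb J B. \<forall>a\<in>polys k. f a = (\<Sum>x\<in>X. f x * L x a)"
    by (elim exE conjE) (rule that)
  have "\<forall>x\<in>X. \<exists>c. \<forall>a. L x a = (\<Sum>j\<in>J. c j * B j a)"
    using XL(3) unfolding lin_comb_def by simp
  then obtain c where c: "\<And>x a. x \<in> X \<Longrightarrow> L x a = (\<Sum>j\<in>J. c x j * B j a)"
    by (metis (no_types))
  define m where "m x y = (\<Sum>j\<in>J. c x j * monomial j y)" for x y
  have m: "m x \<in> polys k" for x unfolding polys by (rule lin_combI) (rule m_def)
  have L: "L x a = integral K (\<lambda>y. m x y * a y)" if "x \<in> X" "a \<in> polys k" for x a
    using c[OF that(1)] B_sum[OF that(2)] unfolding m_def by simp
  define P where "P f x = integral K (\<lambda>y. f y * x y)" for f x :: "point \<Rightarrow> real"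
  have repr: "f y = (\<Sum>x\<in>X. P f x * m x y)" if f: "f \<in> polys k" and y: "y \<in> K" for f y
  proof -
    obtain d where d: "\<forall>a. f a = (\<Sum>j\<in>J. d j * monomial j a)"
      using f unfolding polys lin_comb_def mem_Collect_eq by (elim exE) (rule that)
    have fd: "f = (\<lambda>a. \<Sum>j\<in>J. d j * monomial j a)" by (intro ext) (rule d[rule_format])
    have F: "(\<lambda>a. \<Sum>j\<in>J. d j * B j a) \<in> lin_comb J B" by (rule lin_combI) (rule refl)
    have P_eq: "(\<Sum>j\<in>J. d j * B j a) = P f a" if "a \<in> polys k" for a
      unfolding B_sum[OF that] P_def fd ..
    have P: "P f a = (\<Sum>x\<in>X. P f x * L x a)" if a: "a \<in> polys k" for a
    proof -
      have "P f a = (\<Sum>x\<in>X. (\<Sum>j\<in>J. d j * B j x) * L x a)"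
        using XL(4)[rule_format, OF F a] P_eq[OF a] by simp
      also have "\<dots> = (\<Sum>x\<in>X. P f x * L x a)"
        by (rule sum.cong) (use XL(2) P_eq in auto)
      finally show ?thesis .
    qed
    define r where "r y = f y - (\<Sum>x\<in>X. P f x * m x y)" for y
    have r: "r \<in> polys k"
      unfolding r_def using f m unfolding polys
      by (intro lin_comb_diff lin_comb_sum[OF XL(1)] lin_comb_scale)
    have "integral K (\<lambda>y. (r y)\<^sup>2) = integral K (\<lambda>y. f y * r y - (\<Sum>x\<in>X. P f x * (m x y * r y)))"
      by (intro integral_cong)
        (simp add: power2_eq_square r_def left_diff_distrib sum_distrib_right mult.assoc)
    also have "\<dots> = P f r - (\<Sum>x\<in>X. P f x * L x r)"
      unfolding P_def[of f r]
      by (subst integral_diff; (subst integral_sum)?)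
        (auto intro!: int continuous_intros cont[OF f] cont[OF r] cont[OF m] XL(1) simp: L[OF _ r])
    also have "\<dots> = 0" using P[OF r] by simp
    finally have "(r y)\<^sup>2 = 0"
      by (intro integral_zero_imp_zero[OF K _ _ _ y, of "\<lambda>y. (r y)\<^sup>2"]) (auto intro!: continuous_intros cont[OF r])
    then show ?thesis by (simp add: r_def)
  qed
  have "\<exists>M. \<forall>y\<in>K. (\<Sum>x\<in>X. (m x y)\<^sup>2) \<le> M"
  proof -
    have "compact ((\<lambda>y. \<Sum>x\<in>X. (m x y)\<^sup>2) ` K)"
      by (intro compact_continuous_image K continuous_intros cont m)
    then have "bdd_above ((\<lambda>y. \<Sum>x\<in>X. (m x y)\<^sup>2) ` K)"
      by (intro bounded_imp_bdd_above compact_imp_bounded)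
    then show ?thesis by (auto simp: bdd_above_def)
  qed
  then obtain M where M: "\<And>y. y \<in> K \<Longrightarrow> (\<Sum>x\<in>X. (m x y)\<^sup>2) \<le> M" by blast
  define N where "N = (\<Sum>x\<in>X. integral K (\<lambda>y. (x y)\<^sup>2))"
  have N: "N \<ge> 0" unfolding N_def
    by (intro sum_nonneg integral_nonneg int continuous_intros cont) (use XL(2) in auto)
  show thesis
  proof (rule that[of "N * \<bar>M\<bar>"])
    show "0 \<le> N * \<bar>M\<bar>" using N by simp
    fix f y assume f: "f \<in> polys k" and y: "y \<in> K"
    have f2: "0 \<le> integral K (\<lambda>y. (f y)\<^sup>2)"
      by (intro integral_nonneg int continuous_intros cont f) auto
    have "(f y)\<^sup>2 = (\<Sum>x\<in>X. P f x * m x y)\<^sup>2" using repr[OF f y] by simp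
    also have "\<dots> \<le> (\<Sum>x\<in>X. (P f x)\<^sup>2) * (\<Sum>x\<in>X. (m x y)\<^sup>2)"
      by (rule Cauchy_Schwarz_ineq_sum)
    also have "\<dots> \<le> (integral K (\<lambda>y. (f y)\<^sup>2) * N) * \<bar>M\<bar>"
    proof (intro mult_mono)
      have "(\<Sum>x\<in>X. (P f x)\<^sup>2) \<le> (\<Sum>x\<in>X. integral K (\<lambda>y. (f y)\<^sup>2) * integral K (\<lambda>y. (x y)\<^sup>2))"
        unfolding P_def
        by (intro sum_mono integral_Cauchy_Schwarz K cont f) (use XL(2) in auto)
      then show "(\<Sum>x\<in>X. (P f x)\<^sup>2) \<le> integral K (\<lambda>y. (f y)\<^sup>2) * N"
        by (simp add: N_def sum_distrib_left)
      show "(\<Sum>x\<in>X. (m x y)\<^sup>2) \<le> \<bar>M\<bar>" using M[OF y] by simp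
    qed (use f2 N in \<open>auto intro: sum_nonneg\<close>)
    finally show "(f y)\<^sup>2 \<le> N * \<bar>M\<bar> * integral K (\<lambda>y. (f y)\<^sup>2)" by (simp add: mult_ac)
  qed
qed

section \<open>Triangles and outward normals\<close>

lemma cross2_eq_0_imp_collinear:
  assumes "cross2 (b - a) (c - a) = 0"
  shows "collinear {a, b, c}"
proof -
  define v where "v = b - a"
  define w where "w = c - a"
  have "collinear {0, v, w}"
  proof (cases "v = 0")
    case False
    then have nz: "v \<bullet> v \<noteq> 0" by simp
    have "(v \<bullet> v) *\<^sub>R w = (v \<bullet> w) *\<^sub>R v"
      using assms unfolding v_def[symmetric] w_def[symmetric] cross2_def
      by (simp add: vec_eq_iff forall_2 inner_vec_def sum_2) algebra
    then have "(1 / (v \<bullet> v)) *\<^sub>R ((v \<bullet> v) *\<^sub>R w) = (1 / (v \<bullet> v)) *\<^sub>R ((v \<bullet> w) *\<^sub>R v)" by simp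
    then have "w = ((v \<bullet> w) / (v \<bullet> v)) *\<^sub>R v" using nz by simp
    then show ?thesis unfolding collinear_lemma by blast
  qed (simp add: insert_commute)
  moreover have "collinear {b, a, c} \<longleftrightarrow> collinear {0, b - a, c - a}"
    by (rule collinear_3) (simp add: NO_MATCH_def)
  ultimately show ?thesis by (simp add: v_def w_def insert_commute)
qed

lemma simplex_2_obtain:
  assumes "2 simplex K"
  obtains a b c where "K = convex hull {a, b, c}" "\<not> collinear {a, b, c}"
proof -
  obtain C where C: "\<not> affine_dependent C" "int (card C) = 2 + 1" "K = convex hull C"
    using assms unfolding simplex_def by blast
  then have "card C = 3" by simp
  then obtain a b c where abc: "C = {a, b, c}" "a \<noteq> b" "a \<noteq> c" "b \<noteq> c"
    unfolding card_3_iff by blast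
  then have "\<not> collinear {a, b, c}"
    using C(1) by (simp add: collinear_3_eq_affine_dependent)
  then show thesis using that C(3) abc(1) by blast
qed

lemma triangle_side_obtain:
  assumes "2 simplex K" "E face_of K" "aff_dim E = 1"
  obtains a b c where "K = convex hull {a, b, c}" "\<not> collinear {a, b, c}" "E = closed_segment b c"
proof -
  obtain C where C: "\<not> affine_dependent C" "int (card C) = 2 + 1" "K = convex hull C"
    using assms unfolding simplex_def by blast
  obtain D where D: "D \<subseteq> C" "E = convex hull D"
    using assms(2) face_of_convex_hull_affine_independent[OF C(1)] C(3) by blast
  have finC: "finite C" using C(1) by (rule aff_independent_finite)
  have "\<not> affine_dependent D" using affine_independent_subset[OF C(1) D(1)] .
  then have "card D = 2"
    using assms(3) D(2) aff_dim_affine_independent[of D] by (simp add: aff_dim_convex_hull)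
  then obtain b c where bc: "D = {b, c}" "b \<noteq> c" unfolding card_2_iff by blast
  have "card (C - D) = 1" using C(2) \<open>card D = 2\<close> D(1) finC by (simp add: card_Diff_subset finite_subset)
  then obtain a where "C - D = {a}" by (rule card_1_singletonE)
  then have a: "C = {a, b, c}" "a \<noteq> b" "a \<noteq> c" using D(1) bc by auto
  then have "\<not> collinear {a, b, c}"
    using C(1) bc(2) by (simp add: collinear_3_eq_affine_dependent)
  then show thesis using that[of a b c] C(3) a(1) D(2) bc(1) by (simp add: segment_convex_hull)
qed

lemma triangle_compact: "2 simplex K \<Longrightarrow> compact K"
  by (elim simplex_2_obtain) (simp add: finite_imp_compact_convex_hull)

lemma triangle_convex: "2 simplex K \<Longrightarrow> convex (K :: point set)"
  by (elim simplex_2_obtain) simp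

lemma interior_triangle:
  fixes a b c :: point
  assumes "\<not> collinear {a, b, c}"
  shows "interior (convex hull {a, b, c}) =
    {v. \<exists>x y z. 0 < x \<and> 0 < y \<and> 0 < z \<and> x + y + z = 1 \<and> x *\<^sub>R a + y *\<^sub>R b + z *\<^sub>R c = v}"
  by (rule interior_convex_hull_3_minimal[OF assms]) simp

lemma triangle_interior:
  assumes "2 simplex (K :: point set)"
  shows "interior K \<noteq> {}"
proof -
  obtain a b c where K: "K = convex hull {a, b, c}" "\<not> collinear {a, b, c}"
    using assms by (rule simplex_2_obtain)
  have "(1/3) *\<^sub>R a + (1/3) *\<^sub>R b + (1/3) *\<^sub>R c \<in> interior K"
    unfolding K(1) interior_triangle[OF K(2)] mem_Collect_eq
    by (intro exI[of _ "1/3"]) simp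
  then show ?thesis by blast
qed

lemma simplex_translation:
  assumes "n simplex (K :: point set)"
  shows "n simplex ((+) s ` K)"
proof -
  obtain C where C: "\<not> affine_dependent C" "int (card C) = n + 1" "K = convex hull C"
    using assms unfolding simplex_def by blast
  have "\<not> affine_dependent ((+) s ` C)" using C(1) by (simp add: affine_dependent_translation_eq[symmetric])
  moreover have "card ((+) s ` C) = card C" by (rule card_image) simp
  moreover have "(+) s ` K = convex hull ((+) s ` C)" unfolding C(3) by (rule convex_hull_translation[symmetric])
  ultimately show ?thesis using C(2) unfolding simplex_def by metis
qed

text \<open>
  Near the midpoint of the common side both triangles fill the same half disc. The witness moves from
  the midpoint a short way towards \<open>a'\<close>; the step \<open>e\<close> is small enough that its barycentric
  coordinates with respect to \<open>a, b, c\<close> are still positive.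
\<close>

lemma triangles_same_side_overlap:
  fixes a a' b c n :: point
  assumes nc: "\<not> collinear {a, b, c}" "\<not> collinear {a', b, c}"
    and n: "n \<bullet> (c - b) = 0" "n \<bullet> (a - b) < 0" "n \<bullet> (a' - b) < 0"
  shows "interior (convex hull {a, b, c}) \<inter> interior (convex hull {a', b, c}) \<noteq> {}"
proof -
  define m where "m = (1/2) *\<^sub>R b + (1/2) *\<^sub>R c"
  have "cross2 (b - a) (c - a) \<noteq> 0" using cross2_eq_0_imp_collinear nc(1) by blast
  moreover have "cross2 (a - m) (c - b) = - cross2 (b - a) (c - a)"
    by (simp add: cross2_def m_def field_simps)
  ultimately have "cross2 (a - m) (c - b) \<noteq> 0" by simp
  then obtain l u where lu: "a' - m = l *\<^sub>R (a - m) + u *\<^sub>R (c - b)" by (rule cross2_span)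
  have nm: "n \<bullet> m = n \<bullet> b" using n(1) by (simp add: m_def inner_add_right inner_diff_right)
  have "n \<bullet> (a' - m) = l * (n \<bullet> (a - m))"
    unfolding lu using n(1) by (simp add: inner_add_right)
  then have "l * (n \<bullet> (a - b)) < 0" using n(3) nm by (simp add: inner_diff_right)
  then have l: "l > 0" using n(2) by (simp add: mult_less_0_iff)
  define e where "e = 1 / (2 + l + 2 * \<bar>u\<bar>)"
  have e: "e > 0" "e < 1" using l by (auto simp: e_def)
  have "e * l + 2 * \<bar>e * u\<bar> = e * (l + 2 * \<bar>u\<bar>)" using e(1) by (simp add: abs_mult algebra_simps)
  also have "\<dots> < 1" using l by (simp add: e_def)
  finally have el: "e * l + 2 * \<bar>e * u\<bar> < 1" .
  define y where "y = m + e *\<^sub>R (a' - m)"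
  have "y = e *\<^sub>R a' + ((1 - e) / 2) *\<^sub>R b + ((1 - e) / 2) *\<^sub>R c"
    by (simp add: y_def m_def vec_eq_iff field_simps)
  then have "y \<in> interior (convex hull {a', b, c})"
    unfolding interior_triangle[OF nc(2)] mem_Collect_eq using e(1,2)
    by (intro exI[of _ e] exI[of _ "(1 - e) / 2"]) simp
  moreover have yT: "y = (e * l) *\<^sub>R a + ((1 - e * l) / 2 - e * u) *\<^sub>R b + ((1 - e * l) / 2 + e * u) *\<^sub>R c"
    unfolding y_def lu by (simp add: m_def vec_eq_iff field_simps)
  have "y \<in> interior (convex hull {a, b, c})"
    unfolding interior_triangle[OF nc(1)] mem_Collect_eq
  proof (rule exI[where x = "e * l"], rule exI[where x = "(1 - e * l) / 2 - e * u"],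
      rule exI[where x = "(1 - e * l) / 2 + e * u"], intro conjI)
    have "2 * (e * u) < 1 - e * l" "- 2 * (e * u) < 1 - e * l"
      using el abs_ge_self[of "e * u"] abs_ge_minus_self[of "e * u"] by linarith+
    then show "0 < (1 - e * l) / 2 - e * u" "0 < (1 - e * l) / 2 + e * u" by (simp_all add: field_simps)
  qed (use e l in \<open>simp_all add: yT field_simps\<close>)
  ultimately show ?thesis by blast
qed

text \<open>
  The condition that defines \<^const>\<open>normal\<close> only has to be checked at the vertices.
\<close>

lemma outward_normal_iff:
  "(\<forall>x\<in>closed_segment b c. \<forall>y\<in>convex hull {a, b, c}. n \<bullet> (y - x) \<le> 0)
     \<longleftrightarrow> n \<bullet> (c - b) = 0 \<and> n \<bullet> (a - b) \<le> (0::real)" (is "?L \<longleftrightarrow> ?R")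
proof
  assume L: ?L
  have "a \<in> convex hull {a, b, c}" "b \<in> convex hull {a, b, c}" "c \<in> convex hull {a, b, c}"
    by (auto intro: hull_inc)
  then have "n \<bullet> (c - b) \<le> 0" "n \<bullet> (b - c) \<le> 0" "n \<bullet> (a - b) \<le> 0" using L by auto
  then show ?R by (simp add: inner_diff_right)
next
  assume R: ?R
  show ?L
  proof (intro ballI)
    fix x y assume x: "x \<in> closed_segment b c" and y: "y \<in> convex hull {a, b, c}"
    obtain t where "x = (1 - t) *\<^sub>R b + t *\<^sub>R c" using x unfolding closed_segment_def by blast
    then have "n \<bullet> x = (1 - t) * (n \<bullet> b) + t * (n \<bullet> c)" by (simp add: inner_add_right)
    then have nx: "n \<bullet> x = n \<bullet> b" using R by (simp add: inner_diff_right algebra_simps)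
    obtain u v w where y': "0 \<le> u" "u + v + w = 1" "y = u *\<^sub>R a + v *\<^sub>R b + w *\<^sub>R c"
      using y unfolding convex_hull_3 by blast
    have "n \<bullet> y = u * (n \<bullet> a) + (v + w) * (n \<bullet> b)"
      using R unfolding y'(3) by (simp add: inner_add_right inner_diff_right algebra_simps)
    also have "v + w = 1 - u" using y'(2) by simp
    finally have "n \<bullet> y - n \<bullet> b = u * (n \<bullet> (a - b))" by (simp add: inner_diff_right algebra_simps)
    then show "n \<bullet> (y - x) \<le> 0" using R y'(1) nx by (simp add: inner_diff_right[of n y x] mult_nonneg_nonpos)
  qed
qed

lemma outward_normal_unique:
  fixes a b c :: point
  assumes nc: "\<not> collinear {a, b, c}"
    and n: "norm n = 1" "n \<bullet> (c - b) = 0" "n \<bullet> (a - b) \<le> 0"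
    and n': "norm n' = 1" "n' \<bullet> (c - b) = 0" "n' \<bullet> (a - b) \<le> 0"
  shows "n = n'"
proof -
  have nz: "cross2 (b - a) (c - a) \<noteq> 0" using cross2_eq_0_imp_collinear nc by blast
  have "b \<noteq> c" using nc by auto
  then have eq: "n \<bullet> (b - a) = n' \<bullet> (b - a)"
    using trans[OF scaled_normal[OF n] scaled_normal[OF n', symmetric]] by simp
  moreover have "n \<bullet> (c - a) = n' \<bullet> (c - a)" using eq n(2) n'(2) by (simp add: inner_diff_right)
  moreover obtain s t where st: "n - n' = s *\<^sub>R (b - a) + t *\<^sub>R (c - a)" by (rule cross2_span[OF nz])
  ultimately have "(n - n') \<bullet> (n - n') = 0"
    unfolding st inner_add_right inner_scaleR_right by (simp add: st[symmetric] inner_diff_left)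
  then show ?thesis by simp
qed

lemma outward_normal_exists:
  fixes a b c :: point
  assumes "\<not> collinear {a, b, c}"
  obtains n where "norm n = 1" "n \<bullet> (c - b) = 0" "n \<bullet> (a - b) \<le> 0"
proof -
  define r where "r = c - b"
  define m where "m = (1 / norm r) *\<^sub>R (vector [r $ 2, - r $ 1] :: point)"
  have "b \<noteq> c" using assms by auto
  then have r: "norm r \<noteq> 0" by (simp add: r_def)
  have "norm (vector [r $ 2, - r $ 1] :: point) = norm r"
    by (simp add: norm_vec_def L2_set_def sum_2 add.commute)
  then have "norm m = 1" using r by (simp add: m_def)
  moreover have mr: "m \<bullet> r = 0" by (simp add: m_def inner_vec_def sum_2)
  ultimately show thesis
    using that[of m] that[of "- m"] by (cases "m \<bullet> (a - b) \<le> 0") (auto simp: r_def)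
qed

lemma normal_characterization:
  fixes a b c :: point
  assumes F: "Kplus F = convex hull {a, b, c}" "edge_set F = closed_segment b c" and nc: "\<not> collinear {a, b, c}"
  shows "normal F = n \<longleftrightarrow> norm n = 1 \<and> n \<bullet> (c - b) = 0 \<and> n \<bullet> (a - b) \<le> 0"
proof -
  let ?P = "\<lambda>n. norm n = 1 \<and> n \<bullet> (c - b) = 0 \<and> n \<bullet> (a - b) \<le> 0"
  have def: "normal F = (THE n. ?P n)" unfolding normal_def F outward_normal_iff ..
  obtain m where m: "?P m" using outward_normal_exists[OF nc] by blast
  have uniq: "n = m" if "?P n" for n using that m by (intro outward_normal_unique[OF nc]) simp_all
  have "normal F = m" unfolding def by (rule the_equality[of ?P, OF m]) (rule uniq)
  then show ?thesis using m uniq by blast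
qed

lemma normal_facts:
  fixes a b c :: point
  assumes F: "Kplus F = convex hull {a, b, c}" "edge_set F = closed_segment b c" and nc: "\<not> collinear {a, b, c}"
  shows "norm (normal F) = 1" "normal F \<bullet> (c - b) = 0" "normal F \<bullet> (a - b) < 0"
proof -
  have n: "norm (normal F) = 1" "normal F \<bullet> (c - b) = 0" "normal F \<bullet> (a - b) \<le> 0"
    using normal_characterization[OF F nc, of "normal F"] by auto
  then show "norm (normal F) = 1" "normal F \<bullet> (c - b) = 0" by auto
  have "cross2 (b - a) (c - a) \<noteq> 0" using cross2_eq_0_imp_collinear nc by blast
  then have "normal F \<bullet> (b - a) \<noteq> 0" using scaled_normal[OF n] by auto
  then show "normal F \<bullet> (a - b) < 0" using n(3) by (simp add: inner_diff_right)
qed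

section \<open>Geometry of periodic triangulations\<close>

lemma independent_imp_cross2_nonzero:
  fixes p q :: point
  assumes "independent {p, q}" "p \<noteq> q"
  shows "cross2 p q \<noteq> 0"
proof
  assume "cross2 p q = 0"
  then have "collinear {0, p, q}"
    using cross2_eq_0_imp_collinear[of p 0 q] by simp
  then have "p = 0 \<or> q = 0 \<or> (\<exists>c. q = c *\<^sub>R p)" by (simp add: collinear_lemma)
  moreover have "p \<noteq> 0" "q \<noteq> 0" using assms(1) dependent_zero by auto
  ultimately obtain c where "q = c *\<^sub>R p" by blast
  moreover have "{p, q} - {q} = {p}" using assms(2) by auto
  ultimately have "q \<in> span ({p, q} - {q})" by (simp add: span_base span_mul)
  then show False using assms(1) unfolding dependent_def by blast
qed

text \<open>
  Cramer's rule recovers the integer coordinates of a lattice vector, hence bounds them by its norm.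
\<close>

lemma finite_lattice_bounded:
  assumes "independent {p, q}" "p \<noteq> q"
  shows "finite {l \<in> lattice p q. norm l \<le> R}"
proof -
  have nz: "cross2 p q \<noteq> 0" using independent_imp_cross2_nonzero[OF assms] .
  define M where "M = 2 * R * (norm p + norm q) / \<bar>cross2 p q\<bar>"
  have cross_bound: "\<bar>cross2 v w\<bar> \<le> 2 * norm v * norm w" for v w :: point
  proof -
    have "\<bar>cross2 v w\<bar> \<le> \<bar>v $ 1\<bar> * \<bar>w $ 2\<bar> + \<bar>v $ 2\<bar> * \<bar>w $ 1\<bar>"
      unfolding cross2_def using abs_triangle_ineq4[of "v $ 1 * w $ 2" "v $ 2 * w $ 1"] by (simp add: abs_mult)
    also have "\<dots> \<le> norm v * norm w + norm v * norm w"
      by (intro add_mono mult_mono component_le_norm_cart) auto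
    finally show ?thesis by simp
  qed
  have "{l \<in> lattice p q. norm l \<le> R}
      \<subseteq> (\<lambda>(m, n). of_int m *\<^sub>R p + of_int n *\<^sub>R q) ` ({-\<lceil>M\<rceil>..\<lceil>M\<rceil>} \<times> {-\<lceil>M\<rceil>..\<lceil>M\<rceil>})"
  proof
    fix l assume "l \<in> {l \<in> lattice p q. norm l \<le> R}"
    then obtain m n where l: "l = of_int m *\<^sub>R p + of_int n *\<^sub>R q" "norm l \<le> R"
      unfolding lattice_def by blast
    have "R \<ge> 0" using norm_ge_zero[of l] l(2) by linarith
    have bound: "\<bar>z\<bar> \<le> \<lceil>M\<rceil>" if "\<bar>real_of_int z\<bar> * \<bar>cross2 p q\<bar> = \<bar>cross2 l w\<bar>" "norm w \<le> norm p + norm q" for z w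
    proof -
      have "\<bar>cross2 l w\<bar> \<le> 2 * norm l * norm w" by (rule cross_bound)
      also have "\<dots> \<le> 2 * R * (norm p + norm q)" using l(2) that(2) \<open>R \<ge> 0\<close> by (intro mult_mono) auto
      finally have "\<bar>real_of_int z\<bar> \<le> M" using that(1) nz by (simp add: M_def field_simps)
      then show ?thesis by linarith
    qed
    have "cross2 l q = of_int m * cross2 p q" "cross2 l p = - (of_int n * cross2 p q)"
      unfolding l(1) by (simp_all add: cross2_def algebra_simps)
    then have "\<bar>m\<bar> \<le> \<lceil>M\<rceil>" "\<bar>n\<bar> \<le> \<lceil>M\<rceil>"
      by (intro bound[of m q] bound[of n p]; simp add: abs_mult)+
    then show "l \<in> (\<lambda>(m, n). of_int m *\<^sub>R p + of_int n *\<^sub>R q) ` ({-\<lceil>M\<rceil>..\<lceil>M\<rceil>} \<times> {-\<lceil>M\<rceil>..\<lceil>M\<rceil>})"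
      unfolding l(1) by (intro image_eqI[of _ _ "(m, n)"]) auto
  qed
  then show ?thesis by (rule finite_subset) auto
qed

lemma lattice_zero: "0 \<in> lattice p q"
  unfolding lattice_def by (auto intro!: exI[of _ 0])

lemma lattice_diff:
  assumes "l \<in> lattice p q" "l' \<in> lattice p q"
  shows "l - l' \<in> lattice p q"
proof -
  obtain m n m' n' where "l = of_int m *\<^sub>R p + of_int n *\<^sub>R q" "l' = of_int m' *\<^sub>R p + of_int n' *\<^sub>R q"
    using assms unfolding lattice_def by blast
  then have "l - l' = of_int (m - m') *\<^sub>R p + of_int (n - n') *\<^sub>R q" by (simp add: algebra_simps)
  then show ?thesis unfolding lattice_def by blast
qed

lemma lattice_minus: "l \<in> lattice p q \<Longrightarrow> - l \<in> lattice p q"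
  using lattice_diff[OF lattice_zero] by fastforce

lemma flip_flip: "flip (flip F) = F"
  by (simp add: flip_def)

lemma edge_set_flip: "edge_set (flip F) = (+) (- shift F) ` edge_set F"
proof -
  have "(+) (- shift F) ` (Kplus F \<inter> (+) (shift F) ` Kminus F)
      = (+) (- shift F) ` Kplus F \<inter> (+) (- shift F) ` (+) (shift F) ` Kminus F"
    by (rule image_Int) simp
  then show ?thesis unfolding edge_set_def flip_def by (simp add: image_image Int_commute)
qed

lemma integrable_on_linepath:
  fixes f :: "point \<Rightarrow> 'a::euclidean_space"
  assumes "continuous_on UNIV f"
  shows "(\<lambda>s. f (linepath a b s)) integrable_on {0..1}"
  by (intro integrable_continuous_real continuous_on_compose2[OF assms continuous_on_linepath]) simp

locale mesh =
  fixes p q :: point and \<T> :: "elem set" and \<E> :: "edge set"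
  assumes triangulation: "periodic_triangulation p q \<T>"
    and edges: "mesh_edges p q \<T> \<E>"
begin

abbreviation \<O> :: "edge set" where "\<O> \<equiv> oriented_edges p q \<T>"

lemma finite_mesh: "finite \<T>"
  and mesh_simplex: "K \<in> \<T> \<Longrightarrow> 2 simplex K"
  and mesh_cover: "(\<Union>K\<in>\<T>. \<Union>l\<in>lattice p q. (+) l ` K) = UNIV"
  and periods: "independent {p, q}" "p \<noteq> q"
  using triangulation unfolding periodic_triangulation_def by auto

lemma mesh_conforming:
  assumes "K \<in> \<T>" "K' \<in> \<T>" "l \<in> lattice p q" "(K, 0) \<noteq> (K', l)"
  shows "interior K \<inter> interior ((+) l ` K') = {}"
    "(K \<inter> (+) l ` K') face_of K" "(K \<inter> (+) l ` K') face_of ((+) l ` K')"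
  using triangulation assms unfolding periodic_triangulation_def by simp_all

lemma oriented_edgesD:
  assumes "F \<in> \<O>"
  shows "Kplus F \<in> \<T>" "Kminus F \<in> \<T>" "shift F \<in> lattice p q" "aff_dim (edge_set F) = 1"
    "(Kplus F, 0) \<noteq> (Kminus F, shift F)"
proof -
  show *: "Kplus F \<in> \<T>" "Kminus F \<in> \<T>" "shift F \<in> lattice p q" "aff_dim (edge_set F) = 1"
    using assms unfolding oriented_edges_def by auto
  show "(Kplus F, 0) \<noteq> (Kminus F, shift F)"
  proof
    assume "(Kplus F, 0) = (Kminus F, shift F)"
    then have "edge_set F = Kplus F" by (auto simp: edge_set_def)
    then show False using *(4) aff_dim_simplex[OF mesh_simplex[OF *(1)]] by simp
  qed
qed

lemma mesh_bounded: "\<exists>B. \<forall>K\<in>\<T>. \<forall>x\<in>K. norm x \<le> B"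
proof -
  have "bounded (\<Union>\<T>)"
    using finite_mesh compact_imp_bounded[OF triangle_compact[OF mesh_simplex]] by (intro bounded_Union) auto
  then show ?thesis unfolding bounded_iff by auto
qed

lemma finite_oriented_edges: "finite \<O>"
proof -
  obtain B where B: "\<And>K x. K \<in> \<T> \<Longrightarrow> x \<in> K \<Longrightarrow> norm x \<le> B" using mesh_bounded by metis
  let ?L = "{l \<in> lattice p q. norm l \<le> 2 * B}"
  have "\<O> \<subseteq> (\<lambda>(K, K', l). Edge K K' l) ` (\<T> \<times> \<T> \<times> ?L)"
  proof
    fix F assume F: "F \<in> \<O>"
    note D = oriented_edgesD[OF F]
    have "edge_set F \<noteq> {}" using D(4) by auto
    then obtain y where y: "y \<in> Kminus F" "shift F + y \<in> Kplus F" unfolding edge_set_def by auto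
    have "norm (shift F) \<le> norm (shift F + y) + norm y"
      using norm_triangle_ineq4[of "shift F + y" y] by simp
    also have "\<dots> \<le> 2 * B" using B[OF D(2) y(1)] B[OF D(1) y(2)] by simp
    finally show "F \<in> (\<lambda>(K, K', l). Edge K K' l) ` (\<T> \<times> \<T> \<times> ?L)"
      using D by (intro image_eqI[of _ _ "(Kplus F, Kminus F, shift F)"]) auto
  qed
  moreover have "finite (\<T> \<times> \<T> \<times> ?L)"
    using finite_mesh finite_lattice_bounded[OF periods] by simp
  ultimately show ?thesis by (meson finite_imageI finite_subset)
qed

text \<open>
  The two triangles at an edge have disjoint interiors, so by \<open>triangles_same_side_overlap\<close> their third
  vertices lie on different sides of it.
\<close>

lemma edge_neighbours:
  assumes F: "F \<in> \<O>"
  obtains a a' b c where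
    "Kplus F = convex hull {a, b, c}" "\<not> collinear {a, b, c}" "edge_set F = closed_segment b c"
    "(+) (shift F) ` Kminus F = convex hull {a', b, c}" "\<not> collinear {a', b, c}"
    "normal F \<bullet> (a' - b) > 0"
proof -
  note D = oriented_edgesD[OF F]
  note C = mesh_conforming[OF D(1-3,5)]
  have S: "2 simplex ((+) (shift F) ` Kminus F)" by (rule simplex_translation[OF mesh_simplex[OF D(2)]])
  have aff: "aff_dim (Kplus F \<inter> (+) (shift F) ` Kminus F) = 1" using D(4) by (simp add: edge_set_def)
  obtain a b c where abc: "Kplus F = convex hull {a, b, c}" "\<not> collinear {a, b, c}" "edge_set F = closed_segment b c"
    using triangle_side_obtain[OF mesh_simplex[OF D(1)] C(2) aff] unfolding edge_set_def by blast
  obtain a' b' c' where abc': "(+) (shift F) ` Kminus F = convex hull {a', b', c'}" "\<not> collinear {a', b', c'}"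
    "edge_set F = closed_segment b' c'"
    using triangle_side_obtain[OF S C(3) aff] unfolding edge_set_def by blast
  have "{b', c'} = {b, c}" using abc(3) abc'(3) by simp
  then have eq: "{a', b', c'} = {a', b, c}" by simp
  note abc' = abc'(1,2)[unfolded eq]
  note n = normal_facts[OF abc(1,3,2)]
  have "normal F \<bullet> (a' - b) > 0"
  proof (rule ccontr)
    assume "\<not> normal F \<bullet> (a' - b) > 0"
    moreover have "normal F \<bullet> (a' - b) \<noteq> 0"
    proof
      assume 0: "normal F \<bullet> (a' - b) = 0"
      have "dist b c * (normal F \<bullet> (b - a')) = \<bar>cross2 (b - a') (c - a')\<bar>"
        by (rule scaled_normal[OF n(1,2)]) (use 0 in simp)
      moreover have "normal F \<bullet> (b - a') = 0" using 0 by (simp add: inner_diff_right)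
      ultimately have "cross2 (b - a') (c - a') = 0" by simp
      then show False using cross2_eq_0_imp_collinear abc'(2) by blast
    qed
    ultimately have "normal F \<bullet> (a' - b) < 0" by simp
    from triangles_same_side_overlap[OF abc(2) abc'(2) n(2,3) this] C(1)
    show False unfolding abc(1) abc'(1) by blast
  qed
  then show thesis by (rule that[OF abc abc'])
qed

lemma edge_set_segment:
  assumes "F \<in> \<O>"
  obtains a b where "edge_set F = closed_segment a b"
  using edge_neighbours[OF assms] by metis

lemma flip_oriented:
  assumes "F \<in> \<O>"
  shows "flip F \<in> \<O>"
  using assms lattice_minus unfolding oriented_edges_def mem_Collect_eq edge_set_flip aff_dim_translation_eq
  by (auto simp: flip_def)

lemma normal_flip:
  assumes F: "F \<in> \<O>"
  shows "normal (flip F) = - normal F"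
proof -
  obtain a a' b c where abc: "Kplus F = convex hull {a, b, c}" "\<not> collinear {a, b, c}" "edge_set F = closed_segment b c"
    and abc': "(+) (shift F) ` Kminus F = convex hull {a', b, c}" "\<not> collinear {a', b, c}"
    "normal F \<bullet> (a' - b) > 0"
    by (rule edge_neighbours[OF F])
  note n = normal_facts[OF abc(1,3,2)]
  let ?s = "shift F"
  have "Kplus (flip F) = (+) (- ?s) ` (+) ?s ` Kminus F" by (simp add: flip_def image_image)
  also have "\<dots> = convex hull {- ?s + a', - ?s + b, - ?s + c}"
    unfolding abc'(1) convex_hull_translation[symmetric] by simp
  finally have K: "Kplus (flip F) = convex hull {- ?s + a', - ?s + b, - ?s + c}" .
  have E: "edge_set (flip F) = closed_segment (- ?s + b) (- ?s + c)"
    unfolding edge_set_flip abc(3) by (rule closed_segment_translation[symmetric])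
  have "\<not> collinear {- ?s + a', - ?s + b, - ?s + c}"
    using abc'(2) by (auto simp: collinear_def)
  from normal_characterization[OF K E this, of "- normal F"] show ?thesis using n abc'(3) by simp
qed

text \<open>
  Two neighbours across the same side would both lie beyond it and therefore overlap.
\<close>

lemma edge_unique:
  assumes F: "F \<in> \<O>" and G: "G \<in> \<O>" and eq: "Kplus F = Kplus G" "edge_set F = edge_set G"
  shows "F = G"
proof (rule ccontr)
  assume ne: "F \<noteq> G"
  have n: "normal F = normal G" unfolding normal_def eq ..
  obtain a a' b c where abc: "Kplus F = convex hull {a, b, c}" "\<not> collinear {a, b, c}" "edge_set F = closed_segment b c"
    and abc': "(+) (shift F) ` Kminus F = convex hull {a', b, c}" "\<not> collinear {a', b, c}"
    "normal F \<bullet> (a' - b) > 0"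
    by (rule edge_neighbours[OF F])
  obtain d d' e f where def: "edge_set G = closed_segment e f"
    and def': "(+) (shift G) ` Kminus G = convex hull {d', e, f}" "\<not> collinear {d', e, f}"
    "normal G \<bullet> (d' - e) > 0"
    by (rule edge_neighbours[OF G])
  have bc: "{e, f} = {b, c}" using abc(3) def eq(2) by simp
  then have set_eq: "{d', e, f} = {d', b, c}" by simp
  have nbc: "normal F \<bullet> (c - b) = 0" using normal_facts[OF abc(1,3,2)] by simp
  then have "normal F \<bullet> e = normal F \<bullet> b" using bc by (auto simp: inner_diff_right doubleton_eq_iff)
  then have d': "normal F \<bullet> (d' - b) > 0" using def'(3) n by (simp add: inner_diff_right)
  have overlap: "interior ((+) (shift F) ` Kminus F) \<inter> interior ((+) (shift G) ` Kminus G) \<noteq> {}"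
    unfolding abc'(1) def'(1) set_eq
    by (rule triangles_same_side_overlap[OF abc'(2) def'(2)[unfolded set_eq], of "- normal F"])
      (use nbc d' abc'(3) in auto)
  note DF = oriented_edgesD[OF F] and DG = oriented_edgesD[OF G]
  have "(Kminus F, 0) \<noteq> (Kminus G, shift G - shift F)"
    using ne eq(1) by (cases F; cases G) auto
  from mesh_conforming(1)[OF DF(2) DG(2) lattice_diff[OF DG(3) DF(3)] this]
  have "(+) (shift F) ` (interior (Kminus F) \<inter> interior ((+) (shift G - shift F) ` Kminus G)) = {}" by simp
  moreover have "(+) (shift F) ` (interior (Kminus F) \<inter> interior ((+) (shift G - shift F) ` Kminus G))
     = interior ((+) (shift F) ` Kminus F) \<inter> interior ((+) (shift G) ` Kminus G)"
    by (simp add: image_Int interior_translation[symmetric] image_image)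
  ultimately show False using overlap by simp
qed

text \<open>
  Points just outside \<open>K\<close> beyond the midpoint \<open>m\<close> of the side are covered by other translates. Only
  finitely many of these come near \<open>m\<close>, so a point \<open>y\<close> close enough to \<open>m\<close> lies in one that also
  contains \<open>m\<close>. Its intersection with \<open>K\<close> is a face of \<open>K\<close> containing \<open>m\<close> and different from \<open>K\<close>, which
  leaves the side itself.
\<close>

lemma side_is_edge:
  assumes K: "K \<in> \<T>" "K = convex hull {a, b, c}" "\<not> collinear {a, b, c}"
  obtains F where "F \<in> \<O>" "Kplus F = K" "edge_set F = closed_segment b c"
proof -
  have "b \<noteq> c" using K(3) by auto
  have na: "\<not> affine_dependent {a, b, c}" using K(3) by (simp add: collinear_3_eq_affine_dependent)
  define m where "m = midpoint b c"
  obtain B where B: "\<And>K x. K \<in> \<T> \<Longrightarrow> x \<in> K \<Longrightarrow> norm x \<le> B" using mesh_bounded by metis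
  define L where "L = {l \<in> lattice p q. norm l \<le> norm m + 1 + B}"
  have L: "finite L" unfolding L_def by (rule finite_lattice_bounded[OF periods])
  \<comment> \<open>The nearby translates that miss \<open>m\<close>: a closed set at positive distance from \<open>m\<close>.\<close>
  define U where "U = (\<Union>X\<in>{X \<in> (\<lambda>(l, K). (+) l ` K) ` (L \<times> \<T>). m \<notin> X}. X)"
  have "closed U"
    unfolding U_def
  proof (intro closed_UN ballI)
    show "finite {X \<in> (\<lambda>(l, K). (+) l ` K) ` (L \<times> \<T>). m \<notin> X}" using L finite_mesh by simp
    fix X assume "X \<in> {X \<in> (\<lambda>(l, K). (+) l ` K) ` (L \<times> \<T>). m \<notin> X}"
    then obtain l K where "K \<in> \<T>" "X = (+) l ` K" by auto
    then show "closed X"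
      using closed_translation[OF compact_imp_closed[OF triangle_compact[OF mesh_simplex]]] by simp
  qed
  moreover have "m \<notin> U" unfolding U_def by auto
  ultimately obtain d where d: "d > 0" "ball m d \<subseteq> - U"
    using openE[of "- U" m] by (metis ComplI open_Compl)
  \<comment> \<open>Scaled so that \<open>y\<close> stays within distance \<open>1\<close> (used to bound \<open>l\<close>) and \<open>d\<close> (used to avoid \<open>U\<close>) of \<open>m\<close>.\<close>
  define e where "e = min 1 d / (2 * (norm (m - a) + 1))"
  have e: "e > 0" "norm (e *\<^sub>R (m - a)) < min 1 d"
  proof -
    show "e > 0" using d(1) norm_ge_zero[of "m - a"] by (simp add: e_def add_nonneg_pos)
    have *: "norm (e *\<^sub>R (m - a)) = min 1 d * (norm (m - a) / (2 * (norm (m - a) + 1)))"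
      using \<open>e > 0\<close> abs_of_pos[of "min 1 d"] d(1) by (simp add: e_def)
    have "N / (2 * (N + 1)) < 1" if "N \<ge> 0" for N :: real
      using that by (simp add: field_simps)
    from this[OF norm_ge_zero[of "m - a"]] have "min 1 d * (norm (m - a) / (2 * (norm (m - a) + 1))) < min 1 d * 1"
      using d(1) by (intro mult_strict_left_mono) auto
    then show "norm (e *\<^sub>R (m - a)) < min 1 d" unfolding * by simp
  qed
  define y where "y = m + e *\<^sub>R (m - a)"
  have "y \<notin> K"
  proof
    assume "y \<in> K"
    obtain n where n: "norm n = 1" "n \<bullet> (c - b) = 0" "n \<bullet> (a - b) \<le> 0" by (rule outward_normal_exists[OF K(3)])
    have "cross2 (b - a) (c - a) \<noteq> 0" using cross2_eq_0_imp_collinear K(3) by blast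
    then have "n \<bullet> (a - b) \<noteq> 0" using scaled_normal[OF n] by (auto simp: inner_diff_right)
    then have na: "n \<bullet> (a - b) < 0" using n(3) by simp
    have nm: "n \<bullet> m = n \<bullet> b" using n(2) by (simp add: m_def midpoint_def inner_add_right inner_diff_right)
    have "b \<in> closed_segment b c" by simp
    then have "n \<bullet> (y - b) \<le> 0" using outward_normal_iff[of b c a n] n \<open>y \<in> K\<close> K(2) by blast
    moreover have "n \<bullet> (y - b) = - e * (n \<bullet> (a - b))"
      using nm by (simp add: y_def inner_add_right inner_diff_right algebra_simps)
    moreover have "- e * (n \<bullet> (a - b)) > 0" using e(1) na by (simp add: mult_pos_neg)
    ultimately show False by linarith
  qed
  have dist_ym: "norm (y - m) < min 1 d" using e(2) by (simp add: y_def)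
  obtain K' l where K': "K' \<in> \<T>" "l \<in> lattice p q" "y \<in> (+) l ` K'" using mesh_cover by blast
  define X where "X = (+) l ` K'"
  have "l \<in> L"
  proof -
    obtain z where z: "z \<in> K'" "y = l + z" using K'(3) by blast
    have "norm l = norm ((y - m) + m - z)" using z(2) by simp
    also have "\<dots> \<le> norm (y - m) + norm m + norm z"
      by (meson add_right_mono norm_triangle_ineq norm_triangle_ineq4 order_trans)
    also have "\<dots> \<le> norm m + 1 + B" using dist_ym B[OF K'(1) z(1)] by simp
    finally show ?thesis using K'(2) by (simp add: L_def)
  qed
  have "m \<in> X"
  proof (rule ccontr)
    assume "m \<notin> X"
    then have "y \<in> U" unfolding U_def using K'(1,3) \<open>l \<in> L\<close> X_def by auto
    moreover have "y \<in> ball m d" using dist_ym by (simp add: dist_norm norm_minus_commute)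
    ultimately show False using d(2) by blast
  qed
  have ne: "(K, 0) \<noteq> (K', l)" using K'(3) \<open>y \<notin> K\<close> by auto
  note C = mesh_conforming[OF K(1) K'(1,2) ne, folded X_def]
  have bcK: "b \<in> K" "c \<in> K" using K(2) by (auto intro: hull_inc)
  have m_open: "m \<in> open_segment b c" using \<open>b \<noteq> c\<close> by (simp add: m_def)
  have "closed_segment b c \<subseteq> K"
    by (rule closed_segment_subset[OF bcK triangle_convex[OF mesh_simplex[OF K(1)]]])
  then have "m \<in> K" by (auto simp: m_def)
  then have "m \<in> K \<inter> X" using \<open>m \<in> X\<close> by (rule IntI)
  from face_ofD[OF C(2) m_open bcK this] have "b \<in> K \<inter> X" "c \<in> K \<inter> X" by (rule conjunct1, rule conjunct2)
  obtain D where D: "D \<subseteq> {a, b, c}" "K \<inter> X = convex hull D"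
    using C(2) face_of_convex_hull_affine_independent[OF na] unfolding K(2) by blast
  have "K \<inter> X \<noteq> K"
  proof
    assume "K \<inter> X = K"
    then have "interior K \<subseteq> interior X" by (intro interior_mono) auto
    then show False using C(1) triangle_interior[OF mesh_simplex[OF K(1)]] by blast
  qed
  \<comment> \<open>Vertices of \<open>K\<close> in the face are extreme points of it, hence among its generating vertices \<open>D\<close>.\<close>
  have in_D: "x \<in> D" if "x \<in> {a, b, c}" "x \<in> K \<inter> X" for x
  proof -
    have "{x} face_of K"
      unfolding K(2) face_of_convex_hull_affine_independent[OF na] using that(1) by (intro exI[of _ "{x}"]) auto
    then have "x extreme_point_of K" by (simp add: face_of_singleton)
    then have "x extreme_point_of (K \<inter> X)" using that(2) unfolding extreme_point_of_def by blast
    then show ?thesis unfolding D(2) by (rule extreme_point_of_convex_hull)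
  qed
  have "b \<in> D" "c \<in> D" using in_D \<open>b \<in> K \<inter> X\<close> \<open>c \<in> K \<inter> X\<close> by auto
  moreover have "a \<notin> D"
  proof
    assume "a \<in> D"
    then have "D = {a, b, c}" using D(1) \<open>b \<in> D\<close> \<open>c \<in> D\<close> by blast
    then show False using D(2) K(2) \<open>K \<inter> X \<noteq> K\<close> by simp
  qed
  ultimately have "D = {b, c}" using D(1) by blast
  then have seg: "K \<inter> X = closed_segment b c" using D(2) by (simp add: segment_convex_hull)
  have "aff_dim (closed_segment b c) = 1"
    using \<open>b \<noteq> c\<close> by (simp add: segment_convex_hull aff_dim_convex_hull aff_dim_2)
  then have "Edge K K' l \<in> \<O>"
    using K(1) K'(1,2) seg unfolding oriented_edges_def edge_set_def X_def by simp
  then show thesis using that[of "Edge K K' l"] seg by (simp add: edge_set_def X_def)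
qed

lemma edge_sum:
  fixes \<phi> :: "edge \<Rightarrow> 'a::ab_group_add"
  shows "(\<Sum>F\<in>\<E>. \<phi> F + \<phi> (flip F)) = (\<Sum>F\<in>\<O>. \<phi> F)"
proof -
  have E: "\<E> \<subseteq> \<O>" "\<And>F. F \<in> \<O> \<Longrightarrow> F \<in> \<E> \<longleftrightarrow> flip F \<notin> \<E>"
    using edges unfolding mesh_edges_def by auto
  have fin: "finite \<E>" using finite_subset[OF E(1) finite_oriented_edges] .
  have inj: "inj_on flip \<E>" by (rule inj_on_inverseI[of _ flip]) (rule flip_flip)
  have "flip ` \<E> = \<O> - \<E>"
  proof (intro set_eqI iffI)
    fix F assume "F \<in> flip ` \<E>"
    then obtain G where "G \<in> \<E>" "F = flip G" by blast
    then show "F \<in> \<O> - \<E>" using E flip_oriented by auto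
  next
    fix F assume F: "F \<in> \<O> - \<E>"
    then have "flip F \<in> \<E>" using E(2) by blast
    then show "F \<in> flip ` \<E>" using flip_flip[of F] by (metis image_eqI)
  qed
  then have "(\<Sum>F\<in>\<O> - \<E>. \<phi> F) = (\<Sum>F\<in>\<E>. \<phi> (flip F))"
    by (metis sum.reindex[OF inj] comp_apply sum.cong)
  then show ?thesis
    using sum.subset_diff[OF E(1) finite_oriented_edges, of \<phi>] by (simp add: sum.distrib add.commute)
qed

lemma triangle_edges:
  assumes K: "K \<in> \<T>" "K = convex hull {a, b, c}" "\<not> collinear {a, b, c}"
  obtains Fa Fb Fc where
    "{F \<in> \<O>. Kplus F = K} = {Fa, Fb, Fc}" "Fa \<noteq> Fb" "Fa \<noteq> Fc" "Fb \<noteq> Fc"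
    "edge_set Fa = closed_segment b c" "edge_set Fb = closed_segment a c" "edge_set Fc = closed_segment a b"
proof -
  have ne: "a \<noteq> b" "a \<noteq> c" "b \<noteq> c" using K(3) by (auto simp: insert_commute)
  have na: "\<not> affine_dependent {a, b, c}" using K(3) by (simp add: collinear_3_eq_affine_dependent)
  obtain Fa where Fa: "Fa \<in> \<O>" "Kplus Fa = K" "edge_set Fa = closed_segment b c"
    by (rule side_is_edge[OF K])
  obtain Fb where Fb: "Fb \<in> \<O>" "Kplus Fb = K" "edge_set Fb = closed_segment a c"
    by (rule side_is_edge[of K b a c]) (use K in \<open>auto simp: insert_commute\<close>)
  obtain Fc where Fc: "Fc \<in> \<O>" "Kplus Fc = K" "edge_set Fc = closed_segment a b"
    by (rule side_is_edge[of K c a b]) (use K in \<open>auto simp: insert_commute\<close>)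
  have "F \<in> {Fa, Fb, Fc}" if F: "F \<in> \<O>" "Kplus F = K" for F
  proof -
    note D = oriented_edgesD[OF F(1)]
    have "edge_set F face_of K"
      using mesh_conforming(2)[OF D(1-3,5)] F(2) by (simp add: edge_set_def)
    then obtain C where C: "C \<subseteq> {a, b, c}" "edge_set F = convex hull C"
      using face_of_convex_hull_affine_independent[OF na] unfolding K(2) by blast
    have "\<not> affine_dependent C" by (rule affine_independent_subset[OF na C(1)])
    then have "card C = 2"
      using D(4) C(2) aff_dim_affine_independent[of C] by (simp add: aff_dim_convex_hull)
    then obtain x y where xy: "C = {x, y}" "x \<noteq> y" unfolding card_2_iff by blast
    then have "C = {b, c} \<or> C = {a, c} \<or> C = {a, b}" using C(1) by auto
    then have "edge_set F = edge_set Fa \<or> edge_set F = edge_set Fb \<or> edge_set F = edge_set Fc"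
      unfolding C(2) Fa(3) Fb(3) Fc(3) segment_convex_hull by auto
    then show ?thesis using edge_unique[OF F(1)] Fa Fb Fc F(2) by auto
  qed
  then have eq: "{F \<in> \<O>. Kplus F = K} = {Fa, Fb, Fc}" using Fa(1,2) Fb(1,2) Fc(1,2) by auto
  have "edge_set Fa \<noteq> edge_set Fb" "edge_set Fa \<noteq> edge_set Fc" "edge_set Fb \<noteq> edge_set Fc"
    unfolding Fa(3) Fb(3) Fc(3) closed_segment_eq using ne by (auto simp: doubleton_eq_iff)
  then show thesis using that[OF eq _ _ _ Fa(3) Fb(3) Fc(3)] by blast
qed

end

text \<open>
  A segment determines its endpoints up to order, and the order does not matter.
\<close>

lemma segment_integral_eq:
  "segment_integral (closed_segment a b) f = dist a b *\<^sub>R integral {0..1} (\<lambda>s. f (linepath a b s))"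
proof -
  define P where "P = (\<lambda>(c, d). closed_segment a b = closed_segment c d)"
  obtain c d where cd: "(SOME x. P x) = (c, d)" by (metis surj_pair)
  have "P (SOME x. P x)" by (rule someI[of P "(a, b)"]) (simp add: P_def)
  then have "{a, b} = {c, d}" unfolding cd by (simp add: P_def)
  then have "a = c \<and> b = d \<or> a = d \<and> b = c" by (auto simp: doubleton_eq_iff)
  moreover have "segment_integral (closed_segment a b) f = dist c d *\<^sub>R integral {0..1} (\<lambda>s. f (linepath c d s))"
    unfolding segment_integral_def P_def[symmetric] cd by simp
  ultimately show ?thesis
    using integral_linepath_reverse[of f a b] by (auto simp: dist_commute)
qed

context mesh
begin

lemma divergence_theorem:
  assumes K: "K \<in> \<T>" and f: "C1 f"
  shows "integral K (\<lambda>x. grad f x \<bullet> w) = boundary_integral p q \<T> K (\<lambda>F x. f x * (normal F \<bullet> w))"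
proof -
  obtain a b c where abc: "K = convex hull {a, b, c}" "\<not> collinear {a, b, c}"
    by (rule simplex_2_obtain[OF mesh_simplex[OF K]])
  obtain Fa Fb Fc where F:
    "{F \<in> \<O>. Kplus F = K} = {Fa, Fb, Fc}" "Fa \<noteq> Fb" "Fa \<noteq> Fc" "Fb \<noteq> Fc"
    "edge_set Fa = closed_segment b c" "edge_set Fb = closed_segment a c" "edge_set Fc = closed_segment a b"
    by (rule triangle_edges[OF K abc])
  have KF: "Kplus Fa = convex hull {a, b, c}" "Kplus Fb = convex hull {b, a, c}" "Kplus Fc = convex hull {c, a, b}"
    using F(1) abc(1) by (auto simp: insert_commute)
  have nc: "\<not> collinear {b, a, c}" "\<not> collinear {c, a, b}" using abc(2) by (auto simp: insert_commute)
  note na = normal_facts[OF KF(1) F(5) abc(2)] and nb = normal_facts[OF KF(2) F(6) nc(1)]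
    and nc = normal_facts[OF KF(3) F(7) nc(2)]
  have nz: "cross2 (b - a) (c - a) \<noteq> 0" using cross2_eq_0_imp_collinear abc(2) by blast
  have "boundary_integral p q \<T> K (\<lambda>F x. f x * (normal F \<bullet> w))
      = edge_integral Fa (\<lambda>x. f x * (normal Fa \<bullet> w)) + edge_integral Fb (\<lambda>x. f x * (normal Fb \<bullet> w))
        + edge_integral Fc (\<lambda>x. f x * (normal Fc \<bullet> w))"
    unfolding boundary_integral_def F(1) using F(2-4) by (simp add: add.assoc)
  also have "\<dots> = integral K (\<lambda>x. grad f x \<bullet> w)"
    unfolding edge_integral_def F(5-7) segment_integral_eq abc(1)
    using divergence_theorem_triangle[OF nz C1_has_derivative[OF f] C1_continuous_grad[OF f]
        na(1,2) less_imp_le[OF na(3)] nb(1,2) less_imp_le[OF nb(3)] nc(1,2) less_imp_le[OF nc(3)], of w]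
    by (simp add: mult_ac)
  finally show ?thesis ..
qed

section \<open>Integrals over edges and traces\<close>

lemma edge_integral_add:
  fixes f g :: "point \<Rightarrow> 'a::euclidean_space"
  assumes F: "F \<in> \<O>" and "continuous_on UNIV f" "continuous_on UNIV g"
  shows "edge_integral F (\<lambda>x. f x + g x) = edge_integral F f + edge_integral F g"
proof -
  obtain a b where "edge_set F = closed_segment a b" by (rule edge_set_segment[OF F])
  then show ?thesis
    unfolding edge_integral_def segment_integral_eq
    by (simp add: integral_add integrable_on_linepath assms scaleR_add_right segment_integral_eq)
qed

lemma edge_integral_scaleR:
  fixes f :: "point \<Rightarrow> 'a::euclidean_space"
  assumes F: "F \<in> \<O>"
  shows "edge_integral F (\<lambda>x. r *\<^sub>R f x) = r *\<^sub>R edge_integral F f"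
proof -
  obtain a b where "edge_set F = closed_segment a b" by (rule edge_set_segment[OF F])
  then show ?thesis
    unfolding edge_integral_def by (simp add: segment_integral_eq)
qed

lemma edge_integral_cmult:
  fixes f :: "point \<Rightarrow> real"
  assumes F: "F \<in> \<O>"
  shows "edge_integral F (\<lambda>x. r * f x) = r * edge_integral F f"
  using edge_integral_scaleR[OF F, of r f] by simp

lemma edge_integral_minus:
  fixes f :: "point \<Rightarrow> 'a::euclidean_space"
  assumes F: "F \<in> \<O>"
  shows "edge_integral F (\<lambda>x. - f x) = - edge_integral F f"
  using edge_integral_scaleR[OF F, of "-1" f] by simp

lemma edge_integral_diff:
  fixes f g :: "point \<Rightarrow> 'a::euclidean_space"
  assumes F: "F \<in> \<O>" and "continuous_on UNIV f" "continuous_on UNIV g"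
  shows "edge_integral F (\<lambda>x. f x - g x) = edge_integral F f - edge_integral F g"
  using edge_integral_add[OF F assms(2), of "\<lambda>x. - g x"] edge_integral_minus[OF F, of g]
  by (simp add: continuous_on_minus assms(3))

lemma edge_integral_zero: "F \<in> \<O> \<Longrightarrow> edge_integral F (\<lambda>x. 0 :: real) = 0"
  using edge_integral_cmult[of F 0 "\<lambda>x. 0"] by simp

lemma edge_integral_component:
  fixes f :: "point \<Rightarrow> point"
  assumes F: "F \<in> \<O>" and f: "continuous_on UNIV f"
  shows "edge_integral F f $ i = edge_integral F (\<lambda>x. f x $ i)"
proof -
  obtain a b where "edge_set F = closed_segment a b" by (rule edge_set_segment[OF F])
  then show ?thesis
    unfolding edge_integral_def
    by (simp add: segment_integral_eq integral_component_eq_cart[OF integrable_on_linepath[OF f]])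
qed

lemma edge_integral_mono:
  fixes f g :: "point \<Rightarrow> real"
  assumes F: "F \<in> \<O>" and "continuous_on UNIV f" "continuous_on UNIV g"
    and le: "\<And>x. x \<in> edge_set F \<Longrightarrow> f x \<le> g x"
  shows "edge_integral F f \<le> edge_integral F g"
proof -
  obtain a b where E: "edge_set F = closed_segment a b" by (rule edge_set_segment[OF F])
  have "linepath a b s \<in> edge_set F" if "s \<in> {0..1}" for s
    unfolding E using that linepath_in_path by blast
  then have "integral {0..1} (\<lambda>s. f (linepath a b s)) \<le> integral {0..1} (\<lambda>s. g (linepath a b s))"
    by (intro integral_le integrable_on_linepath assms le)
  then show ?thesis
    unfolding edge_integral_def E segment_integral_eq by (simp add: mult_left_mono)
qed

lemma edge_integral_flip:
  fixes f :: "point \<Rightarrow> 'a::euclidean_space"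
  assumes F: "F \<in> \<O>"
  shows "edge_integral (flip F) f = edge_integral F (\<lambda>x. f (x - shift F))"
proof -
  obtain a b where E: "edge_set F = closed_segment a b" by (rule edge_set_segment[OF F])
  have E': "edge_set (flip F) = closed_segment (- shift F + a) (- shift F + b)"
    unfolding edge_set_flip E by (rule closed_segment_translation[symmetric])
  have "linepath (- shift F + a) (- shift F + b) s = linepath a b s - shift F" for s
    by (simp add: linepath_def algebra_simps)
  then show ?thesis
    unfolding edge_integral_def E E' segment_integral_eq by (simp add: dist_norm)
qed

text \<open>
  \<open>T\<close> is the contribution of a test function supported in \<open>K\<close>, seen from both sides of the edge; the
  contribution of the minus side is that of the reversed edge.
\<close>

lemma edge_sum_element:
  fixes P :: "edge \<Rightarrow> 'a::ab_group_add"
  assumes "\<And>F. F \<in> \<E> \<Longrightarrow> T F = (if Kplus F = K then P F else 0) + (if Kminus F = K then P (flip F) else 0)"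
  shows "(\<Sum>F\<in>\<E>. T F) = (\<Sum>F\<in>{F \<in> \<O>. Kplus F = K}. P F)"
proof -
  have "(\<Sum>F\<in>\<E>. T F) = (\<Sum>F\<in>\<E>. (if Kplus F = K then P F else 0) + (if Kplus (flip F) = K then P (flip F) else 0))"
    by (rule sum.cong) (auto simp: assms flip_def)
  also have "\<dots> = (\<Sum>F\<in>\<O>. if Kplus F = K then P F else 0)"
    by (rule edge_sum)
  also have "\<dots> = (\<Sum>F\<in>{F \<in> \<O>. Kplus F = K}. P F)"
    by (rule sum.inter_filter[symmetric]) (rule finite_oriented_edges)
  finally show ?thesis .
qed

lemma mesh_edge_oriented: "F \<in> \<E> \<Longrightarrow> F \<in> \<O>"
  using edges unfolding mesh_edges_def by auto

lemma boundary_integral_component: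
  fixes f :: "edge \<Rightarrow> point \<Rightarrow> point"
  assumes "\<And>F. F \<in> \<O> \<Longrightarrow> continuous_on UNIV (f F)"
  shows "boundary_integral p q \<T> K f $ i = boundary_integral p q \<T> K (\<lambda>F x. f F x $ i)"
  unfolding boundary_integral_def sum_component
  by (rule sum.cong[OF refl], rule edge_integral_component[OF _ assms]) auto

lemma trace_flip:
  "trace_plus (flip F) \<phi> (x - shift F) = trace_minus F \<phi> x"
  "trace_minus (flip F) \<phi> (x - shift F) = trace_plus F \<phi> x"
  by (simp_all add: trace_plus_def trace_minus_def flip_def)

lemma jump_flip: "jump (flip F) \<phi> (x - shift F) = - jump F \<phi> x"
  by (simp add: jump_def trace_flip)

lemma avg_flip: "avg (flip F) \<phi> (x - shift F) = avg F \<phi> x"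
  by (simp add: avg_def trace_flip add.commute)

lemma alpha_flip: "F \<in> \<O> \<Longrightarrow> alpha g h u (flip F) (x - shift F) = alpha g h u F x"
  by (simp add: alpha_def trace_flip normal_flip max.commute)

lemma mass_flux_flip: "F \<in> \<O> \<Longrightarrow> mass_flux g b h u (flip F) (x - shift F) = - mass_flux g b h u F x"
  by (simp add: mass_flux_def jump_flip avg_flip alpha_flip normal_flip)

lemma momentum_flux_flip:
  "F \<in> \<O> \<Longrightarrow> momentum_flux g b h u (flip F) (x - shift F) = - momentum_flux g b h u F x"
  by (simp add: momentum_flux_def jump_flip avg_flip alpha_flip normal_flip)

end

section \<open>Balances at a fixed time\<close>

definition broken_continuous :: "elem set \<Rightarrow> ('v::topological_space) broken \<Rightarrow> bool" where
  "broken_continuous \<T> \<phi> \<longleftrightarrow> (\<forall>K\<in>\<T>. continuous_on UNIV (\<phi> K))"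

context mesh
begin

lemma continuous_trace:
  assumes "broken_continuous \<T> \<phi>" "F \<in> \<O>"
  shows "continuous_on UNIV (trace_plus F \<phi>)" "continuous_on UNIV (trace_minus F \<phi>)"
proof -
  note D = oriented_edgesD[OF assms(2)]
  have "continuous_on UNIV (\<phi> (Kplus F))" "continuous_on UNIV (\<phi> (Kminus F))"
    using assms(1) D unfolding broken_continuous_def by auto
  then show "continuous_on UNIV (trace_plus F \<phi>)" "continuous_on UNIV (trace_minus F \<phi>)"
    unfolding trace_plus_def trace_minus_def
    by (auto intro!: continuous_on_compose2[of UNIV "\<phi> (Kminus F)"] continuous_intros)
qed

lemma continuous_jump:
  fixes \<phi> :: "'v::real_normed_vector broken"
  assumes "broken_continuous \<T> \<phi>" "F \<in> \<O>"
  shows "continuous_on UNIV (jump F \<phi>)"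
  unfolding jump_def by (intro continuous_on_diff continuous_trace assms)

lemma continuous_avg:
  fixes \<phi> :: "'v::real_normed_vector broken"
  assumes "broken_continuous \<T> \<phi>" "F \<in> \<O>"
  shows "continuous_on UNIV (avg F \<phi>)"
  unfolding avg_def by (intro continuous_on_scaleR continuous_on_const continuous_on_add continuous_trace assms)

end

definition element_indicator :: "elem \<Rightarrow> 'v \<Rightarrow> ('v::zero) broken" where
  "element_indicator K c = (\<lambda>K' x. if K' = K then c else 0)"

lemma jump_element_indicator:
  "jump F (element_indicator K c) x = (if Kplus F = K then c else 0) - (if Kminus F = K then c else 0)"
  by (simp add: jump_def trace_plus_def trace_minus_def element_indicator_def)

lemma jacobian_component:
  fixes v :: "point \<Rightarrow> point"
  assumes "\<And>i. C1 (\<lambda>x. v x $ i)"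
  shows "jacobian v (at x) $ i $ j = grad (\<lambda>x. v x $ i) x $ j"
proof -
  let ?D = "\<lambda>w. \<chi> i. grad (\<lambda>x. v x $ i) x \<bullet> w"
  have "(v has_derivative ?D) (at x)"
  proof (rule iffD2[OF has_derivative_componentwise_within], rule ballI)
    fix e :: point assume "e \<in> Basis"
    then obtain i where e: "e = axis i 1" by (auto simp: Basis_vec_def)
    show "((\<lambda>x. v x \<bullet> e) has_derivative (\<lambda>x. ?D x \<bullet> e)) (at x)"
      using C1_has_derivative[OF assms, of i x] by (simp add: e inner_axis)
  qed
  then have "jacobian v (at x) = matrix ?D"
    unfolding jacobian_def using frechet_derivative_at by metis
  then show ?thesis by (simp add: matrix_def inner_axis)
qed

text \<open>
  \<open>A\<close> is the normal component of the averaged discharge, \<open>s\<close> and \<open>r\<close> are the two surface levels and \<open>v\<close>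
  and \<open>w\<close> the two velocities. All terms with \<open>A\<close> cancel: the central parts of the fluxes conserve energy
  and only the penalty terms change it.
\<close>

lemma edge_energy_identity:
  fixes v w :: point
  shows "(A + 1 / 2 * a * (s - r)) * (1 / 2 * (v \<bullet> v) - 1 / 2 * (w \<bullet> w))
    - (A *\<^sub>R ((1 / 2) *\<^sub>R (v + w)) + (1 / 2 * a) *\<^sub>R (s *\<^sub>R v - r *\<^sub>R w)) \<bullet> (v - w)
    + g * (s - r) * A - (A + 1 / 2 * a * (s - r)) * (g * s - g * r)
    = - (1 / 2 * a * (g * (s - r)\<^sup>2 + (1 / 2) *\<^sub>R (s + r) * ((v - w) \<bullet> (v - w))))"
  by (simp add: inner_add_left inner_diff_left inner_diff_right inner_commute[of w v] power2_eq_square field_simps)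

text \<open>
  The state at one instant. The identities for the operators hold for arbitrary continuously
  differentiable elementwise functions.
\<close>

locale broken_state = mesh p q \<T> \<E> for p q \<T> \<E> +
  fixes g :: real and b h :: "real broken" and u :: "point broken"
  assumes b_C1: "\<And>K. K \<in> \<T> \<Longrightarrow> C1 (b K)" and h_C1: "\<And>K. K \<in> \<T> \<Longrightarrow> C1 (h K)"
    and u_C1: "\<And>K i. K \<in> \<T> \<Longrightarrow> C1 (\<lambda>x. u K x $ i)"
begin

lemma cont_h: "broken_continuous \<T> h" and cont_b: "broken_continuous \<T> b"
  using C1_continuous b_C1 h_C1 unfolding broken_continuous_def by auto

lemma cont_u: "broken_continuous \<T> u"
  unfolding broken_continuous_def
proof (intro ballI)
  fix K assume "K \<in> \<T>"
  then have "continuous_on UNIV (\<lambda>x. \<chi> i. u K x $ i)"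
    by (intro continuous_on_vec_lambda C1_continuous u_C1)
  then show "continuous_on UNIV (u K)" by simp
qed

lemma cont_surface: "broken_continuous \<T> (\<lambda>K x. h K x + b K x)"
  using cont_h cont_b unfolding broken_continuous_def by (auto intro: continuous_on_add)

lemma cont_hu: "broken_continuous \<T> (\<lambda>K x. h K x *\<^sub>R u K x)"
  using cont_h cont_u unfolding broken_continuous_def by (auto intro: continuous_on_scaleR)

lemma cont_surface_u: "broken_continuous \<T> (\<lambda>K x. (h K x + b K x) *\<^sub>R u K x)"
  using cont_surface cont_u unfolding broken_continuous_def by (auto intro: continuous_on_scaleR)

lemma continuous_alpha: "F \<in> \<O> \<Longrightarrow> continuous_on UNIV (alpha g h u F)"
  unfolding alpha_def
  by (intro continuous_on_max continuous_on_add continuous_on_real_sqrt continuous_on_mult continuous_on_const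
      continuous_on_rabs continuous_on_inner continuous_trace cont_h cont_u)

lemma continuous_mass_flux: "F \<in> \<O> \<Longrightarrow> continuous_on UNIV (mass_flux g b h u F)"
  unfolding mass_flux_def
  by (intro continuous_on_add continuous_on_mult continuous_on_const continuous_on_inner
      continuous_alpha continuous_avg continuous_jump cont_hu cont_surface)

lemma continuous_momentum_flux: "F \<in> \<O> \<Longrightarrow> continuous_on UNIV (momentum_flux g b h u F)"
  unfolding momentum_flux_def
  by (intro continuous_on_add continuous_on_scaleR continuous_on_mult continuous_on_const continuous_on_inner
      continuous_alpha continuous_avg continuous_jump cont_hu cont_u cont_surface_u)

lemma Ah_element_indicator:
  assumes K: "K \<in> \<T>"
  shows "Ah \<T> \<E> g b h u (element_indicator K 1) = boundary_integral p q \<T> K (mass_flux g b h u)"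
proof -
  have "grad (element_indicator K 1 K') x = 0" for K' x
    by (simp add: element_indicator_def grad_const)
  then have "Ah \<T> \<E> g b h u (element_indicator K 1)
      = (\<Sum>F\<in>\<E>. edge_integral F (\<lambda>x. mass_flux g b h u F x * jump F (element_indicator K 1) x))"
    by (simp add: Ah_def)
  also have "\<dots> = boundary_integral p q \<T> K (mass_flux g b h u)"
    unfolding boundary_integral_def
  proof (rule edge_sum_element)
    fix F assume "F \<in> \<E>"
    then have F: "F \<in> \<O>" by (rule mesh_edge_oriented)
    have "edge_integral (flip F) (mass_flux g b h u (flip F)) = - edge_integral F (mass_flux g b h u F)"
      by (simp add: edge_integral_flip[OF F] mass_flux_flip[OF F] edge_integral_minus[OF F])
    then show "edge_integral F (\<lambda>x. mass_flux g b h u F x * jump F (element_indicator K 1) x)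
        = (if Kplus F = K then edge_integral F (mass_flux g b h u F) else 0)
        + (if Kminus F = K then edge_integral (flip F) (mass_flux g b h u (flip F)) else 0)"
      using edge_integral_zero[OF F] edge_integral_minus[OF F, of "mass_flux g b h u F"]
      by (simp add: jump_element_indicator)
  qed
  finally show ?thesis .
qed

lemma Bh_element_indicator:
  assumes K: "K \<in> \<T>"
  shows "Bh \<T> \<E> g b h u (element_indicator K (axis i 1)) = boundary_integral p q \<T> K (momentum_flux g b h u) $ i"
proof -
  let ?v = "element_indicator K (axis i 1) :: point broken"
  have "jacobian (?v K') (at x) = 0" for K' x
    by (simp add: vec_eq_iff jacobian_component C1_const element_indicator_def grad_const)
  then have "Bh \<T> \<E> g b h u ?v = (\<Sum>F\<in>\<E>. edge_integral F (\<lambda>x. momentum_flux g b h u F x \<bullet> jump F ?v x))"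
    by (simp add: Bh_def)
  also have "\<dots> = (\<Sum>F\<in>{F \<in> \<O>. Kplus F = K}. edge_integral F (momentum_flux g b h u F) $ i)"
  proof (rule edge_sum_element)
    fix F assume "F \<in> \<E>"
    then have F: "F \<in> \<O>" by (rule mesh_edge_oriented)
    have "edge_integral (flip F) (momentum_flux g b h u (flip F)) = - edge_integral F (momentum_flux g b h u F)"
      by (simp add: edge_integral_flip[OF F] momentum_flux_flip[OF F] edge_integral_minus[OF F])
    then show "edge_integral F (\<lambda>x. momentum_flux g b h u F x \<bullet> jump F ?v x)
        = (if Kplus F = K then edge_integral F (momentum_flux g b h u F) $ i else 0)
        + (if Kminus F = K then edge_integral (flip F) (momentum_flux g b h u (flip F)) $ i else 0)"
      using edge_integral_zero[OF F] edge_integral_minus[OF F, of "\<lambda>x. momentum_flux g b h u F x $ i"]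
        edge_integral_component[OF F continuous_momentum_flux[OF F], of i]
      by (simp add: jump_element_indicator inner_axis)
  qed
  finally show ?thesis by (simp add: boundary_integral_def)
qed

lemma Ch_element_indicator:
  assumes K: "K \<in> \<T>"
  shows "Ch \<T> \<E> g b h (element_indicator K (axis i 1))
    = integral K (\<lambda>x. g * h K x * grad (\<lambda>y. h K y + b K y) x $ i)
      - boundary_integral p q \<T> K (\<lambda>F x. g * jump F (\<lambda>K y. h K y + b K y) x * (1 / 2 * h K x * normal F $ i))"
proof -
  let ?v = "element_indicator K (axis i 1) :: point broken"
  let ?j = "\<lambda>F. jump F (\<lambda>K y. h K y + b K y)"
  have "(\<Sum>K'\<in>\<T>. integral K' (\<lambda>x. g * h K' x * (grad (\<lambda>y. h K' y + b K' y) x \<bullet> ?v K' x)))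
      = (\<Sum>K'\<in>\<T>. if K' = K then integral K (\<lambda>x. g * h K x * grad (\<lambda>y. h K y + b K y) x $ i) else 0)"
    by (rule sum.cong) (auto simp: element_indicator_def inner_axis)
  also have "\<dots> = integral K (\<lambda>x. g * h K x * grad (\<lambda>y. h K y + b K y) x $ i)"
    using K finite_mesh by simp
  finally have vol: "(\<Sum>K'\<in>\<T>. integral K' (\<lambda>x. g * h K' x * (grad (\<lambda>y. h K' y + b K' y) x \<bullet> ?v K' x)))
      = integral K (\<lambda>x. g * h K x * grad (\<lambda>y. h K y + b K y) x $ i)" .
  have "(\<Sum>F\<in>\<E>. edge_integral F (\<lambda>x. g * ?j F x * (avg F (\<lambda>K y. h K y *\<^sub>R ?v K y) x \<bullet> normal F)))
     = boundary_integral p q \<T> K (\<lambda>F x. g * ?j F x * (1 / 2 * h K x * normal F $ i))"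
    unfolding boundary_integral_def
  proof (rule edge_sum_element)
    fix F assume "F \<in> \<E>"
    then have F: "F \<in> \<O>" by (rule mesh_edge_oriented)
    let ?P = "\<lambda>x. if Kplus F = K then g * ?j F x * (1 / 2 * trace_plus F h x * normal F $ i) else 0"
    let ?M = "\<lambda>x. if Kminus F = K then g * ?j F x * (1 / 2 * trace_minus F h x * normal F $ i) else 0"
    have "g * ?j F x * (avg F (\<lambda>K y. h K y *\<^sub>R ?v K y) x \<bullet> normal F) = ?P x + ?M x" for x
      by (simp add: avg_def trace_plus_def trace_minus_def element_indicator_def inner_add_left inner_axis'
          algebra_simps)
    moreover have "continuous_on UNIV ?P" "continuous_on UNIV ?M"
    proof -
      have "continuous_on UNIV (\<lambda>x. g * ?j F x * (1 / 2 * trace_plus F h x * normal F $ i))"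
        "continuous_on UNIV (\<lambda>x. g * ?j F x * (1 / 2 * trace_minus F h x * normal F $ i))"
        by (intro continuous_on_mult continuous_on_const continuous_jump[OF cont_surface F] continuous_trace[OF cont_h F])+
      then show "continuous_on UNIV ?P" "continuous_on UNIV ?M"
        by (cases "Kplus F = K"; cases "Kminus F = K"; simp only: if_True if_False continuous_on_const)+
    qed
    ultimately have "edge_integral F (\<lambda>x. g * ?j F x * (avg F (\<lambda>K y. h K y *\<^sub>R ?v K y) x \<bullet> normal F))
      = edge_integral F ?P + edge_integral F ?M"
      using edge_integral_add[OF F, of ?P ?M] by simp
    also have "edge_integral F ?P
      = (if Kplus F = K then edge_integral F (\<lambda>x. g * ?j F x * (1 / 2 * h K x * normal F $ i)) else 0)"
      by (auto simp: trace_plus_def edge_integral_zero[OF F])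
    also have "edge_integral F ?M
      = (if Kminus F = K then edge_integral (flip F) (\<lambda>x. g * ?j (flip F) x * (1 / 2 * h K x * normal (flip F) $ i)) else 0)"
      by (auto simp: edge_integral_flip[OF F] jump_flip normal_flip[OF F] trace_minus_def edge_integral_zero[OF F])
    finally show "edge_integral F (\<lambda>x. g * ?j F x * (avg F (\<lambda>K y. h K y *\<^sub>R ?v K y) x \<bullet> normal F)) =
        (if Kplus F = K then edge_integral F (\<lambda>x. g * ?j F x * (1 / 2 * h K x * normal F $ i)) else 0)
        + (if Kminus F = K then edge_integral (flip F) (\<lambda>x. g * ?j (flip F) x * (1 / 2 * h K x * normal (flip F) $ i)) else 0)" .
  qed
  then show ?thesis unfolding Ch_def vol by simp
qed

lemma kinetic_C1:
  assumes K: "K \<in> \<T>"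
  shows "C1 (\<lambda>x. 1 / 2 * (u K x \<bullet> u K x))"
    "grad (\<lambda>x. 1 / 2 * (u K x \<bullet> u K x)) = (\<lambda>x. u K x $ 1 *\<^sub>R grad (\<lambda>x. u K x $ 1) x + u K x $ 2 *\<^sub>R grad (\<lambda>x. u K x $ 2) x)"
proof -
  have sq: "C1 (\<lambda>x. u K x $ i * u K x $ i)" for i by (intro C1_mult u_C1 K)
  have sum: "C1 (\<lambda>x. u K x $ 1 * u K x $ 1 + u K x $ 2 * u K x $ 2)" by (rule C1_add(1)[OF sq sq])
  have eq: "u K x \<bullet> u K x = u K x $ 1 * u K x $ 1 + u K x $ 2 * u K x $ 2" for x
    by (simp add: inner_vec_def sum_2)
  show "C1 (\<lambda>x. 1 / 2 * (u K x \<bullet> u K x))" unfolding eq by (rule C1_mult(1)[OF C1_const sum])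
  show "grad (\<lambda>x. 1 / 2 * (u K x \<bullet> u K x)) = (\<lambda>x. u K x $ 1 *\<^sub>R grad (\<lambda>x. u K x $ 1) x + u K x $ 2 *\<^sub>R grad (\<lambda>x. u K x $ 2) x)"
    unfolding eq C1_mult(2)[OF C1_const sum] C1_add(2)[OF sq sq] C1_mult(2)[OF u_C1[OF K] u_C1[OF K]] grad_const
    by (rule ext) (simp add: scaleR_add_right flip: scaleR_2)
qed

lemma surface_C1:
  assumes K: "K \<in> \<T>"
  shows "C1 (\<lambda>x. h K x + b K x)" "C1 (\<lambda>x. g * (h K x + b K x))"
    "grad (\<lambda>x. g * (h K x + b K x)) = (\<lambda>x. g *\<^sub>R grad (\<lambda>y. h K y + b K y) x)"
proof -
  show H: "C1 (\<lambda>x. h K x + b K x)" by (rule C1_add(1)[OF h_C1[OF K] b_C1[OF K]])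
  show "C1 (\<lambda>x. g * (h K x + b K x))" by (rule C1_mult(1)[OF C1_const H])
  show "grad (\<lambda>x. g * (h K x + b K x)) = (\<lambda>x. g *\<^sub>R grad (\<lambda>y. h K y + b K y) x)"
    unfolding C1_mult(2)[OF C1_const H] grad_const by simp
qed

lemma entropy_identity:
  "Ah \<T> \<E> g b h u (\<lambda>K x. 1 / 2 * (u K x \<bullet> u K x)) - Bh \<T> \<E> g b h u u - Ch \<T> \<E> g b h u
    - Ah \<T> \<E> g b h u (\<lambda>K x. g * (h K x + b K x)) = entropy_production \<E> g b h u"
proof -
  let ?k = "\<lambda>K x. 1 / 2 * (u K x \<bullet> u K x)"
  let ?s = "\<lambda>K x. h K x + b K x"
  let ?gs = "\<lambda>K x. g * (h K x + b K x)"
  let ?mf = "mass_flux g b h u" and ?mm = "momentum_flux g b h u"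
  let ?hu = "\<lambda>K x. h K x *\<^sub>R u K x"
  have convection: "integral K (\<lambda>x. (h K x *\<^sub>R u K x) \<bullet> grad (?k K) x)
      = integral K (\<lambda>x. h K x * (outer (u K x) (u K x) \<bullet> jacobian (u K) (at x)))" if K: "K \<in> \<T>" for K
    unfolding kinetic_C1(2)[OF K]
    by (intro integral_cong)
      (simp add: inner_vec_def sum_2 outer_def jacobian_component[OF u_C1[OF K]] algebra_simps)
  have pressure: "integral K (\<lambda>x. g * h K x * (grad (?s K) x \<bullet> u K x))
      = integral K (\<lambda>x. (h K x *\<^sub>R u K x) \<bullet> grad (?gs K) x)" if K: "K \<in> \<T>" for K
    by (intro integral_cong) (simp add: surface_C1(3)[OF K] inner_commute mult_ac)
  have "broken_continuous \<T> ?k"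
    unfolding broken_continuous_def using C1_continuous[OF kinetic_C1(1)] by blast
  note cont_k = continuous_jump[OF this]
  have "broken_continuous \<T> ?gs"
    unfolding broken_continuous_def using C1_continuous[OF surface_C1(2)] by blast
  note cont_gs = continuous_jump[OF this]
  have edge: "edge_integral F (\<lambda>x. ?mf F x * jump F ?k x) - edge_integral F (\<lambda>x. ?mm F x \<bullet> jump F u x)
      + edge_integral F (\<lambda>x. g * jump F ?s x * (avg F ?hu x \<bullet> normal F)) - edge_integral F (\<lambda>x. ?mf F x * jump F ?gs x)
      = - edge_integral F (\<lambda>x. 1 / 2 * alpha g h u F x * (g * (jump F ?s x)\<^sup>2 + avg F ?s x * (jump F u x \<bullet> jump F u x)))"
    (is "edge_integral F ?P1 - edge_integral F ?P2 + edge_integral F ?P3 - edge_integral F ?P4 = - edge_integral F ?Q")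
    if "F \<in> \<E>" for F
  proof -
    have F: "F \<in> \<O>" using that by (rule mesh_edge_oriented)
    have c1: "continuous_on UNIV ?P1" by (intro continuous_on_mult continuous_mass_flux cont_k F)
    have c2: "continuous_on UNIV ?P2" by (intro continuous_on_inner continuous_momentum_flux continuous_jump cont_u F)
    have c3: "continuous_on UNIV ?P3"
      by (intro continuous_on_mult continuous_on_const continuous_on_inner continuous_jump continuous_avg
          cont_surface cont_hu F)
    have c4: "continuous_on UNIV ?P4" by (intro continuous_on_mult continuous_mass_flux cont_gs F)
    have "edge_integral F ?P1 - edge_integral F ?P2 + edge_integral F ?P3 - edge_integral F ?P4
        = edge_integral F (\<lambda>x. ?P1 x - ?P2 x + ?P3 x - ?P4 x)"
      using edge_integral_diff[OF F c1 c2] edge_integral_add[OF F continuous_on_diff[OF c1 c2] c3]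
        edge_integral_diff[OF F continuous_on_add[OF continuous_on_diff[OF c1 c2] c3] c4] by simp
    also have "(\<lambda>x. ?P1 x - ?P2 x + ?P3 x - ?P4 x) = (\<lambda>x. - ?Q x)"
    proof
      fix x
      show "?P1 x - ?P2 x + ?P3 x - ?P4 x = - ?Q x"
        using edge_energy_identity[of "avg F ?hu x \<bullet> normal F" "alpha g h u F x" "trace_plus F ?s x" "trace_minus F ?s x"
            "trace_plus F u x" "trace_minus F u x"]
        unfolding mass_flux_def momentum_flux_def jump_def avg_def[of F u] avg_def[of F ?s]
        by (simp only: trace_plus_def[of F] trace_minus_def[of F])
    qed
    finally show ?thesis by (simp only: edge_integral_minus[OF F])
  qed
  have conv: "(\<Sum>K\<in>\<T>. integral K (\<lambda>x. (h K x *\<^sub>R u K x) \<bullet> grad (?k K) x))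
      = (\<Sum>K\<in>\<T>. integral K (\<lambda>x. h K x * (outer (u K x) (u K x) \<bullet> jacobian (u K) (at x))))"
    by (rule sum.cong[OF refl convection])
  have pres: "(\<Sum>K\<in>\<T>. integral K (\<lambda>x. g * h K x * (grad (?s K) x \<bullet> u K x)))
      = (\<Sum>K\<in>\<T>. integral K (\<lambda>x. (h K x *\<^sub>R u K x) \<bullet> grad (?gs K) x))"
    by (rule sum.cong[OF refl pressure])
  have "Ah \<T> \<E> g b h u ?k - Bh \<T> \<E> g b h u u - Ch \<T> \<E> g b h u - Ah \<T> \<E> g b h u ?gs
     = (\<Sum>F\<in>\<E>. edge_integral F (\<lambda>x. ?mf F x * jump F ?k x) - edge_integral F (\<lambda>x. ?mm F x \<bullet> jump F u x)
      + edge_integral F (\<lambda>x. g * jump F ?s x * (avg F ?hu x \<bullet> normal F)) - edge_integral F (\<lambda>x. ?mf F x * jump F ?gs x))"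
    unfolding Ah_def Bh_def Ch_def sum_subtractf sum.distrib conv pres by linarith
  also have "\<dots> = entropy_production \<E> g b h u"
    unfolding entropy_production_def sum_negf[symmetric] by (rule sum.cong[OF refl edge])
  finally show ?thesis .
qed

lemma alpha_nonneg:
  assumes "g > 0" "\<And>K x. K \<in> \<T> \<Longrightarrow> x \<in> K \<Longrightarrow> h K x > 0" and F: "F \<in> \<O>" "x \<in> edge_set F"
  shows "alpha g h u F x \<ge> 0"
proof -
  have "h (Kplus F) x > 0"
    using assms oriented_edgesD[OF F(1)] unfolding edge_set_def by blast
  then have "0 \<le> sqrt (g * trace_plus F h x) + \<bar>trace_plus F u x \<bullet> normal F\<bar>"
    using assms(1) by (simp add: trace_plus_def)
  then show ?thesis unfolding alpha_def by simp
qed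

text \<open>
  The part with the jump of the surface level is nonpositive in any case, so only the velocity jumps
  need a bound. With \<open>M = 0\<close> this is the entropy inequality; a multiple of the relative energy as \<open>M\<close>
  gives the estimate for Gronwall's inequality.
\<close>

lemma entropy_production_le:
  assumes g: "g > 0" and h: "\<And>K x. K \<in> \<T> \<Longrightarrow> x \<in> K \<Longrightarrow> h K x > 0"
    and M: "\<And>F x. F \<in> \<E> \<Longrightarrow> x \<in> edge_set F \<Longrightarrow>
      - (1 / 2 * alpha g h u F x * (avg F (\<lambda>K y. h K y + b K y) x * (jump F u x \<bullet> jump F u x))) \<le> M"
  shows "entropy_production \<E> g b h u \<le> M * (\<Sum>F\<in>\<E>. edge_integral F (\<lambda>x. 1))"
proof -
  let ?s = "\<lambda>K x. h K x + b K x"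
  let ?Q = "\<lambda>F x. 1 / 2 * alpha g h u F x * (g * (jump F ?s x)\<^sup>2 + avg F ?s x * (jump F u x \<bullet> jump F u x))"
  have "- edge_integral F (?Q F) \<le> M * edge_integral F (\<lambda>x. 1)" if "F \<in> \<E>" for F
  proof -
    have F: "F \<in> \<O>" using that by (rule mesh_edge_oriented)
    have cont: "continuous_on UNIV (\<lambda>x. - ?Q F x)"
      by (intro continuous_on_minus continuous_on_mult continuous_on_const continuous_alpha continuous_on_add
          continuous_on_power continuous_on_inner continuous_jump continuous_avg cont_surface cont_u F)
    have "- edge_integral F (?Q F) = edge_integral F (\<lambda>x. - ?Q F x)" by (simp only: edge_integral_minus[OF F])
    also have "\<dots> \<le> edge_integral F (\<lambda>x. M * 1)"
    proof (rule edge_integral_mono[OF F cont continuous_on_const])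
      fix x assume x: "x \<in> edge_set F"
      have "0 \<le> 1 / 2 * alpha g h u F x * (g * (jump F ?s x)\<^sup>2)"
        using alpha_nonneg[OF g h F x] g by simp
      then show "- ?Q F x \<le> M * 1" using M[OF that x] by (simp add: distrib_left)
    qed
    also have "\<dots> = M * edge_integral F (\<lambda>x. 1)" by (rule edge_integral_cmult[OF F])
    finally show ?thesis .
  qed
  then have "(\<Sum>F\<in>\<E>. - edge_integral F (?Q F)) \<le> (\<Sum>F\<in>\<E>. M * edge_integral F (\<lambda>x. 1))"
    by (rule sum_mono)
  then show ?thesis unfolding entropy_production_def sum_negf sum_distrib_left .
qed

lemma entropy_production_nonpos:
  assumes g: "g > 0" and h: "\<And>K x. K \<in> \<T> \<Longrightarrow> x \<in> K \<Longrightarrow> h K x > 0"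
    and avg: "\<And>F x. F \<in> \<E> \<Longrightarrow> x \<in> edge_set F \<Longrightarrow> avg F (\<lambda>K y. h K y + b K y) x \<ge> 0"
  shows "entropy_production \<E> g b h u \<le> 0"
proof -
  have "- (1 / 2 * alpha g h u F x * (avg F (\<lambda>K y. h K y + b K y) x * (jump F u x \<bullet> jump F u x))) \<le> 0"
    if "F \<in> \<E>" "x \<in> edge_set F" for F x
    using alpha_nonneg[OF g h mesh_edge_oriented that(2)] avg that by simp
  from entropy_production_le[OF g h this] show ?thesis by simp
qed

text \<open>
  The boundary term \<open>1/2 g h^2 n\<close> that the divergence theorem extracts from \<open>g h \<nabla>h\<close> cancels against
  the part of the jump term that contains the inner trace of \<open>h\<close> twice.
\<close>

lemma pressure_balance:
  assumes K: "K \<in> \<T>"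
  shows "boundary_integral p q \<T> K (\<lambda>F x. g * jump F (\<lambda>K y. h K y + b K y) x * (1 / 2 * h K x * normal F $ i))
      - integral K (\<lambda>x. g * h K x * grad (\<lambda>y. h K y + b K y) x $ i)
    = (boundary_integral p q \<T> K (\<lambda>F x. (1 / 2 * g * h K x * b K x) *\<^sub>R normal F)
      - boundary_integral p q \<T> K (\<lambda>F x. (1 / 2 * g * h K x * (trace_minus F h x + trace_minus F b x)) *\<^sub>R normal F)
      - integral K (\<lambda>x. (g * h K x) *\<^sub>R grad (b K) x)) $ i"
proof -
  let ?S = "{F \<in> \<O>. Kplus F = K}"
  let ?J = "\<lambda>F x. g * jump F (\<lambda>K y. h K y + b K y) x * (1 / 2 * h K x * normal F $ i)"
  let ?P = "\<lambda>F x. 1 / 2 * g * (h K x * h K x) * (normal F \<bullet> axis i 1)"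
  let ?Q = "\<lambda>F x. (1 / 2 * g * h K x * b K x) *\<^sub>R normal F"
  let ?R = "\<lambda>F x. (1 / 2 * g * h K x * (trace_minus F h x + trace_minus F b x)) *\<^sub>R normal F"
  have ch: "continuous_on UNIV (h K)" and cb: "continuous_on UNIV (b K)"
    using C1_continuous h_C1 b_C1 K by auto
  have cQ: "continuous_on UNIV (?Q F)" for F
    by (intro continuous_on_scaleR continuous_on_mult continuous_on_const ch cb)
  have cR: "continuous_on UNIV (?R F)" if "F \<in> \<O>" for F
    by (intro continuous_on_scaleR continuous_on_mult continuous_on_const continuous_on_add
        continuous_trace cont_h cont_b ch that)
  have cP: "continuous_on UNIV (?P F)" for F
    by (intro continuous_on_mult continuous_on_const ch)
  have "boundary_integral p q \<T> K ?J = boundary_integral p q \<T> K ?P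
      + boundary_integral p q \<T> K (\<lambda>F x. ?Q F x $ i) - boundary_integral p q \<T> K (\<lambda>F x. ?R F x $ i)"
    unfolding boundary_integral_def sum.distrib[symmetric] sum_subtractf[symmetric]
  proof (rule sum.cong[OF refl])
    fix F assume "F \<in> ?S"
    then have F: "F \<in> \<O>" "Kplus F = K" by auto
    have cQi: "continuous_on UNIV (\<lambda>x. ?Q F x $ i)" by (rule continuous_on_component[OF cQ])
    have cRi: "continuous_on UNIV (\<lambda>x. ?R F x $ i)" by (rule continuous_on_component[OF cR[OF F(1)]])
    have "?J F = (\<lambda>x. ?P F x + ?Q F x $ i - ?R F x $ i)"
      by (rule ext) (simp add: jump_def trace_plus_def trace_minus_def F(2) inner_axis algebra_simps)
    then show "edge_integral F (?J F)
        = edge_integral F (?P F) + edge_integral F (\<lambda>x. ?Q F x $ i) - edge_integral F (\<lambda>x. ?R F x $ i)"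
      using edge_integral_add[OF F(1) cP cQi] edge_integral_diff[OF F(1) continuous_on_add[OF cP cQi] cRi] by simp
  qed
  moreover have "integral K (\<lambda>x. g * h K x * grad (\<lambda>y. h K y + b K y) x $ i)
      = boundary_integral p q \<T> K ?P + integral K (\<lambda>x. (g * h K x) *\<^sub>R grad (b K) x) $ i"
  proof -
    have hh: "C1 (\<lambda>x. h K x * h K x)" by (rule C1_mult(1)[OF h_C1[OF K] h_C1[OF K]])
    have P: "C1 (\<lambda>x. 1 / 2 * g * (h K x * h K x))" by (rule C1_mult(1)[OF C1_const hh])
    have gP: "grad (\<lambda>x. 1 / 2 * g * (h K x * h K x)) = (\<lambda>x. (g * h K x) *\<^sub>R grad (h K) x)"
      unfolding C1_mult(2)[OF C1_const hh] grad_const C1_mult(2)[OF h_C1[OF K] h_C1[OF K]]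
      by (rule ext) (simp add: scaleR_add_right[symmetric] scaleR_2[symmetric])
    have int: "f integrable_on K" if "continuous_on UNIV f" for f :: "point \<Rightarrow> 'a::euclidean_space"
      by (rule integrable_on_compact[OF triangle_compact[OF mesh_simplex[OF K]] continuous_on_subset[OF that]]) simp
    have cgh: "continuous_on UNIV (\<lambda>x. (g * h K x) *\<^sub>R grad (h K) x)" and cgb: "continuous_on UNIV (\<lambda>x. (g * h K x) *\<^sub>R grad (b K) x)"
      by (intro continuous_on_scaleR continuous_on_mult continuous_on_const ch C1_continuous_grad h_C1 b_C1 K)+
    have "integral K (\<lambda>x. g * h K x * grad (\<lambda>y. h K y + b K y) x $ i)
        = integral K (\<lambda>x. ((g * h K x) *\<^sub>R grad (h K) x) $ i + ((g * h K x) *\<^sub>R grad (b K) x) $ i)"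
      unfolding C1_add(2)[OF h_C1[OF K] b_C1[OF K]] by (intro integral_cong) (simp add: algebra_simps)
    also have "\<dots> = integral K (\<lambda>x. ((g * h K x) *\<^sub>R grad (h K) x) $ i) + integral K (\<lambda>x. ((g * h K x) *\<^sub>R grad (b K) x) $ i)"
      by (intro integral_add int continuous_on_component cgh cgb)
    also have "integral K (\<lambda>x. ((g * h K x) *\<^sub>R grad (h K) x) $ i) = boundary_integral p q \<T> K ?P"
      using divergence_theorem[OF K P, of "axis i 1"] unfolding gP by (simp only: inner_axis inner_real_def mult_1_right)
    also have "integral K (\<lambda>x. ((g * h K x) *\<^sub>R grad (b K) x) $ i) = integral K (\<lambda>x. (g * h K x) *\<^sub>R grad (b K) x) $ i"
      by (rule integral_component_eq_cart[OF int[OF cgb]])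
    finally show ?thesis .
  qed
  ultimately show ?thesis
    by (simp only: vector_minus_component boundary_integral_component[OF cQ] boundary_integral_component[OF cR])
qed

end

section \<open>Conservation and energy balance along solutions\<close>

lemma has_real_derivative_component:
  "(f has_vector_derivative D) F \<Longrightarrow> ((\<lambda>s. f s $ i) has_real_derivative (D :: point) $ i) F"
  unfolding has_real_derivative_iff_has_vector_derivative
  by (rule bounded_linear.has_vector_derivative[OF bounded_linear_vec_nth])

lemma has_vector_derivative_componentwise:
  fixes f :: "real \<Rightarrow> point"
  assumes "\<And>i. ((\<lambda>s. f s $ i) has_real_derivative D $ i) (at t within J)"
  shows "(f has_vector_derivative D) (at t within J)"
  unfolding has_vector_derivative_def
proof (rule iffD2[OF has_derivative_componentwise_within], rule ballI)
  fix e :: point assume "e \<in> Basis"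
  then obtain i where e: "e = axis i 1" by (auto simp: Basis_vec_def)
  show "((\<lambda>s. f s \<bullet> e) has_derivative (\<lambda>r. (r *\<^sub>R D) \<bullet> e)) (at t within J)"
    using assms[of i] unfolding has_field_derivative_def by (simp add: e inner_axis mult_commute_abs)
qed

locale dg_scheme = mesh p q \<T> \<E> for p q \<T> \<E> +
  fixes k :: nat and g :: real and b :: "real broken"
    and I :: "real set" and h :: "real \<Rightarrow> real broken" and u :: "real \<Rightarrow> point broken"
  assumes g: "g > 0" and b: "b \<in> Vh k \<T>"
    and time: "is_interval I" "0 \<in> I" "I \<subseteq> {0..}" "I \<noteq> {0}"
    and sol: "dg_solution k \<T> \<E> g b I h u"
begin

abbreviation ht where "ht \<equiv> time_deriv I h"
abbreviation hut where "hut \<equiv> time_deriv I (\<lambda>s K x. h s K x *\<^sub>R u s K x)"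

text \<open>
  Derivatives within the time interval are unique, also at its endpoints.
\<close>

lemma at_nontrivial:
  assumes "t \<in> I"
  shows "at t within I \<noteq> bot"
proof -
  have "I \<noteq> {x}" for x using time(2,4) by blast
  then have "t islimpt I"
    using connected_imp_perfect[of I t] is_interval_connected[OF time(1)] assms by blast
  then show ?thesis by (simp add: trivial_limit_within)
qed

lemma solution_facts:
  assumes "t \<in> I"
  shows "h t \<in> Vh k \<T>" "u t \<in> VVh k \<T>"
    "\<And>K x. K \<in> \<T> \<Longrightarrow> x \<in> K \<Longrightarrow> h t K x > 0"
    "\<And>K x. K \<in> \<T> \<Longrightarrow> x \<in> K \<Longrightarrow> (\<lambda>s. h s K x) differentiable (at t within I)"
    "\<And>K x. K \<in> \<T> \<Longrightarrow> x \<in> K \<Longrightarrow> (\<lambda>s. u s K x) differentiable (at t within I)"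
    "\<And>e. e \<in> Vh k \<T> \<Longrightarrow> Mh \<T> (ht t) e + Ah \<T> \<E> g b (h t) (u t) e = 0"
    "\<And>v. v \<in> VVh k \<T> \<Longrightarrow> MMh \<T> (hut t) v
        + Bh \<T> \<E> g b (h t) (u t) v + Ch \<T> \<E> g b (h t) v
        - Mh \<T> (ht t) (\<lambda>K x. 1 / 2 * (u t K x \<bullet> v K x))
        - Ah \<T> \<E> g b (h t) (u t) (\<lambda>K x. 1 / 2 * (u t K x \<bullet> v K x)) = 0"
  using sol assms unfolding dg_solution_def by simp_all

lemma VhD: "v \<in> Vh k \<T> \<Longrightarrow> K \<in> \<T> \<Longrightarrow> v K \<in> polys k"
  by (simp add: Vh_def)

lemma VVhD: "v \<in> VVh k \<T> \<Longrightarrow> K \<in> \<T> \<Longrightarrow> (\<lambda>x. v K x $ i) \<in> polys k"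
  by (simp add: VVh_def Vh_def)

lemma h_poly: "t \<in> I \<Longrightarrow> K \<in> \<T> \<Longrightarrow> h t K \<in> polys k"
  and u_poly: "t \<in> I \<Longrightarrow> K \<in> \<T> \<Longrightarrow> (\<lambda>x. u t K x $ i) \<in> polys k"
  and b_poly: "K \<in> \<T> \<Longrightarrow> b K \<in> polys k"
  using VhD solution_facts(1) VVhD solution_facts(2) b by blast+

lemma broken_state_at:
  assumes "t \<in> I"
  shows "broken_state p q \<T> \<E> b (h t) (u t)"
  by unfold_locales (use h_poly[OF assms] u_poly[OF assms] b_poly polys_C1 in blast)+

lemma compact_element: "K \<in> \<T> \<Longrightarrow> compact K"
  using triangle_compact mesh_simplex by blast

lemma separable_h: "K \<in> \<T> \<Longrightarrow> separable I K (\<lambda>s. h s K)"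
  using separable_polys[of I "\<lambda>s. h s K" k K] h_poly solution_facts(4) by blast

lemma separable_u:
  assumes "K \<in> \<T>"
  shows "separable I K (\<lambda>s x. u s K x $ i)"
proof (rule separable_polys)
  show "(\<lambda>x. u s K x $ i) \<in> polys k" if "s \<in> I" for s using u_poly[OF that assms] .
  show "(\<lambda>s. u s K x $ i) differentiable (at t within I)" if "t \<in> I" "x \<in> K" for t x
    using differentiable_compose[OF bounded_linear_imp_differentiable[OF bounded_linear_vec_nth[of i]]
        solution_facts(5)[OF that(1) assms that(2)]] .
qed

lemma separable_b: "K \<in> \<T> \<Longrightarrow> separable I K (\<lambda>s. b K)"
  by (intro separable_space continuous_on_subset[OF C1_continuous[OF polys_C1[OF b_poly]]]) auto

lemma h_derivative:
  assumes "t \<in> I" "K \<in> \<T>" "x \<in> K"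
  shows "((\<lambda>s. h s K x) has_real_derivative ht t K x) (at t within I)"
  using solution_facts(4)[OF assms] vector_derivative_works
  unfolding time_deriv_def has_real_derivative_iff_has_vector_derivative by blast

lemma u_derivative:
  assumes "t \<in> I" "K \<in> \<T>" "x \<in> K"
  shows "((\<lambda>s. u s K x $ i) has_real_derivative time_deriv I u t K x $ i) (at t within I)"
  using solution_facts(5)[OF assms] unfolding time_deriv_def
  by (intro has_real_derivative_component) (simp add: vector_derivative_works)

lemma hu_derivative:
  assumes "t \<in> I" "K \<in> \<T>" "x \<in> K"
  shows "((\<lambda>s. h s K x * u s K x $ i) has_real_derivative hut t K x $ i) (at t within I)"
    "hut t K x $ i = ht t K x * u t K x $ i + h t K x * time_deriv I u t K x $ i"
proof -
  have "(\<lambda>s. h s K x *\<^sub>R u s K x) differentiable (at t within I)"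
    by (intro differentiable_scaleR solution_facts assms)
  then have "((\<lambda>s. h s K x *\<^sub>R u s K x) has_vector_derivative hut t K x) (at t within I)"
    unfolding time_deriv_def by (simp add: vector_derivative_works)
  from has_real_derivative_component[OF this, of i]
  show der: "((\<lambda>s. h s K x * u s K x $ i) has_real_derivative hut t K x $ i) (at t within I)" by simp
  have "((\<lambda>s. h s K x * u s K x $ i) has_real_derivative
      ht t K x * u t K x $ i + time_deriv I u t K x $ i * h t K x) (at t within I)"
    by (rule DERIV_mult[OF h_derivative[OF assms] u_derivative[OF assms]])
  from has_field_derivative_unique[OF der this at_nontrivial[OF assms(1)]]
  show "hut t K x $ i = ht t K x * u t K x $ i + h t K x * time_deriv I u t K x $ i" by simp
qed

lemma continuous_time_derivatives:
  assumes "t \<in> I" "K \<in> \<T>"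
  shows "continuous_on K (ht t K)" "continuous_on K (\<lambda>x. hut t K x $ i)"
  using has_derivative_integral_separable(2)[OF separable_h compact_element assms(1) at_nontrivial h_derivative]
    has_derivative_integral_separable(2)[OF separable_mult[OF separable_h separable_u] compact_element assms(1)
      at_nontrivial hu_derivative(1)] assms by blast+

lemma mass_balance:
  assumes t: "t \<in> I" and K: "K \<in> \<T>"
  shows "((\<lambda>s. integral K (h s K)) has_real_derivative
           - boundary_integral p q \<T> K (mass_flux g b (h t) (u t))) (at t within I)"
proof -
  interpret S: broken_state p q \<T> \<E> g b "h t" "u t" by (rule broken_state_at[OF t])
  have "element_indicator K 1 \<in> Vh k \<T>"
    unfolding Vh_def element_indicator_def by (simp add: polys_const)
  from solution_facts(6)[OF t this] have "Mh \<T> (ht t) (element_indicator K 1)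
      = - boundary_integral p q \<T> K (mass_flux g b (h t) (u t))"
    unfolding S.Ah_element_indicator[OF K] by simp
  moreover have "Mh \<T> (ht t) (element_indicator K 1) = integral K (ht t K)"
  proof -
    have "Mh \<T> (ht t) (element_indicator K 1) = (\<Sum>K'\<in>\<T>. if K' = K then integral K (ht t K) else 0)"
      unfolding Mh_def by (rule sum.cong) (auto simp: element_indicator_def)
    then show ?thesis using K finite_mesh by simp
  qed
  moreover have "((\<lambda>s. integral K (h s K)) has_real_derivative integral K (ht t K)) (at t within I)"
    by (rule has_derivative_integral_separable(1)[OF separable_h[OF K] compact_element[OF K] t at_nontrivial[OF t]
          h_derivative[OF t K]])
  ultimately show ?thesis by simp
qed

text \<open>
  With \<open>v\<close> the coordinate vector on \<open>K\<close>, half of \<open>u \<bullet> v\<close> is half a component of \<open>u\<close> on \<open>K\<close>, so the mass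
  equation removes the two correction terms.
\<close>

lemma momentum_rate:
  assumes t: "t \<in> I" and K: "K \<in> \<T>"
  shows "integral K (\<lambda>x. hut t K x $ i) = (- boundary_integral p q \<T> K (momentum_flux g b (h t) (u t))
      - integral K (\<lambda>x. (g * h t K x) *\<^sub>R grad (b K) x)
      + boundary_integral p q \<T> K (\<lambda>F x. (1 / 2 * g * h t K x * b K x) *\<^sub>R normal F)
      - boundary_integral p q \<T> K (\<lambda>F x.
          (1 / 2 * g * h t K x * (trace_minus F (h t) x + trace_minus F b x)) *\<^sub>R normal F)) $ i"
proof -
  interpret S: broken_state p q \<T> \<E> g b "h t" "u t" by (rule broken_state_at[OF t])
  let ?v = "element_indicator K (axis i 1) :: point broken"
  have v: "?v \<in> VVh k \<T>"
    unfolding VVh_def Vh_def element_indicator_def by (auto simp: polys_const)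
  have "(\<lambda>K' x. 1 / 2 * (u t K' x \<bullet> ?v K' x)) \<in> Vh k \<T>"
    unfolding Vh_def
  proof (intro CollectI ballI)
    fix K' assume K': "K' \<in> \<T>"
    show "(\<lambda>x. 1 / 2 * (u t K' x \<bullet> ?v K' x)) \<in> polys k"
    proof (cases "K' = K")
      case True
      then show ?thesis
        using polys_scale[OF u_poly[OF t K, of i], of "1 / 2"] by (simp add: element_indicator_def inner_axis)
    next
      case False
      then show ?thesis using polys_const[of 0] by (simp add: element_indicator_def)
    qed
  qed
  from solution_facts(6)[OF t this] solution_facts(7)[OF t v]
  have "MMh \<T> (hut t) ?v = - Bh \<T> \<E> g b (h t) (u t) ?v - Ch \<T> \<E> g b (h t) ?v" by linarith
  moreover have "MMh \<T> (hut t) ?v = integral K (\<lambda>x. hut t K x $ i)"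
  proof -
    have "MMh \<T> (hut t) ?v = (\<Sum>K'\<in>\<T>. if K' = K then integral K (\<lambda>x. hut t K x $ i) else 0)"
      unfolding MMh_def by (rule sum.cong) (auto simp: element_indicator_def inner_axis)
    then show ?thesis using K finite_mesh by simp
  qed
  ultimately show ?thesis
    using S.pressure_balance[OF K, of i] unfolding S.Bh_element_indicator[OF K] S.Ch_element_indicator[OF K]
    by simp
qed

lemma momentum_balance:
  assumes t: "t \<in> I" and K: "K \<in> \<T>"
  shows "((\<lambda>s. integral K (\<lambda>x. h s K x *\<^sub>R u s K x)) has_vector_derivative
      - boundary_integral p q \<T> K (momentum_flux g b (h t) (u t))
      - integral K (\<lambda>x. (g * h t K x) *\<^sub>R grad (b K) x)
      + boundary_integral p q \<T> K (\<lambda>F x. (1 / 2 * g * h t K x * b K x) *\<^sub>R normal F)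
      - boundary_integral p q \<T> K (\<lambda>F x.
          (1 / 2 * g * h t K x * (trace_minus F (h t) x + trace_minus F b x)) *\<^sub>R normal F)) (at t within I)"
    (is "(?f has_vector_derivative ?D) _")
proof -
  have comp: "((\<lambda>s. ?f s $ i) has_real_derivative ?D $ i) (at t within I)" for i
  proof (rule has_field_derivative_transform_within[OF _ zero_less_one t])
    show "((\<lambda>s. integral K (\<lambda>x. h s K x * u s K x $ i)) has_real_derivative ?D $ i) (at t within I)"
      unfolding momentum_rate[OF t K, symmetric]
      by (rule has_derivative_integral_separable(1)[OF separable_mult[OF separable_h[OF K] separable_u[OF K]]
            compact_element[OF K] t at_nontrivial[OF t] hu_derivative(1)[OF t K]])
    fix s assume s: "s \<in> I"
    interpret S: broken_state p q \<T> \<E> g b "h s" "u s" by (rule broken_state_at[OF s])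
    have "continuous_on K (\<lambda>x. h s K x *\<^sub>R u s K x)"
      using S.cont_hu K continuous_on_subset unfolding broken_continuous_def by blast
    from integral_component_eq_cart[OF integrable_on_compact[OF compact_element[OF K] this], of i]
    show "integral K (\<lambda>x. h s K x * u s K x $ i) = ?f s $ i" by simp
  qed
  show ?thesis by (rule has_vector_derivative_componentwise[OF comp])
qed

lemma time_derivative_integrable:
  assumes t: "t \<in> I" and K: "K \<in> \<T>"
  shows "(\<lambda>x. hut t K x \<bullet> u t K x) integrable_on K"
    "(\<lambda>x. ht t K x * (1 / 2 * (u t K x \<bullet> u t K x))) integrable_on K"
    "(\<lambda>x. ht t K x * (g * (h t K x + b K x))) integrable_on K"
proof -
  interpret S: broken_state p q \<T> \<E> g b "h t" "u t" by (rule broken_state_at[OF t])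
  have c: "continuous_on K f" if "continuous_on UNIV f" for f :: "point \<Rightarrow> 'a::euclidean_space"
    by (rule continuous_on_subset[OF that subset_UNIV])
  have cu: "continuous_on K (\<lambda>x. u t K x $ i)" for i
    by (rule c[OF C1_continuous[OF S.u_C1[OF K]]])
  note int = integrable_on_compact[OF compact_element[OF K]]
  have "continuous_on K (\<lambda>x. hut t K x $ 1 * u t K x $ 1 + hut t K x $ 2 * u t K x $ 2)"
    by (intro continuous_on_add continuous_on_mult continuous_time_derivatives(2)[OF t K] cu)
  then show "(\<lambda>x. hut t K x \<bullet> u t K x) integrable_on K"
    using int by (simp add: inner_vec_def sum_2)
  show "(\<lambda>x. ht t K x * (1 / 2 * (u t K x \<bullet> u t K x))) integrable_on K"
    by (intro int continuous_on_mult continuous_time_derivatives(1)[OF t K] c[OF C1_continuous[OF S.kinetic_C1(1)[OF K]]])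
  show "(\<lambda>x. ht t K x * (g * (h t K x + b K x))) integrable_on K"
    by (intro int continuous_on_mult continuous_time_derivatives(1)[OF t K] c[OF C1_continuous[OF S.surface_C1(2)[OF K]]])
qed

definition energy_density :: "real \<Rightarrow> elem \<Rightarrow> point \<Rightarrow> real" where
  "energy_density s K x = 1 / 2 * h s K x * (norm (u s K x))\<^sup>2 + 1 / 2 * g * (h s K x)\<^sup>2 + g * h s K x * b K x"

lemma energy_density_components:
  "energy_density s K x = 1 / 2 * (h s K x * (u s K x $ 1 * u s K x $ 1 + u s K x $ 2 * u s K x $ 2))
     + (1 / 2 * g * (h s K x * h s K x) + g * (h s K x * b K x))"
proof -
  have "(norm (u s K x))\<^sup>2 = u s K x $ 1 * u s K x $ 1 + u s K x $ 2 * u s K x $ 2"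
    by (simp add: power2_norm_eq_inner inner_vec_def sum_2)
  then show ?thesis unfolding energy_density_def by (simp add: power2_eq_square)
qed

lemma separable_energy_density:
  assumes K: "K \<in> \<T>"
  shows "separable I K (\<lambda>s. energy_density s K)"
proof -
  have "separable I K (\<lambda>s x. 1 / 2 * (h s K x * (u s K x $ 1 * u s K x $ 1 + u s K x $ 2 * u s K x $ 2))
     + (1 / 2 * g * (h s K x * h s K x) + g * (h s K x * b K x)))"
    by (intro separable_add separable_mult[OF separable_space[OF continuous_on_const]]
        separable_mult separable_h[OF K] separable_u[OF K] separable_b[OF K])
  then show ?thesis by (rule separable_cong) (rule energy_density_components)
qed

text \<open>
  The form on the right keeps the discharge derivative \<open>(h u)_t\<close> together, as it occurs in the scheme.
\<close>

lemma energy_density_derivative: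
  assumes t: "t \<in> I" and K: "K \<in> \<T>" and x: "x \<in> K"
  shows "((\<lambda>s. energy_density s K x) has_real_derivative
     hut t K x \<bullet> u t K x - ht t K x * (1 / 2 * (u t K x \<bullet> u t K x)) + ht t K x * (g * (h t K x + b K x)))
     (at t within I)"
proof -
  note dh = h_derivative[OF t K x] and du = u_derivative[OF t K x]
  let ?u' = "time_deriv I u t K x"
  have "((\<lambda>s. energy_density s K x) has_real_derivative
      1 / 2 * (ht t K x * (u t K x $ 1 * u t K x $ 1 + u t K x $ 2 * u t K x $ 2)
        + ((?u' $ 1 * u t K x $ 1 + ?u' $ 1 * u t K x $ 1) + (?u' $ 2 * u t K x $ 2 + ?u' $ 2 * u t K x $ 2)) * h t K x)
      + (1 / 2 * g * (ht t K x * h t K x + ht t K x * h t K x) + g * (ht t K x * b K x))) (at t within I)"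
    unfolding energy_density_components
    by (intro DERIV_add DERIV_cmult DERIV_mult DERIV_cmult_right dh du)
  moreover have "hut t K x \<bullet> u t K x = (ht t K x * u t K x $ 1 + h t K x * ?u' $ 1) * u t K x $ 1
      + (ht t K x * u t K x $ 2 + h t K x * ?u' $ 2) * u t K x $ 2"
    by (simp add: inner_vec_def sum_2 hu_derivative(2)[OF t K x])
  moreover have "u t K x \<bullet> u t K x = u t K x $ 1 * u t K x $ 1 + u t K x $ 2 * u t K x $ 2"
    by (simp add: inner_vec_def sum_2)
  ultimately show ?thesis by (simp add: algebra_simps)
qed

lemma entropy_balance:
  assumes t: "t \<in> I"
  shows "((\<lambda>s. entropy \<T> g b (h s) (u s)) has_real_derivative
           entropy_production \<E> g b (h t) (u t)) (at t within I)"
proof -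
  interpret S: broken_state p q \<T> \<E> g b "h t" "u t" by (rule broken_state_at[OF t])
  let ?k = "\<lambda>K x. 1 / 2 * (u t K x \<bullet> u t K x)"
  let ?gs = "\<lambda>K x. g * (h t K x + b K x)"
  have "((\<lambda>s. \<Sum>K\<in>\<T>. integral K (energy_density s K)) has_real_derivative
     (\<Sum>K\<in>\<T>. integral K (\<lambda>x. hut t K x \<bullet> u t K x - ht t K x * ?k K x + ht t K x * ?gs K x))) (at t within I)"
  proof (rule DERIV_sum)
    fix K assume K: "K \<in> \<T>"
    show "((\<lambda>s. integral K (energy_density s K)) has_real_derivative
       integral K (\<lambda>x. hut t K x \<bullet> u t K x - ht t K x * ?k K x + ht t K x * ?gs K x)) (at t within I)"
      by (rule has_derivative_integral_separable(1)[OF separable_energy_density[OF K] compact_element[OF K] t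
            at_nontrivial[OF t] energy_density_derivative[OF t K]])
  qed
  also have "(\<Sum>K\<in>\<T>. integral K (\<lambda>x. hut t K x \<bullet> u t K x - ht t K x * ?k K x + ht t K x * ?gs K x))
      = MMh \<T> (hut t) (u t) - Mh \<T> (ht t) ?k + Mh \<T> (ht t) ?gs"
    unfolding MMh_def Mh_def sum_subtractf[symmetric] sum.distrib[symmetric]
  proof (rule sum.cong[OF refl])
    fix K assume K: "K \<in> \<T>"
    note int = time_derivative_integrable[OF t K]
    show "integral K (\<lambda>x. hut t K x \<bullet> u t K x - ht t K x * ?k K x + ht t K x * ?gs K x)
      = integral K (\<lambda>x. hut t K x \<bullet> u t K x) - integral K (\<lambda>x. ht t K x * ?k K x) + integral K (\<lambda>x. ht t K x * ?gs K x)"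
      using integral_add[OF integrable_diff[OF int(1,2)] int(3)] integral_diff[OF int(1,2)] by simp
  qed
  also have "\<dots> = entropy_production \<E> g b (h t) (u t)"
  proof -
    have "?gs \<in> Vh k \<T>"
      unfolding Vh_def using h_poly[OF t] b_poly by (auto intro!: polys_scale polys_add)
    from solution_facts(6)[OF t this] solution_facts(7)[OF t solution_facts(2)[OF t]] S.entropy_identity
    show ?thesis by linarith
  qed
  finally show ?thesis unfolding entropy_def energy_density_def .
qed

lemma total_mass_conserved:
  assumes t: "t \<in> I"
  shows "((\<lambda>s. \<Sum>K\<in>\<T>. integral K (h s K)) has_real_derivative 0) (at t within I)"
proof -
  have "((\<lambda>s. \<Sum>K\<in>\<T>. integral K (h s K)) has_real_derivative (\<Sum>K\<in>\<T>. integral K (ht t K))) (at t within I)"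
    by (rule DERIV_sum, rule has_derivative_integral_separable(1)[OF separable_h compact_element t at_nontrivial[OF t] h_derivative[OF t]])
  moreover have "(\<Sum>K\<in>\<T>. integral K (ht t K)) = 0"
  proof -
    have "(\<lambda>K x. 1) \<in> Vh k \<T>" by (simp add: Vh_def polys_const)
    from solution_facts(6)[OF t this] have "Mh \<T> (ht t) (\<lambda>K x. 1) = - Ah \<T> \<E> g b (h t) (u t) (\<lambda>K x. 1)" by linarith
    also have "Ah \<T> \<E> g b (h t) (u t) (\<lambda>K x. 1) = 0"
      using edge_integral_zero[OF mesh_edge_oriented]
      by (simp add: Ah_def grad_const jump_def trace_plus_def trace_minus_def)
    finally show ?thesis by (simp add: Mh_def)
  qed
  ultimately show ?thesis by simp
qed

end

section \<open>Preservation of the lake at rest\<close>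

lemma gronwall_zero:
  fixes f :: "real \<Rightarrow> real"
  assumes t: "0 \<le> t" and der: "\<And>s. s \<in> {0..t} \<Longrightarrow> (f has_real_derivative f' s) (at s within {0..t})"
    and le: "\<And>s. s \<in> {0..t} \<Longrightarrow> f' s \<le> L * f s" and zero: "f 0 = 0"
  shows "f t \<le> 0"
proof -
  let ?G = "\<lambda>s. exp (- L * s) * f s"
  have G: "(?G has_real_derivative exp (- L * s) * (f' s - L * f s)) (at s within {0..t})" if "s \<in> {0..t}" for s
    by (auto intro!: derivative_eq_intros der[OF that] simp: algebra_simps)
  have "?G t \<le> ?G 0"
  proof (rule DERIV_nonpos_imp_decreasing_open[OF t])
    show "continuous_on {0..t} ?G"
      unfolding continuous_on_eq_continuous_within
      using G has_field_derivative_imp_has_derivative has_derivative_continuous by blast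
    fix s assume s: "0 < s" "s < t"
    have "at s within {0..t} = at s" using s by (simp add: at_within_Icc_at)
    then have "(?G has_real_derivative exp (- L * s) * (f' s - L * f s)) (at s)" using G[of s] s by simp
    moreover have "exp (- L * s) * (f' s - L * f s) \<le> 0"
      using le[of s] s by (intro mult_nonneg_nonpos) auto
    ultimately show "\<exists>y. (?G has_real_derivative y) (at s) \<and> y \<le> 0" by (intro exI conjI)
  qed
  then have "exp (- L * t) * f t \<le> 0" using zero by simp
  then show ?thesis by (simp add: mult_le_0_iff)
qed

lemma finite_uniform_bound:
  fixes Q :: "'a \<Rightarrow> real \<Rightarrow> bool"
  assumes "finite A" and ex: "\<And>a. a \<in> A \<Longrightarrow> \<exists>B. Q a B"
    and mono: "\<And>a B B'. a \<in> A \<Longrightarrow> Q a B \<Longrightarrow> B \<le> B' \<Longrightarrow> Q a B'"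
  shows "\<exists>B. \<forall>a\<in>A. Q a B"
proof -
  obtain B where B: "\<And>a. a \<in> A \<Longrightarrow> Q a (B a)" using ex by metis
  have "Q a (\<Sum>a\<in>A. \<bar>B a\<bar>)" if "a \<in> A" for a
  proof (rule mono[OF that B[OF that]])
    have "\<bar>B a\<bar> \<le> (\<Sum>a\<in>A. \<bar>B a\<bar>)" by (rule member_le_sum[OF that _ assms(1)]) simp
    then show "B a \<le> (\<Sum>a\<in>A. \<bar>B a\<bar>)" by simp
  qed
  then show ?thesis by blast
qed

lemma separable_bounded:
  assumes f: "separable I K f" and K: "compact K" and J: "compact J" "J \<subseteq> I"
  shows "\<exists>B. \<forall>s\<in>J. \<forall>x\<in>K. \<bar>f s x\<bar> \<le> B"
proof -
  have "continuous_on (J \<times> K) (\<lambda>(s, x). f s x)"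
    by (rule continuous_on_subset[OF separable_continuous[OF f]]) (use J in auto)
  then have "bounded ((\<lambda>(s, x). f s x) ` (J \<times> K))"
    by (intro compact_imp_bounded compact_continuous_image compact_Times J K)
  then obtain B where "\<forall>y\<in>(\<lambda>(s, x). f s x) ` (J \<times> K). norm y \<le> B" unfolding bounded_iff by blast
  then show ?thesis by (intro exI[of _ B]) auto
qed

text \<open>
  The bound is stated through a multiple of \<open>f\<close> because this form is monotone in \<open>B\<close>, as
  \<open>finite_uniform_bound\<close> requires.
\<close>

lemma separable_bounded_below:
  assumes f: "separable I K f" and K: "compact K" and J: "compact J" "J \<subseteq> I"
    and pos: "\<And>s x. s \<in> J \<Longrightarrow> x \<in> K \<Longrightarrow> f s x > 0"
  shows "\<exists>B\<ge>0. \<forall>s\<in>J. \<forall>x\<in>K. 1 \<le> B * f s x"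
proof (cases "J \<times> K = {}")
  case False
  have "continuous_on (J \<times> K) (\<lambda>(s, x). f s x)"
    by (rule continuous_on_subset[OF separable_continuous[OF f]]) (use J in auto)
  from continuous_attains_inf[OF compact_Times[OF J(1) K] False this]
  obtain s0 x0 where min: "s0 \<in> J" "x0 \<in> K" "\<And>s x. s \<in> J \<Longrightarrow> x \<in> K \<Longrightarrow> f s0 x0 \<le> f s x" by auto
  have le: "1 \<le> 1 / f s0 x0 * f s x" if "s \<in> J" "x \<in> K" for s x
    using min(3)[OF that] pos[OF min(1,2)] by simp
  have "0 \<le> 1 / f s0 x0" using pos[OF min(1,2)] by simp
  then show ?thesis by (intro exI[of _ "1 / f s0 x0"] conjI ballI le)
qed auto

context dg_scheme
begin

lemma Icc_subset:
  assumes "t \<in> I"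
  shows "{0..t} \<subseteq> I"
proof
  fix s assume "s \<in> {0..t}"
  then have "0 \<le> s" "s \<le> t" by simp_all
  then show "s \<in> I" by (rule mem_is_interval_1_I[OF time(1,2) assms])
qed

lemma solution_bounded:
  assumes t: "t \<in> I"
  obtains H where "\<And>s K x. s \<in> {0..t} \<Longrightarrow> K \<in> \<T> \<Longrightarrow> x \<in> K \<Longrightarrow>
    \<bar>h s K x\<bar> \<le> H \<and> \<bar>b K x\<bar> \<le> H \<and> norm (u s K x) \<le> H"
proof -
  have "\<exists>H. \<forall>K\<in>\<T>. \<forall>s\<in>{0..t}. \<forall>x\<in>K. \<bar>h s K x\<bar> \<le> H \<and> \<bar>b K x\<bar> \<le> H \<and> norm (u s K x) \<le> H"
  proof (rule finite_uniform_bound[OF finite_mesh])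
    fix K assume K: "K \<in> \<T>"
    note bd = separable_bounded[OF _ compact_element[OF K] compact_Icc Icc_subset[OF t]]
    obtain B1 where B1: "\<forall>s\<in>{0..t}. \<forall>x\<in>K. \<bar>h s K x\<bar> \<le> B1" using bd[OF separable_h[OF K]] by (rule exE)
    obtain B2 where B2: "\<forall>s\<in>{0..t}. \<forall>x\<in>K. \<bar>b K x\<bar> \<le> B2" using bd[OF separable_b[OF K]] by (rule exE)
    obtain B3 where B3: "\<forall>s\<in>{0..t}. \<forall>x\<in>K. \<bar>u s K x $ 1\<bar> \<le> B3" using bd[OF separable_u[OF K]] by (rule exE)
    obtain B4 where B4: "\<forall>s\<in>{0..t}. \<forall>x\<in>K. \<bar>u s K x $ 2\<bar> \<le> B4" using bd[OF separable_u[OF K]] by (rule exE)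
    have "\<bar>h s K x\<bar> \<le> \<bar>B1\<bar> + \<bar>B2\<bar> + (\<bar>B3\<bar> + \<bar>B4\<bar>) \<and> \<bar>b K x\<bar> \<le> \<bar>B1\<bar> + \<bar>B2\<bar> + (\<bar>B3\<bar> + \<bar>B4\<bar>)
        \<and> norm (u s K x) \<le> \<bar>B1\<bar> + \<bar>B2\<bar> + (\<bar>B3\<bar> + \<bar>B4\<bar>)" if "s \<in> {0..t}" "x \<in> K" for s x
    proof -
      have "norm (u s K x) \<le> \<bar>u s K x $ 1\<bar> + \<bar>u s K x $ 2\<bar>"
        using norm_le_l1_cart[of "u s K x"] by (simp add: sum_2)
      moreover have "\<bar>h s K x\<bar> \<le> B1" "\<bar>b K x\<bar> \<le> B2" "\<bar>u s K x $ 1\<bar> \<le> B3" "\<bar>u s K x $ 2\<bar> \<le> B4"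
        using B1 B2 B3 B4 that by auto
      ultimately show ?thesis by linarith
    qed
    then show "\<exists>H. \<forall>s\<in>{0..t}. \<forall>x\<in>K. \<bar>h s K x\<bar> \<le> H \<and> \<bar>b K x\<bar> \<le> H \<and> norm (u s K x) \<le> H"
      by (intro exI[of _ "\<bar>B1\<bar> + \<bar>B2\<bar> + (\<bar>B3\<bar> + \<bar>B4\<bar>)"]) simp
  qed (fastforce intro: order_trans)
  then show thesis using that by blast
qed

lemma height_bounded_below:
  assumes t: "t \<in> I"
  obtains B where "\<And>s K x. s \<in> {0..t} \<Longrightarrow> K \<in> \<T> \<Longrightarrow> x \<in> K \<Longrightarrow> 1 \<le> B * h s K x"
proof -
  have pos: "h s K x > 0" if "s \<in> {0..t}" "K \<in> \<T>" "x \<in> K" for s K x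
    using solution_facts(3)[of s K x] Icc_subset[OF t] that by blast
  have "\<exists>B. \<forall>K\<in>\<T>. \<forall>s\<in>{0..t}. \<forall>x\<in>K. 1 \<le> B * h s K x"
  proof (rule finite_uniform_bound[OF finite_mesh])
    fix K assume K: "K \<in> \<T>"
    show "\<exists>B. \<forall>s\<in>{0..t}. \<forall>x\<in>K. 1 \<le> B * h s K x"
      using separable_bounded_below[OF separable_h[OF K] compact_element[OF K] compact_Icc Icc_subset[OF t] pos[OF _ K]]
      by blast
  next
    fix K B B' assume K: "K \<in> \<T>" and B: "\<forall>s\<in>{0..t}. \<forall>x\<in>K. 1 \<le> B * h s K x" "B \<le> (B' :: real)"
    show "\<forall>s\<in>{0..t}. \<forall>x\<in>K. 1 \<le> B' * h s K x"
    proof (intro ballI)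
      fix s x assume s: "s \<in> {0..t}" and x: "x \<in> K"
      have "1 \<le> B * h s K x" using B(1) s x by blast
      also have "\<dots> \<le> B' * h s K x" by (rule mult_right_mono[OF B(2) less_imp_le[OF pos[OF s K x]]])
      finally show "1 \<le> B' * h s K x" .
    qed
  qed
  then show thesis using that by blast
qed

lemma polys_bounded_uniformly:
  obtains C where "C \<ge> 0" "\<And>K f x. K \<in> \<T> \<Longrightarrow> f \<in> polys k \<Longrightarrow> x \<in> K \<Longrightarrow> (f x)\<^sup>2 \<le> C * integral K (\<lambda>y. (f y)\<^sup>2)"
proof -
  have "\<exists>C. \<forall>K\<in>\<T>. \<forall>f\<in>polys k. \<forall>x\<in>K. (f x)\<^sup>2 \<le> C * integral K (\<lambda>y. (f y)\<^sup>2)"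
  proof (rule finite_uniform_bound[OF finite_mesh])
    fix K assume "K \<in> \<T>"
    then have S: "2 simplex K" by (rule mesh_simplex)
    obtain C where "\<And>f x. f \<in> polys k \<Longrightarrow> x \<in> K \<Longrightarrow> (f x)\<^sup>2 \<le> C * integral K (\<lambda>y. (f y)\<^sup>2)"
      by (rule polys_bounded_by_L2[OF triangle_compact[OF S] triangle_convex[OF S] triangle_interior[OF S], of k]) (rule that)
    then show "\<exists>C. \<forall>f\<in>polys k. \<forall>x\<in>K. (f x)\<^sup>2 \<le> C * integral K (\<lambda>y. (f y)\<^sup>2)"
      by (intro exI[of _ C] ballI)
  next
    fix K C C' assume K: "K \<in> \<T>" and C: "\<forall>f\<in>polys k. \<forall>x\<in>K. (f x)\<^sup>2 \<le> C * integral K (\<lambda>y. (f y)\<^sup>2)" "C \<le> (C' :: real)"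
    show "\<forall>f\<in>polys k. \<forall>x\<in>K. (f x)\<^sup>2 \<le> C' * integral K (\<lambda>y. (f y)\<^sup>2)"
    proof (intro ballI)
      fix f x assume f: "f \<in> polys k" and x: "x \<in> K"
      have "0 \<le> integral K (\<lambda>y. (f y)\<^sup>2)"
        by (intro integral_nonneg integrable_on_compact[OF compact_element[OF K]] continuous_on_power
            continuous_on_subset[OF C1_continuous[OF polys_C1[OF f]]]) auto
      then have "C * integral K (\<lambda>y. (f y)\<^sup>2) \<le> C' * integral K (\<lambda>y. (f y)\<^sup>2)"
        by (rule mult_right_mono[OF C(2)])
      with bspec[OF bspec[OF C(1) f] x] show "(f x)\<^sup>2 \<le> C' * integral K (\<lambda>y. (f y)\<^sup>2)" by (rule order_trans)
    qed
  qed
  then obtain C where C: "\<forall>K\<in>\<T>. \<forall>f\<in>polys k. \<forall>x\<in>K. (f x)\<^sup>2 \<le> C * integral K (\<lambda>y. (f y)\<^sup>2)" by (rule exE)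
  show thesis
  proof (rule that[of "max C 0"])
    fix K f x assume K: "K \<in> \<T>" and f: "f \<in> polys k" and x: "x \<in> K"
    have "0 \<le> integral K (\<lambda>y. (f y)\<^sup>2)"
      by (intro integral_nonneg integrable_on_compact[OF compact_element[OF K]] continuous_on_power
          continuous_on_subset[OF C1_continuous[OF polys_C1[OF f]]]) auto
    then have "C * integral K (\<lambda>y. (f y)\<^sup>2) \<le> max C 0 * integral K (\<lambda>y. (f y)\<^sup>2)"
      by (intro mult_right_mono) auto
    with bspec[OF bspec[OF bspec[OF C K] f] x]
    show "(f x)\<^sup>2 \<le> max C 0 * integral K (\<lambda>y. (f y)\<^sup>2)" by (rule order_trans)
  qed simp
qed

text \<open>
  The energy relative to the lake at rest with surface level \<open>C\<close>. It differs from the energy density by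
  \<open>- g C h\<close>, whose integral is conserved, and by a function independent of time.
\<close>

definition relative_energy :: "real \<Rightarrow> real \<Rightarrow> elem \<Rightarrow> point \<Rightarrow> real" where
  "relative_energy C s K x = 1 / 2 * h s K x * (norm (u s K x))\<^sup>2 + 1 / 2 * g * (h s K x + b K x - C)\<^sup>2"

definition total_relative_energy :: "real \<Rightarrow> real \<Rightarrow> real" where
  "total_relative_energy C s = (\<Sum>K\<in>\<T>. integral K (relative_energy C s K))"

lemma continuous_state:
  assumes s: "s \<in> I" and K: "K \<in> \<T>"
  shows "continuous_on K (h s K)" "continuous_on K (b K)" "continuous_on K (u s K)"
proof -
  interpret S: broken_state p q \<T> \<E> g b "h s" "u s" by (rule broken_state_at[OF s])
  show "continuous_on K (h s K)" "continuous_on K (b K)" "continuous_on K (u s K)"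
    using S.cont_h S.cont_b S.cont_u K continuous_on_subset unfolding broken_continuous_def by blast+
qed

lemma relative_energy_facts:
  assumes s: "s \<in> I" and K: "K \<in> \<T>"
  shows "continuous_on K (relative_energy C s K)" "relative_energy C s K integrable_on K"
    "\<And>x. x \<in> K \<Longrightarrow> 0 \<le> relative_energy C s K x" "0 \<le> integral K (relative_energy C s K)"
proof -
  note c = continuous_state[OF s K]
  show cont: "continuous_on K (relative_energy C s K)"
    unfolding relative_energy_def
    by (intro continuous_on_add continuous_on_mult continuous_on_const continuous_on_power continuous_on_norm
        continuous_on_diff c)
  show int: "relative_energy C s K integrable_on K" by (rule integrable_on_compact[OF compact_element[OF K] cont])
  show nonneg: "0 \<le> relative_energy C s K x" if "x \<in> K" for x
    using solution_facts(3)[OF s K that] g by (simp add: relative_energy_def)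
  show "0 \<le> integral K (relative_energy C s K)" by (rule integral_nonneg[OF int nonneg])
qed

lemma total_relative_energy_eq:
  assumes s: "s \<in> I"
  shows "total_relative_energy C s = entropy \<T> g b (h s) (u s) - g * C * (\<Sum>K\<in>\<T>. integral K (h s K))
    + (\<Sum>K\<in>\<T>. integral K (\<lambda>x. 1 / 2 * g * (b K x - C)\<^sup>2))"
  unfolding total_relative_energy_def entropy_def sum_distrib_left sum_subtractf[symmetric] sum.distrib[symmetric]
proof (rule sum.cong[OF refl])
  fix K assume K: "K \<in> \<T>"
  note c = continuous_state[OF s K]
  let ?e = "\<lambda>x. 1 / 2 * h s K x * (norm (u s K x))\<^sup>2 + 1 / 2 * g * (h s K x)\<^sup>2 + g * h s K x * b K x"
  let ?c = "\<lambda>x. 1 / 2 * g * (b K x - C)\<^sup>2"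
  have e: "?e integrable_on K" and ch: "(\<lambda>x. g * C * h s K x) integrable_on K" and cb: "?c integrable_on K"
    by (intro integrable_on_compact[OF compact_element[OF K]] continuous_on_add continuous_on_mult continuous_on_const
        continuous_on_power continuous_on_norm continuous_on_diff c)+
  have "integral K (relative_energy C s K) = integral K (\<lambda>x. ?e x - g * C * h s K x + ?c x)"
    by (intro integral_cong) (simp add: relative_energy_def power2_eq_square field_simps)
  also have "\<dots> = integral K ?e - g * C * integral K (h s K) + integral K ?c"
    using integral_add[OF integrable_diff[OF e ch] cb] integral_diff[OF e ch] by simp
  finally show "integral K (relative_energy C s K) = integral K ?e - g * C * integral K (h s K) + integral K ?c" .
qed

lemma total_relative_energy_derivative:
  assumes t: "t \<in> I"
  shows "(total_relative_energy C has_real_derivative entropy_production \<E> g b (h t) (u t)) (at t within I)"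
proof (rule has_field_derivative_transform_within[OF _ zero_less_one t])
  show "((\<lambda>s. entropy \<T> g b (h s) (u s) - g * C * (\<Sum>K\<in>\<T>. integral K (h s K))
    + (\<Sum>K\<in>\<T>. integral K (\<lambda>x. 1 / 2 * g * (b K x - C)\<^sup>2))) has_real_derivative
      entropy_production \<E> g b (h t) (u t)) (at t within I)"
    using DERIV_add[OF DERIV_diff[OF entropy_balance[OF t] DERIV_cmult[OF total_mass_conserved[OF t]]] DERIV_const]
    by simp
qed (simp add: total_relative_energy_eq)

text \<open>
  \<open>C\<close> bounds point values by mean squares and \<open>1 / B\<close> bounds the water height from below.
\<close>

lemma velocity_le_relative_energy:
  assumes s: "s \<in> I" and K: "K \<in> \<T>" and x: "x \<in> K"
    and C: "C \<ge> 0" "\<And>f x. f \<in> polys k \<Longrightarrow> x \<in> K \<Longrightarrow> (f x)\<^sup>2 \<le> C * integral K (\<lambda>y. (f y)\<^sup>2)"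
    and B: "\<And>x. x \<in> K \<Longrightarrow> 1 \<le> B * h s K x"
  shows "u s K x \<bullet> u s K x \<le> 2 * C * B * total_relative_energy C0 s"
proof -
  note c = continuous_state[OF s K] and int = integrable_on_compact[OF compact_element[OF K]]
  have "0 < B * h s K x" using B[OF x] by simp
  then have B0: "B > 0" by (rule zero_less_mult_pos2) (rule solution_facts(3)[OF s K x])
  have ci: "continuous_on K (\<lambda>x. (u s K x $ i)\<^sup>2)" for i
    by (intro continuous_on_power continuous_on_component c)
  have uu: "u s K y \<bullet> u s K y = (u s K y $ 1)\<^sup>2 + (u s K y $ 2)\<^sup>2" for y
    by (simp add: inner_vec_def sum_2 power2_eq_square)
  have "u s K x \<bullet> u s K x \<le> C * integral K (\<lambda>y. (u s K y $ 1)\<^sup>2) + C * integral K (\<lambda>y. (u s K y $ 2)\<^sup>2)"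
    unfolding uu by (intro add_mono C(2)[OF u_poly[OF s K] x])
  also have "\<dots> = C * integral K (\<lambda>y. u s K y \<bullet> u s K y)"
    unfolding uu by (simp add: integral_add[OF int[OF ci] int[OF ci]] distrib_left)
  also have "\<dots> \<le> C * integral K (\<lambda>y. 2 * B * relative_energy C0 s K y)"
  proof (intro mult_left_mono C(1) integral_le)
    show "(\<lambda>y. u s K y \<bullet> u s K y) integrable_on K" by (intro int continuous_on_inner c)
    show "(\<lambda>y. 2 * B * relative_energy C0 s K y) integrable_on K"
      by (intro int continuous_on_mult continuous_on_const relative_energy_facts(1)[OF s K])
    fix y assume y: "y \<in> K"
    have "u s K y \<bullet> u s K y \<le> B * h s K y * (u s K y \<bullet> u s K y)"
      using mult_right_mono[OF B[OF y], of "u s K y \<bullet> u s K y"] by simp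
    also have "\<dots> \<le> B * h s K y * (u s K y \<bullet> u s K y) + B * g * (h s K y + b K y - C0)\<^sup>2"
      using B0 g by simp
    also have "\<dots> = 2 * B * relative_energy C0 s K y"
      by (simp add: relative_energy_def power2_norm_eq_inner algebra_simps)
    finally show "u s K y \<bullet> u s K y \<le> 2 * B * relative_energy C0 s K y" .
  qed
  also have "\<dots> = 2 * C * B * integral K (relative_energy C0 s K)" by simp
  also have "\<dots> \<le> 2 * C * B * total_relative_energy C0 s"
    unfolding total_relative_energy_def
    using C(1) B0 relative_energy_facts(4)[OF s]
    by (intro mult_left_mono member_le_sum[OF K _ finite_mesh]) auto
  finally show ?thesis .
qed

text \<open>
  Everything in the production except the velocity jump is bounded on the compact time interval, and the
  square of the jump is bounded by the relative energy.
\<close>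

lemma production_le_relative_energy:
  assumes t: "t \<in> I"
  obtains L where "\<And>s. s \<in> {0..t} \<Longrightarrow> entropy_production \<E> g b (h s) (u s) \<le> L * total_relative_energy C0 s"
proof -
  obtain H where H: "\<And>s K x. s \<in> {0..t} \<Longrightarrow> K \<in> \<T> \<Longrightarrow> x \<in> K \<Longrightarrow>
    \<bar>h s K x\<bar> \<le> H \<and> \<bar>b K x\<bar> \<le> H \<and> norm (u s K x) \<le> H" using solution_bounded[OF t] by blast
  obtain B where B: "\<And>s K x. s \<in> {0..t} \<Longrightarrow> K \<in> \<T> \<Longrightarrow> x \<in> K \<Longrightarrow> 1 \<le> B * h s K x"
    using height_bounded_below[OF t] by blast
  obtain C where C: "C \<ge> 0" "\<And>K f x. K \<in> \<T> \<Longrightarrow> f \<in> polys k \<Longrightarrow> x \<in> K \<Longrightarrow> (f x)\<^sup>2 \<le> C * integral K (\<lambda>y. (f y)\<^sup>2)"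
    using polys_bounded_uniformly by blast
  \<comment> \<open>\<open>A\<close> bounds \<open>alpha\<close>; the square of a velocity jump is at most four times the larger squared trace.\<close>
  define A where "A = sqrt (g * H) + H"
  define M where "M s = 1 / 2 * A * (2 * H * (4 * (2 * C * B * total_relative_energy C0 s)))" for s
  have "entropy_production \<E> g b (h s) (u s) \<le> M s * (\<Sum>F\<in>\<E>. edge_integral F (\<lambda>x. 1))" if s: "s \<in> {0..t}" for s
  proof -
    have sI: "s \<in> I" using Icc_subset[OF t] s by blast
    interpret S: broken_state p q \<T> \<E> g b "h s" "u s" by (rule broken_state_at[OF sI])
    let ?e = "2 * C * B * total_relative_energy C0 s"
    show ?thesis
    proof (rule S.entropy_production_le[OF g solution_facts(3)[OF sI]])
      fix F x assume FE: "F \<in> \<E>" and x: "x \<in> edge_set F"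
      have F: "F \<in> \<O>" by (rule mesh_edge_oriented[OF FE])
      note D = oriented_edgesD[OF F]
      have xp: "x \<in> Kplus F" and xm: "x - shift F \<in> Kminus F" using x unfolding edge_set_def by auto
      note Hp = H[OF s D(1) xp] and Hm = H[OF s D(2) xm]
      have H0: "H \<ge> 0" using Hp norm_ge_zero order_trans by blast
      let ?n = "normal F"
      have n: "norm ?n = 1"
        using edge_neighbours[OF F] normal_facts(1)[of F] by metis
      have "\<bar>w \<bullet> ?n\<bar> \<le> H" if "norm w \<le> H" for w
        using Cauchy_Schwarz_ineq2[of w ?n] n that by simp
      moreover have "sqrt (g * z) \<le> sqrt (g * H)" if "\<bar>z\<bar> \<le> H" for z
        using that g by (intro real_sqrt_le_mono mult_left_mono) auto
      ultimately have al: "alpha g (h s) (u s) F x \<le> A"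
        unfolding alpha_def A_def trace_plus_def trace_minus_def using Hp Hm
        by (intro max.boundedI add_mono) auto
      have al0: "0 \<le> alpha g (h s) (u s) F x"
        by (rule S.alpha_nonneg[OF g solution_facts(3)[OF sI] F x])
      let ?v = "trace_plus F (u s) x" and ?w = "trace_minus F (u s) x"
      have "?v \<bullet> ?v \<le> ?e" "?w \<bullet> ?w \<le> ?e"
        unfolding trace_plus_def trace_minus_def
        using velocity_le_relative_energy[OF sI D(1) xp C(1) C(2)[OF D(1)] B[OF s D(1)]]
          velocity_le_relative_energy[OF sI D(2) xm C(1) C(2)[OF D(2)] B[OF s D(2)]] by auto
      moreover have "jump F (u s) x \<bullet> jump F (u s) x \<le> 2 * (?v \<bullet> ?v) + 2 * (?w \<bullet> ?w)"
        using inner_ge_zero[of "?v + ?w"] by (simp add: jump_def inner_add_left inner_add_right inner_diff_left inner_diff_right inner_commute)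
      ultimately have ju: "jump F (u s) x \<bullet> jump F (u s) x \<le> 4 * ?e" by linarith
      have av: "- avg F (\<lambda>K y. h s K y + b K y) x \<le> 2 * H"
      proof -
        have "- h s (Kplus F) x \<le> H" "- b (Kplus F) x \<le> H"
          "- h s (Kminus F) (x - shift F) \<le> H" "- b (Kminus F) (x - shift F) \<le> H"
          using Hp Hm by auto
        then show ?thesis unfolding avg_def trace_plus_def trace_minus_def by (simp add: field_simps)
      qed
      have e0: "0 \<le> 4 * ?e" using ju inner_ge_zero order_trans by blast
      have "- avg F (\<lambda>K y. h s K y + b K y) x * (jump F (u s) x \<bullet> jump F (u s) x) \<le> 2 * H * (4 * ?e)"
      proof (rule order_trans[OF mult_right_mono[OF av inner_ge_zero]])
        show "2 * H * (jump F (u s) x \<bullet> jump F (u s) x) \<le> 2 * H * (4 * ?e)"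
          by (rule mult_left_mono[OF ju]) (use H0 in simp)
      qed
      then have "1 / 2 * alpha g (h s) (u s) F x * (- avg F (\<lambda>K y. h s K y + b K y) x * (jump F (u s) x \<bullet> jump F (u s) x))
          \<le> 1 / 2 * alpha g (h s) (u s) F x * (2 * H * (4 * ?e))"
        using al0 by (intro mult_left_mono) auto
      also have "\<dots> \<le> M s"
        unfolding M_def
      proof (rule mult_right_mono)
        show "1 / 2 * alpha g (h s) (u s) F x \<le> 1 / 2 * A" using al by simp
        show "0 \<le> 2 * H * (4 * ?e)" by (rule mult_nonneg_nonneg[OF _ e0]) (use H0 in simp)
      qed
      finally show "- (1 / 2 * alpha g (h s) (u s) F x * (avg F (\<lambda>K y. h s K y + b K y) x * (jump F (u s) x \<bullet> jump F (u s) x))) \<le> M s"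
        by simp
    qed
  qed
  then show thesis
    by (intro that[of "1 / 2 * A * (2 * H * (4 * (2 * C * B))) * (\<Sum>F\<in>\<E>. edge_integral F (\<lambda>x. 1))"])
      (simp add: M_def mult_ac)
qed

lemma well_balanced:
  assumes init: "\<And>K x. K \<in> \<T> \<Longrightarrow> x \<in> K \<Longrightarrow> u 0 K x = 0 \<and> h 0 K x + b K x = C"
    and t: "t \<in> I" and K: "K \<in> \<T>" and x: "x \<in> K"
  shows "u t K x = 0 \<and> h t K x + b K x = C"
proof -
  have t0: "0 \<le> t" using time(3) t by auto
  obtain L where L: "\<And>s. s \<in> {0..t} \<Longrightarrow> entropy_production \<E> g b (h s) (u s) \<le> L * total_relative_energy C s"
    using production_le_relative_energy[OF t] by blast
  have "total_relative_energy C 0 = (\<Sum>K\<in>\<T>. integral K (\<lambda>x. 0))"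
    unfolding total_relative_energy_def
    by (intro sum.cong refl integral_cong) (simp add: relative_energy_def init)
  then have "total_relative_energy C 0 = 0" by simp
  then have "total_relative_energy C t \<le> 0"
    using Icc_subset[OF t]
    by (intro gronwall_zero[OF t0 _ L] DERIV_subset[OF total_relative_energy_derivative]) auto
  then have "integral K (relative_energy C t K) = 0"
    using member_le_sum[OF K _ finite_mesh, of "\<lambda>K. integral K (relative_energy C t K)"]
      relative_energy_facts(4)[OF t] K unfolding total_relative_energy_def by (force intro: antisym)
  moreover note S = triangle_compact[OF mesh_simplex[OF K]] triangle_convex[OF mesh_simplex[OF K]]
    triangle_interior[OF mesh_simplex[OF K]]
  ultimately have "relative_energy C t K x = 0"
    using integral_zero_imp_zero[OF S relative_energy_facts(1)[OF t K] relative_energy_facts(3)[OF t K] _ x]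
    by blast
  moreover have "h t K x > 0" by (rule solution_facts(3)[OF t K x])
  ultimately show ?thesis using g by (simp add: relative_energy_def add_nonneg_eq_0_iff)
qed

end

(* The three conjuncts are (a), (b), (c). Two points differ from the printed text, which is false
   there as it stands: the last boundary integral of the momentum balance (the pressure exchanged
   with the neighbouring elements) is missing in print, and the sign of the entropy production
   needs a nonnegative mean surface level {h + b} on the edges. *)
theorem theorem2p1:
  fixes p q :: point and \<T> :: "elem set" and \<E> :: "edge set"
    and k :: nat and g :: real and b :: "real broken"
    and I :: "real set" and h :: "real \<Rightarrow> real broken" and u :: "real \<Rightarrow> point broken"
  assumes mesh: "periodic_triangulation p q \<T>"
    and edges: "mesh_edges p q \<T> \<E>"
    and g: "g > 0"
    and b: "b \<in> Vh k \<T>"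
    and time: "is_interval I" "0 \<in> I" "I \<subseteq> {0..}" "I \<noteq> {0}"
    and sol: "dg_solution k \<T> \<E> g b I h u"
  shows
    "(\<forall>t\<in>I. \<forall>K\<in>\<T>.
        ((\<lambda>s. integral K (h s K)) has_real_derivative
           - boundary_integral p q \<T> K (mass_flux g b (h t) (u t))) (at t within I) \<and>
        ((\<lambda>s. integral K (\<lambda>x. h s K x *\<^sub>R u s K x)) has_vector_derivative
           - boundary_integral p q \<T> K (momentum_flux g b (h t) (u t))
           - integral K (\<lambda>x. (g * h t K x) *\<^sub>R grad (b K) x)
           + boundary_integral p q \<T> K (\<lambda>F x. (1 / 2 * g * h t K x * b K x) *\<^sub>R normal F)
           - boundary_integral p q \<T> K (\<lambda>F x.
               (1 / 2 * g * h t K x * (trace_minus F (h t) x + trace_minus F b x)) *\<^sub>R normal F))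
          (at t within I))
     \<and>
     (\<forall>t\<in>I.
        ((\<lambda>s. entropy \<T> g b (h s) (u s)) has_real_derivative
           entropy_production \<E> g b (h t) (u t)) (at t within I) \<and>
        ((\<forall>F\<in>\<E>. \<forall>x\<in>edge_set F. avg F (\<lambda>K y. h t K y + b K y) x \<ge> 0)
           \<longrightarrow> entropy_production \<E> g b (h t) (u t) \<le> 0))
     \<and>
     (\<forall>C. (\<forall>K\<in>\<T>. \<forall>x\<in>K. u 0 K x = 0 \<and> h 0 K x + b K x = C)
        \<longrightarrow> (\<forall>t\<in>I. \<forall>K\<in>\<T>. \<forall>x\<in>K. u t K x = 0 \<and> h t K x + b K x = C))"
proof -
  interpret dg_scheme p q \<T> \<E> k g b I h u
    by unfold_locales (fact assms)+
  have production: "entropy_production \<E> g b (h t) (u t) \<le> 0"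
    if t: "t \<in> I" and avg: "\<forall>F\<in>\<E>. \<forall>x\<in>edge_set F. avg F (\<lambda>K y. h t K y + b K y) x \<ge> 0" for t
    by (rule broken_state.entropy_production_nonpos[OF broken_state_at[OF t] g solution_facts(3)[OF t] bspec[OF bspec[OF avg]]])
  show ?thesis
  proof (intro conjI ballI impI allI)
    fix C t K x
    assume init: "\<forall>K\<in>\<T>. \<forall>x\<in>K. u 0 K x = 0 \<and> h 0 K x + b K x = C" and "t \<in> I" "K \<in> \<T>" "x \<in> K"
    then have "u t K x = 0 \<and> h t K x + b K x = C"
      by (intro well_balanced[OF bspec[OF bspec[OF init]]])
    then show "u t K x = 0" "h t K x + b K x = C" by (rule conjunct1, rule conjunct2)
  qed (fact mass_balance momentum_balance entropy_balance production | assumption)+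
qed

end
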